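(* Let $x\in D_1$, $\nu\in\mathbb{C}$, $\mu\in\mathbb{C}\setminus\mathbb{Z}$ with $\nu+\mu\notin-\mathbb{N}$. Then $$\mathsf{Q}_\nu^\mu(x)=\frac{(1+x)^\nu}{2^{\nu+1}}\Bigg[\cos(\pi\mu)\Gamma(\mu)\left(\frac{1+x}{1-x}\right)^{\frac12\mu}{}_2F_1\!\left(-\nu,-\nu-\mu;1-\mu;\frac{x-1}{x+1}\right)+\frac{\Gamma(\nu+\mu+1)\Gamma(-\mu)}{\Gamma(\nu-\mu+1)}\left(\frac{1-x}{1+x}\right)^{\frac12\mu}{}_2F_1\!\left(-\nu,\mu-\nu;1+\mu;\frac{x-1}{x+1}\right)\Bigg].$$
   Context: $\mathbb{N}=\{1,2,3,\dots\}$, $-\mathbb{N}=\{-1,-2,\dots\}$. $D_1=\mathbb{C}\setminus((-\infty,-1]\cup[1,\infty))$, $D_2=\mathbb{C}\setminus(-\infty,1]$. Complex powers are principal values. ${}_2F_1(a,b;c;w)$ is the Gauss hypergeometric function, principal branch on $\mathbb{C}\setminus[1,\infty)$ (the analytic continuation of $\sum_{n\ge0}\frac{(a)_n(b)_n}{(c)_n}\frac{w^n}{n!}$). $1/\Gamma$ is read as the entire function (zero at the poles of $\Gamma$), and a quotient ${}_2F_1(a,b;c;w)/\Gamma(c)$ with $c\in\{0,-1,-2,\dots\}$ is read as the regularized function (continuous in $c$). Associated Legendre function of the second kind: for $z\in D_2$, $\nu+\mu\in\mathbb{C}\setminus-\mathbb{N}$, $$Q_\nu^\mu(z)=\frac{\sqrt{\pi}\,e^{i\pi\mu}\Gamma(\nu+\mu+1)(z^2-1)^{\frac12\mu}}{2^{\nu+1}\Gamma(\nu+\frac32)z^{\nu+\mu+1}}\,{}_2F_1\!\left(\tfrac{\nu+\mu+2}{2},\tfrac{\nu+\mu+1}{2};\nu+\tfrac32;\tfrac1{z^2}\right),$$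 where $(z^2-1)^\alpha:=(z+1)^\alpha(z-1)^\alpha$. Ferrers function of the second kind: for $x\in(-1,1)$, $$\mathsf{Q}_\nu^\mu(x)=\tfrac12\big[e^{-\frac12 i\pi\mu}\,e^{-i\pi\mu}Q_\nu^\mu(x+i0)+e^{\frac12 i\pi\mu}\,e^{-i\pi\mu}Q_\nu^\mu(x-i0)\big],$$ where $x\pm i0$ denotes the limit from the upper/lower half-plane, and $\mathsf{Q}_\nu^\mu$ is extended analytically to $D_1$. *)

theory Defs
  imports "HOL-Complex_Analysis.Complex_Analysis"
begin

text \<open>
  The analytic continuation to \<open>D\<close> of a function \<open>f\<close> that is prescribed on \<open>S\<close>. For \<open>D\<close> open and
  connected and \<open>S \<subseteq> D\<close> with a limit point in \<open>D\<close>, its values on \<open>D\<close> do not depend on the choice.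
\<close>
definition analytic_extension ::
  "(complex \<Rightarrow> complex) \<Rightarrow> complex set \<Rightarrow> complex set \<Rightarrow> complex \<Rightarrow> complex" where
  "analytic_extension f S D = (SOME g. g holomorphic_on D \<and> (\<forall>z\<in>S. g z = f z))"

lemma analytic_extension_eqI:
  assumes "g holomorphic_on D" "\<And>z. z \<in> S \<Longrightarrow> g z = f z"
    and "open D" "connected D" "S \<subseteq> D" "a \<in> D" "a islimpt S" "z \<in> D"
  shows "analytic_extension f S D z = g z"
proof -
  define h where "h = analytic_extension f S D"
  have "h holomorphic_on D \<and> (\<forall>z\<in>S. h z = f z)"
    unfolding h_def analytic_extension_def
    by (rule someI[of "\<lambda>g. g holomorphic_on D \<and> (\<forall>z\<in>S. g z = f z)" g]) (use assms in auto)
  then have "h z - g z = 0"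
    using assms by (intro analytic_continuation[of "\<lambda>w. h w - g w" D S a z] holomorphic_intros) auto
  then show ?thesis
    by (simp add: h_def)
qed

definition hyp2F1_domain :: "complex set" where
  "hyp2F1_domain = - (of_real ` {1..})"

definition hyp2F1 :: "complex \<Rightarrow> complex \<Rightarrow> complex \<Rightarrow> complex \<Rightarrow> complex" where
  "hyp2F1 a b c = analytic_extension
     (\<lambda>w. \<Sum>n. pochhammer a n * pochhammer b n / pochhammer c n * (w ^ n / fact n))
     (ball 0 1) hyp2F1_domain"

text \<open>
  The regularized function \<open>hyp2F1 a b c w / Gamma c\<close>. As \<open>1 / (Gamma c * pochhammer c n)\<close> is
  \<open>rGamma (c + of_nat n)\<close>, this form of the series is entire in \<open>c\<close>, including \<open>c = 0, -1, -2, ...\<close>.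
\<close>
definition hyp2F1_reg :: "complex \<Rightarrow> complex \<Rightarrow> complex \<Rightarrow> complex \<Rightarrow> complex" where
  "hyp2F1_reg a b c = analytic_extension
     (\<lambda>w. \<Sum>n. pochhammer a n * pochhammer b n * rGamma (c + of_nat n) * (w ^ n / fact n))
     (ball 0 1) hyp2F1_domain"

lemma hyp2F1_reg_coeff:
  fixes a b c :: complex
  assumes "c \<notin> \<int>\<^sub>\<le>\<^sub>0"
  shows "pochhammer a n * pochhammer b n * rGamma (c + of_nat n) =
         pochhammer a n * pochhammer b n / pochhammer c n / Gamma c"
proof -
  have "pochhammer c n \<noteq> 0"
    using assms by (auto simp: pochhammer_eq_0_iff)
  moreover have "rGamma c = pochhammer c n * rGamma (c + of_nat n)"
    by (rule pochhammer_rGamma)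
  ultimately show ?thesis
    by (simp add: Gamma_def field_simps)
qed

text \<open>
  The associated Legendre function of the second kind. The formula is meant for \<open>z\<close> off the cut
  \<open>(-\<infinity>, 1]\<close>, and \<open>(z\<^sup>2 - 1) powr (\<mu> / 2)\<close> is read as \<open>(z + 1) powr (\<mu> / 2) * (z - 1) powr (\<mu> / 2)\<close>.
\<close>
definition legendre_Q :: "complex \<Rightarrow> complex \<Rightarrow> complex \<Rightarrow> complex" where
  "legendre_Q \<nu> \<mu> z =
     of_real (sqrt pi) * exp (\<i> * of_real pi * \<mu>) * Gamma (\<nu> + \<mu> + 1) *
     ((z + 1) powr (\<mu> / 2) * (z - 1) powr (\<mu> / 2)) /
     (2 powr (\<nu> + 1) * z powr (\<nu> + \<mu> + 1)) *
     hyp2F1_reg ((\<nu> + \<mu> + 2) / 2) ((\<nu> + \<mu> + 1) / 2) (\<nu> + 3 / 2) (1 / z\<^sup>2)"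

definition ferrers_Q_cut :: "complex \<Rightarrow> complex \<Rightarrow> complex \<Rightarrow> complex" where
  "ferrers_Q_cut \<nu> \<mu> x =
     1 / 2 *
     (exp (- (\<i> * of_real pi * \<mu> / 2)) * exp (- (\<i> * of_real pi * \<mu>)) *
        Lim (at x within {z. Im z > 0}) (legendre_Q \<nu> \<mu>) +
      exp (\<i> * of_real pi * \<mu> / 2) * exp (- (\<i> * of_real pi * \<mu>)) *
        Lim (at x within {z. Im z < 0}) (legendre_Q \<nu> \<mu>))"

definition D1 :: "complex set" where
  "D1 = - (of_real ` ({..-1} \<union> {1..}))"

definition ferrers_Q :: "complex \<Rightarrow> complex \<Rightarrow> complex \<Rightarrow> complex" where
  "ferrers_Q \<nu> \<mu> = analytic_extension (ferrers_Q_cut \<nu> \<mu>) (of_real ` {-1<..<1}) D1"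

end

theory Submission
  imports Defs
begin

text \<open>
  Off the cut \<open>(-\<infinity>, 1]\<close>, \<open>Q\<close> equals \<open>(z\<^sup>2 - 1)\<^bsup>\<mu>/2\<^esup>\<close> times a solution, prescribed at \<open>\<infinity>\<close>, of the Gegenbauer
  equation \<open>(z\<^sup>2 - 1) u'' + 2 (\<mu> + 1) z u' - (\<nu> - \<mu>) (\<nu> + \<mu> + 1) u = 0\<close>. It is a combination of the two
  Frobenius solutions at \<open>z = 1\<close>, and the Wronskians give the coefficients: the one of the singular
  solution follows for \<open>Re \<mu> > 0\<close> from an Abelian theorem for the hypergeometric series at \<open>1\<close>, for all
  other \<open>\<mu>\<close> from the derivative relation \<open>\<mu> \<rightarrow> \<mu> + 1\<close>, and the one of the regular solution from Euler's
  transformation, which exchanges \<open>\<mu>\<close> and \<open>-\<mu>\<close>. The two Frobenius solutions have obvious limits on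
  both sides of \<open>(-1, 1)\<close>, and Pfaff's transformation turns the result into the claimed formula.

  As \<open>hyp2F1\<close> is defined by choosing a continuation, the existence of one has to be proved: with
  \<open>w = 4 s / (1 + s)\<^sup>2\<close>, which maps the unit disc onto the plane slit along \<open>[1, \<infinity>)\<close>, the function
  \<open>(1 + s)\<^bsup>-2a\<^esup> F(a, b; c; w)\<close> is a power series in \<open>s\<close> whose coefficients satisfy a three-term
  recurrence, so that it converges in the whole disc.
\<close>

text \<open>Dividing out (z^2 - 1)^(\<mu>/2) lets differentiation act as the shift from \<mu> to
  \<mu> + 1, up to a constant factor, on all three solutions. The Abelian theorem sees only the
  dominant term at z = 1: for Re \<mu> > 0 the solution with exponent 0 is hidden behind (z -
  1)^(-\<mu>), so the two coefficients need different arguments. Regularization by 1/Gamma(c) is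
  forced, as c = \<nu> + 3/2 may be a nonpositive integer. Transformations of the series rest on one
  principle: both sides solve the same hypergeometric equation and agree at 0. It fails at c = -m,
  where the regularized series has no term below w^(m+1); there an index shift leads back to c = m +
  2. The cosine in the claim is a mean of phases: with the factors in the definition of the Ferrers
  function included, the term with Gamma(\<mu>) carries e^(-i pi \<mu>) from above and e^(i pi
  \<mu>) from below, while the phases of the other term cancel.\<close>

unbundle no vec_syntax

subsection \<open>The regularized hypergeometric series\<close>

text \<open>The limiting characteristic equation x^2 = 1 has only roots of modulus one, so
  \<open>k n\<close> grows at most like R^n for every R > 1.\<close>

lemma conv_radius_ge_1_of_recurrence:
  fixes k p q :: "nat \<Rightarrow> complex"
  assumes rec: "eventually (\<lambda>n. k (n + 2) = p n * k (n + 1) + q n * k n) sequentially"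
    and p: "p \<longlonglongrightarrow> 0" and q: "q \<longlonglongrightarrow> 1"
  shows "conv_radius k \<ge> 1"
proof (rule conv_radius_geI_ex')
  fix r :: real
  assume r: "0 < r" "ereal r < 1"
  \<comment> \<open>The midpoint of 1 and 1/r: growth like R^n still leaves a convergent series at
    r.\<close>
  define R where "R = (1 + 1 / r) / 2"
  have R: "R > 1" "R * r < 1"
    using r by (auto simp: R_def field_simps)
  \<comment> \<open>The limit is 1 < R^2, so from some index on the bound C R^n reproduces itself
    under the recurrence.\<close>
  have "(\<lambda>n. norm (p n) * R + norm (q n)) \<longlonglongrightarrow> norm (0::complex) * R + norm (1::complex)"
    by (intro tendsto_intros p q)
  moreover have "norm (0::complex) * R + norm (1::complex) < R\<^sup>2"
    using R by (simp add: one_less_power)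
  ultimately have "eventually (\<lambda>n. norm (p n) * R + norm (q n) < R\<^sup>2) sequentially"
    by (rule order_tendstoD)
  then have "eventually (\<lambda>n. norm (p n) * R + norm (q n) < R\<^sup>2 \<and>
      k (n + 2) = p n * k (n + 1) + q n * k n) sequentially"
    using rec by eventually_elim auto
  then obtain N where N: "\<And>n. n \<ge> N \<Longrightarrow> norm (p n) * R + norm (q n) < R\<^sup>2"
      "\<And>n. n \<ge> N \<Longrightarrow> k (n + 2) = p n * k (n + 1) + q n * k n"
    unfolding eventually_sequentially by blast
  define C where "C = norm (k N) / R ^ N + norm (k (Suc N)) / R ^ Suc N"
  have C0: "C \<ge> 0"
    using R by (auto simp: C_def)
  have bound: "norm (k n) \<le> C * R ^ n" if "n \<ge> N" for n
    using that
  proof (induction n rule: less_induct)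
    case (less n)
    have "n = N \<or> n = Suc N \<or> (\<exists>m\<ge>N. n = m + 2)"
      using less.prems by presburger
    then consider "n = N" | "n = Suc N" | m where "n = m + 2" "m \<ge> N"
      by blast
    then show ?case
    proof cases
      case 3
      have "norm (k n) \<le> norm (p m) * norm (k (m + 1)) + norm (q m) * norm (k m)"
        unfolding 3 N(2)[OF 3(2)] by (metis norm_mult norm_triangle_ineq)
      also have "\<dots> \<le> norm (p m) * (C * R ^ (m + 1)) + norm (q m) * (C * R ^ m)"
        by (intro add_mono mult_left_mono less.IH) (use 3 in auto)
      also have "\<dots> = C * R ^ m * (norm (p m) * R + norm (q m))"
        by (simp add: algebra_simps)
      also have "\<dots> \<le> C * R ^ m * R\<^sup>2"
        using N(1)[OF 3(2)] C0 R by (intro mult_left_mono) auto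
      finally show ?thesis
        using 3 by (simp add: power_add mult_ac power2_eq_square)
    qed (use R in \<open>auto simp: C_def field_simps\<close>)
  qed
  show "summable (\<lambda>n. k n * of_real r ^ n)"
  proof (rule summable_comparison_test')
    show "summable (\<lambda>n. C * (R * r) ^ n)"
      using R r by (intro summable_mult summable_geometric) auto
    show "norm (k n * of_real r ^ n) \<le> C * (R * r) ^ n" if "n \<ge> N" for n
      using mult_right_mono[OF bound[OF that], of "r ^ n"] r
      by (simp add: norm_mult norm_power power_mult_distrib mult_ac)
  qed
qed

lemma eventually_add_nat_neq_0: "eventually (\<lambda>n. c + of_nat n \<noteq> (0::complex)) sequentially"
proof -
  have "eventually (\<lambda>n. real n > - Re c) sequentially"
    using filterlim_real_sequentially by (simp add: filterlim_at_top_dense)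
  then show ?thesis
    by eventually_elim (auto simp: complex_eq_iff)
qed

lemma tendsto_linear_ratio:
  "(\<lambda>n. (a + of_nat n) / (c + of_nat n) :: complex) \<longlonglongrightarrow> 1"
proof -
  have "(\<lambda>n. (a / of_nat n + 1) / (c / of_nat n + 1) :: complex) \<longlonglongrightarrow> (0 + 1) / (0 + 1)"
    by (intro tendsto_intros tendsto_divide_0[OF tendsto_const] tendsto_of_nat) auto
  moreover have "eventually (\<lambda>n. (a / of_nat n + 1) / (c / of_nat n + 1) =
      (a + of_nat n) / (c + of_nat n)) sequentially"
    using eventually_gt_at_top[of 0] by eventually_elim (simp add: divide_simps)
  ultimately show ?thesis
    by (simp add: filterlim_cong)
qed

section \<open>The regularized series and its differential equation\<close>

definition hyp_fps :: "complex \<Rightarrow> complex \<Rightarrow> complex \<Rightarrow> complex fps" where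
  "hyp_fps a b c = Abs_fps (\<lambda>n. pochhammer a n * pochhammer b n * rGamma (c + of_nat n) / fact n)"

text \<open>Meant for the unit disc only; on the rest of the slit plane \<open>hyp2F1_reg\<close>
  takes its place.\<close>

definition Freg :: "complex \<Rightarrow> complex \<Rightarrow> complex \<Rightarrow> complex \<Rightarrow> complex" where
  "Freg a b c = eval_fps (hyp_fps a b c)"

lemma rGamma_shift: "rGamma (z + of_nat n) = (z + of_nat n) * rGamma (z + 1 + of_nat n)"
  for z :: complex
  using rGamma_plus1[of "z + of_nat n"] by (simp add: add_ac)

text \<open>Kept free of division, because c + n may vanish and the identity is needed for every
  c.\<close>

lemma hyp_fps_rec:
  "of_nat (Suc n) * (c + of_nat n) * hyp_fps a b c $ Suc n =
   (a + of_nat n) * (b + of_nat n) * hyp_fps a b c $ n"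
proof -
  have "of_nat (Suc n) \<noteq> (0::complex)"
    using of_nat_neq_0 by blast
  then show ?thesis
    using rGamma_shift[of c n]
    by (simp add: hyp_fps_def pochhammer_Suc add_ac divide_simps del: of_nat_Suc) (simp add: algebra_simps)
qed

text \<open>The coefficient recurrence has order one; two steps of it form an order-two recurrence
  with p = 0. The ratio makes sense only where c + n is nonzero, which holds for all large
  n.\<close>

lemma fps_conv_radius_hyp_fps: "fps_conv_radius (hyp_fps a b c) \<ge> 1"
  unfolding fps_conv_radius_def
proof (rule conv_radius_ge_1_of_recurrence)
  define r where "r n = ((a + of_nat n) / (c + of_nat n)) * ((b + of_nat n) / (1 + of_nat n))" for n
  have r1: "r \<longlonglongrightarrow> 1 * 1"
    unfolding r_def by (intro tendsto_mult tendsto_linear_ratio)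
  show "(\<lambda>n. r (Suc n) * r n) \<longlonglongrightarrow> 1"
    using tendsto_mult[OF LIMSEQ_Suc[OF r1] r1] by simp
  have eq: "hyp_fps a b c $ Suc n = r n * hyp_fps a b c $ n" if "c + of_nat n \<noteq> 0" for n
  proof -
    have "1 + of_nat n \<noteq> (0::complex)"
      by (metis of_nat_Suc of_nat_neq_0)
    have "r n * hyp_fps a b c $ n =
        ((a + of_nat n) * (b + of_nat n) * hyp_fps a b c $ n) / (of_nat (Suc n) * (c + of_nat n))"
      by (simp add: r_def mult_ac)
    also have "\<dots> = hyp_fps a b c $ Suc n"
      unfolding hyp_fps_rec[symmetric] using that \<open>1 + of_nat n \<noteq> 0\<close> by simp
    finally show ?thesis ..
  qed
  have "eventually (\<lambda>n. c + of_nat (Suc n) \<noteq> 0) sequentially"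
    using eventually_add_nat_neq_0 by (rule eventually_sequentially_Suc[THEN iffD2])
  then show "eventually (\<lambda>n. hyp_fps a b c $ (n + 2) =
      0 * hyp_fps a b c $ (n + 1) + r (Suc n) * r n * hyp_fps a b c $ n) sequentially"
    using eventually_add_nat_neq_0[of c]
    by eventually_elim (use eq in \<open>simp del: of_nat_Suc\<close>)
qed auto

lemma norm_less_hyp_fps_radius:
  assumes "norm w < 1"
  shows "ereal (norm w) < fps_conv_radius (hyp_fps a b c)"
  using less_le_trans[OF _ fps_conv_radius_hyp_fps, of "ereal (norm w)"] assms by simp

text \<open>The n-th coefficient of the differential expression is the difference of the two sides
  of the recurrence. One direction gives \<open>Freg_ode\<close>, the other
  \<open>hyp_ode_unique\<close>.\<close>

lemma fps_ode_hyp_iff: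
  "fps_X * fps_deriv (fps_deriv F) - fps_X * (fps_X * fps_deriv (fps_deriv F)) +
     fps_const c * fps_deriv F - fps_const (a + b + 1) * (fps_X * fps_deriv F) -
     fps_const (a * b) * F = 0 \<longleftrightarrow>
   (\<forall>n. of_nat (Suc n) * (c + of_nat n) * F $ Suc n = (a + of_nat n) * (b + of_nat n) * F $ n)"
  (is "?E = 0 \<longleftrightarrow> _") for F :: "complex fps"
proof -
  have "?E $ n = of_nat (Suc n) * (c + of_nat n) * F $ Suc n - (a + of_nat n) * (b + of_nat n) * F $ n"
    for n
  proof (cases n)
    case (Suc m)
    then show ?thesis
      by (cases m) (simp, simp add: algebra_simps)+
  qed simp
  then show ?thesis
    by (simp add: fps_eq_iff)
qed

text \<open>Regularization absorbs the usual factor 1/c, so the rule has no exceptional c.\<close>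

lemma fps_deriv_hyp_fps:
  "fps_deriv (hyp_fps a b c) = fps_const (a * b) * hyp_fps (a + 1) (b + 1) (c + 1)"
proof (rule fps_ext)
  fix n
  have "of_nat (Suc n) \<noteq> (0::complex)"
    using of_nat_neq_0 by blast
  then show "fps_deriv (hyp_fps a b c) $ n = (fps_const (a * b) * hyp_fps (a + 1) (b + 1) (c + 1)) $ n"
    by (simp add: hyp_fps_def pochhammer_rec add_ac divide_simps del: of_nat_Suc) (simp add: algebra_simps)
qed

lemma eval_fps_const_mult:
  "norm z < fps_conv_radius F \<Longrightarrow> eval_fps (fps_const c * F) z = c * eval_fps F z"
  for F :: "complex fps"
  by (simp add: eval_fps_mult)

lemma less_fps_conv_radius_arith:
  fixes G H :: "complex fps"
  assumes "x < fps_conv_radius G" "x < fps_conv_radius H"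
  shows "x < fps_conv_radius (G * H)" "x < fps_conv_radius (G + H)" "x < fps_conv_radius (G - H)"
  using assms
  by (intro less_le_trans[OF _ fps_conv_radius_mult] less_le_trans[OF _ fps_conv_radius_add]
        less_le_trans[OF _ fps_conv_radius_diff]; simp)+

lemma has_field_derivative_Freg:
  assumes "norm w < 1"
  shows "(Freg a b c has_field_derivative a * b * Freg (a + 1) (b + 1) (c + 1) w) (at w within S)"
  unfolding Freg_def
  using has_field_derivative_eval_fps[OF norm_less_hyp_fps_radius[OF assms, of a b c], of S]
  by (simp add: fps_deriv_hyp_fps eval_fps_const_mult norm_less_hyp_fps_radius assms)

lemma has_field_derivative_Freg_compose [derivative_intros]:
  assumes "(g has_field_derivative g') (at w within S)" "norm (g w) < 1"
  shows "((\<lambda>w. Freg a b c (g w)) has_field_derivative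
           a * b * Freg (a + 1) (b + 1) (c + 1) (g w) * g') (at w within S)"
  using DERIV_chain2[OF has_field_derivative_Freg assms(1)] assms(2) by simp

lemma Freg_0: "Freg a b c 0 = rGamma c"
  by (simp add: Freg_def eval_fps_at_0 hyp_fps_def)

lemma Freg_commute: "Freg a b c = Freg b a c"
  by (simp add: Freg_def hyp_fps_def mult.commute)

lemma Freg_ode:
  assumes w: "norm w < 1"
  shows "w * (1 - w) * (a * b * (a + 1) * (b + 1) * Freg (a + 2) (b + 2) (c + 2) w) +
    (c - (a + b + 1) * w) * (a * b * Freg (a + 1) (b + 1) (c + 1) w) - a * b * Freg a b c w = 0"
proof -
  define F where "F = hyp_fps a b c"
  have d: "fps_deriv (fps_deriv F) = fps_const (a * b * (a + 1) * (b + 1)) * hyp_fps (a + 2) (b + 2) (c + 2)"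
    by (simp add: F_def fps_deriv_hyp_fps add.assoc mult.assoc flip: fps_const_mult)
  have d1: "fps_deriv F = fps_const (a * b) * hyp_fps (a + 1) (b + 1) (c + 1)"
    by (simp add: F_def fps_deriv_hyp_fps)
  have rad: "norm w < fps_conv_radius (hyp_fps a b c)" for a b c
    using norm_less_hyp_fps_radius[OF w] .
  have E: "fps_X * fps_deriv (fps_deriv F) - fps_X * (fps_X * fps_deriv (fps_deriv F)) +
     fps_const c * fps_deriv F - fps_const (a + b + 1) * (fps_X * fps_deriv F) -
     fps_const (a * b) * F = 0"
    unfolding fps_ode_hyp_iff F_def using hyp_fps_rec by blast
  have "eval_fps 0 w = (0::complex)"
    by (simp add: eval_fps_def)
  with arg_cong[OF E[unfolded d, unfolded d1], of "\<lambda>G. eval_fps G w"] show ?thesis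
    unfolding F_def
    by (simp add: rad less_fps_conv_radius_arith eval_fps_add eval_fps_diff eval_fps_mult Freg_def)
      (simp add: algebra_simps)
qed

text \<open>The factor (n + 1) (c + n) of the next coefficient never vanishes, so the value at 0
  fixes the whole power series of an analytic solution. The radius is left free because Pfaff's
  transformation is available only on a smaller disc.\<close>

lemma hyp_ode_unique:
  assumes c: "c \<notin> \<int>\<^sub>\<le>\<^sub>0" and r: "0 < r" "r \<le> 1"
    and f: "\<And>w. norm w < r \<Longrightarrow> (f has_field_derivative f' w) (at w)"
    and f': "\<And>w. norm w < r \<Longrightarrow> (f' has_field_derivative f'' w) (at w)"
    and ode: "\<And>w. norm w < r \<Longrightarrow>
      w * (1 - w) * f'' w + (c - (a + b + 1) * w) * f' w - a * b * f w = 0"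
    and w: "norm w < r"
  shows "f w = f 0 * Gamma c * Freg a b c w"
proof -
  define F where "F = fps_expansion f 0"
  have holo: "f holomorphic_on ball 0 r"
    by (rule holomorphic_onI) (auto simp: field_differentiable_def dest!: f intro: has_field_derivative_at_within)
  have F: "f has_fps_expansion F"
    unfolding F_def using r holo by (intro has_fps_expansion_fps_expansion[of "ball 0 r"]) auto
  have near: "eventually (\<lambda>w. w \<in> ball 0 r) (nhds (0::complex))"
    using r by (intro eventually_nhds_in_open) auto
  have F1: "f' has_fps_expansion fps_deriv F"
  proof (rule has_fps_expansion_cong[THEN iffD1])
    show "deriv f has_fps_expansion fps_deriv F"
      by (intro fps_expansion_intros F)
    show "eventually (\<lambda>w. deriv f w = f' w) (nhds 0)"
      using near by eventually_elim (auto intro!: DERIV_imp_deriv f)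
  qed auto
  have F2: "f'' has_fps_expansion fps_deriv (fps_deriv F)"
  proof (rule has_fps_expansion_cong[THEN iffD1])
    show "deriv f' has_fps_expansion fps_deriv (fps_deriv F)"
      by (intro fps_expansion_intros F1)
    show "eventually (\<lambda>w. deriv f' w = f'' w) (nhds 0)"
      using near by eventually_elim (auto intro!: DERIV_imp_deriv f')
  qed auto
  have "(\<lambda>w. w * f'' w - w * (w * f'' w) + c * f' w - (a + b + 1) * (w * f' w) - a * b * f w)
     has_fps_expansion fps_X * fps_deriv (fps_deriv F) - fps_X * (fps_X * fps_deriv (fps_deriv F)) +
     fps_const c * fps_deriv F - fps_const (a + b + 1) * (fps_X * fps_deriv F) -
     fps_const (a * b) * F"
    by (intro fps_expansion_intros F F1 F2)
  moreover have "(\<lambda>w. w * f'' w - w * (w * f'' w) + c * f' w - (a + b + 1) * (w * f' w) - a * b * f w)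
     has_fps_expansion 0"
  proof (rule has_fps_expansion_cong[THEN iffD2])
    show "eventually (\<lambda>w. w * f'' w - w * (w * f'' w) + c * f' w - (a + b + 1) * (w * f' w) - a * b * f w
        = 0) (nhds 0)"
      using near by eventually_elim (use ode in \<open>simp add: algebra_simps\<close>)
  qed auto
  ultimately have rec: "of_nat (Suc n) * (c + of_nat n) * F $ Suc n = (a + of_nat n) * (b + of_nat n) * F $ n"
    for n using fps_expansion_unique_complex fps_ode_hyp_iff by blast
  have nz: "c + of_nat n \<noteq> 0" for n
    using c by (metis add.commute add_eq_0_iff minus_of_nat_in_nonpos_Ints)
  have "F $ n = f 0 * Gamma c * hyp_fps a b c $ n" for n
  proof (induction n)
    case 0
    have "F $ 0 = f 0"
      by (simp add: F_def fps_expansion_def)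
    then show ?case
      using c by (simp add: hyp_fps_def rGamma_inverse_Gamma Gamma_eq_zero_iff)
  next
    case (Suc n)
    have "of_nat (Suc n) \<noteq> (0::complex)"
      using of_nat_neq_0 by blast
    moreover have "of_nat (Suc n) * (c + of_nat n) * F $ Suc n =
        of_nat (Suc n) * (c + of_nat n) * (f 0 * Gamma c * hyp_fps a b c $ Suc n)"
      using rec[of n] Suc hyp_fps_rec[of n c a b] by (simp add: mult_ac del: of_nat_Suc) 
    ultimately show ?case
      using nz[of n] by simp
  qed
  then have "F = fps_const (f 0 * Gamma c) * hyp_fps a b c"
    by (simp add: fps_eq_iff)
  moreover have "eval_fps F w = f w"
    using F w holo by (rule has_fps_expansion_imp_eval_fps_eq)
  ultimately show ?thesis
    using r w by (simp add: Freg_def eval_fps_const_mult norm_less_hyp_fps_radius)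
qed

subsection \<open>Continuation to the slit plane\<close>

text \<open>The coefficients in s of (1 + s)^(-2a) F(a, b; c; 4s/(1 + s)^2), normalized to 1 at s =
  0 rather than regularized; the recurrence is \<open>quad_ode\<close> read coefficient by
  coefficient.\<close>

fun quad_coeff :: "complex \<Rightarrow> complex \<Rightarrow> complex \<Rightarrow> nat \<Rightarrow> complex" where
  "quad_coeff a b c 0 = 1"
| "quad_coeff a b c (Suc 0) = - 2 * (c - 2 * b) * a / c"
| "quad_coeff a b c (Suc (Suc n)) =
     (- 2 * (c - 2 * b) * (of_nat n + 1 + a) * quad_coeff a b c (Suc n) +
      (of_nat n + 2 * a) * (of_nat n + 1 + 2 * a - c) * quad_coeff a b c n) /
     ((of_nat n + 2) * (of_nat n + 1 + c))"

lemma conv_radius_quad_coeff: "conv_radius (quad_coeff a b c) \<ge> 1"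
proof (rule conv_radius_ge_1_of_recurrence)
  \<comment> \<open>The coefficient of the middle term has one linear factor in n fewer above than
    below, so it tends to 0.\<close>
  have lim: "(\<lambda>n. (x + of_nat n) / (y + of_nat n) * z / (u + of_nat n) :: complex) \<longlonglongrightarrow> 0" for x y z u
  proof -
    have "filterlim (\<lambda>n. u + of_nat n :: complex) at_infinity sequentially"
      by (rule tendsto_add_filterlim_at_infinity[OF tendsto_const tendsto_of_nat])
    then show ?thesis
      by (intro tendsto_divide_0[OF tendsto_mult[OF tendsto_linear_ratio tendsto_const]])
  qed
  show "(\<lambda>n. (1 + a + of_nat n) / (2 + of_nat n) * (- 2 * (c - 2 * b)) / (1 + c + of_nat n)) \<longlonglongrightarrow> 0"
    by (rule lim)
  show "(\<lambda>n. (2 * a + of_nat n) / (2 + of_nat n) *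
      ((1 + 2 * a - c + of_nat n) / (1 + c + of_nat n))) \<longlonglongrightarrow> 1"
    using tendsto_mult[OF tendsto_linear_ratio tendsto_linear_ratio] by simp
  have aux: "(- 2 * C * A * x + P * Q * y) / (u * v) = A / u * (- 2 * C) / v * x + P / u * (Q / v) * y"
    for A C P Q u v x y :: complex
    by (simp add: add_divide_distrib diff_divide_distrib mult_ac)
  have "quad_coeff a b c (n + 2) =
      (- 2 * (c - 2 * b) * (1 + a + of_nat n) * quad_coeff a b c (n + 1) +
       (2 * a + of_nat n) * (1 + 2 * a - c + of_nat n) * quad_coeff a b c n) /
      ((2 + of_nat n) * (1 + c + of_nat n))" for n
    by (simp add: algebra_simps)
  then show "eventually (\<lambda>n. quad_coeff a b c (n + 2) =
      (1 + a + of_nat n) / (2 + of_nat n) * (- 2 * (c - 2 * b)) / (1 + c + of_nat n) * quad_coeff a b c (n + 1) +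
      (2 * a + of_nat n) / (2 + of_nat n) *
      ((1 + 2 * a - c + of_nat n) / (1 + c + of_nat n)) * quad_coeff a b c n) sequentially"
    unfolding aux by simp
qed

context
  fixes a b c :: complex
begin

definition quad_fps :: "complex fps" where
  "quad_fps = Abs_fps (quad_coeff a b c)"

text \<open>This is the hypergeometric equation pulled back along w = 4s/(1 + s)^2. Its finite
  singular points are 0, 1 and -1, the last two lying over w = 1 and w = \<infinity>, so nothing
  obstructs convergence inside the unit disc.\<close>

lemma quad_ode:
  assumes c: "c \<notin> \<int>\<^sub>\<le>\<^sub>0" and s: "norm s < 1"
  defines "K \<equiv> \<lambda>i. eval_fps ((fps_deriv ^^ i) quad_fps) s"
  shows "s * (1 - s\<^sup>2) * K 2 + (c + (2 * c - 4 * b) * s + (c - 2 - 4 * a) * s\<^sup>2) * K 1 +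
    2 * a * (c - 2 * b + (c - 1 - 2 * a) * s) * K 0 = 0"
proof -
  let ?F = "quad_fps" and ?X = "fps_X :: complex fps"
  let ?C = "fps_const :: complex \<Rightarrow> complex fps"
  let ?E = "?X * fps_deriv (fps_deriv ?F) - ?X * (?X * (?X * fps_deriv (fps_deriv ?F))) +
     ?C c * fps_deriv ?F + ?C (2 * c - 4 * b) * (?X * fps_deriv ?F) +
     ?C (c - 2 - 4 * a) * (?X * (?X * fps_deriv ?F)) +
     ?C (2 * a * (c - 2 * b)) * ?F + ?C (2 * a * (c - 1 - 2 * a)) * (?X * ?F)"
  have nz: "of_nat n + c \<noteq> 0" for n
    using c by (metis add.commute add_eq_0_iff minus_of_nat_in_nonpos_Ints)
  have rec: "(of_nat n + 2) * (of_nat n + 1 + c) * quad_coeff a b c (Suc (Suc n)) =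
      - 2 * (c - 2 * b) * (of_nat n + 1 + a) * quad_coeff a b c (Suc n) +
      (of_nat n + 2 * a) * (of_nat n + 1 + 2 * a - c) * quad_coeff a b c n" for n
  proof -
    have "of_nat n + 2 \<noteq> (0::complex)" "of_nat n + 1 + c \<noteq> 0"
      using of_nat_neq_0[of "Suc n", where ?'a = complex] nz[of "Suc n"] by (simp_all add: add_ac)
    then show ?thesis
      by simp
  qed
  have "?E $ n = 0" for n
  proof (cases n)
    case 0
    then show ?thesis
      using nz[of 0] by (simp add: quad_fps_def) (simp add: algebra_simps)
  next
    case (Suc m)
    have "?E $ n = (of_nat m + 2) * (of_nat m + 1 + c) * quad_coeff a b c (Suc (Suc m)) -
      (- 2 * (c - 2 * b) * (of_nat m + 1 + a) * quad_coeff a b c (Suc m) +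
      (of_nat m + 2 * a) * (of_nat m + 1 + 2 * a - c) * quad_coeff a b c m)"
    proof (cases m)
      case 0
      then show ?thesis
        unfolding Suc
        by (simp add: quad_fps_def del: quad_coeff.simps) (simp add: algebra_simps del: quad_coeff.simps)
    next
      case (Suc k)
      show ?thesis
        unfolding \<open>n = _\<close> Suc
        by (cases k; simp add: quad_fps_def del: quad_coeff.simps;
            simp add: algebra_simps del: quad_coeff.simps)
    qed
    then show ?thesis
      by (simp only: rec) simp
  qed
  then have E: "?E = 0"
    by (simp add: fps_eq_iff)
  have "1 \<le> fps_conv_radius quad_fps"
    by (simp add: fps_conv_radius_def quad_fps_def conv_radius_quad_coeff)
  then have r: "norm s < fps_conv_radius quad_fps"
    using s less_le_trans[of "ereal (norm s)" 1] by simp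
  have rd: "norm s < fps_conv_radius (fps_deriv F)" if "norm s < fps_conv_radius F"
    for F :: "complex fps"
    by (rule less_le_trans[OF that fps_conv_radius_deriv])
  have "eval_fps 0 s = (0::complex)"
    by (simp add: eval_fps_def)
  with arg_cong[OF E, of "\<lambda>G. eval_fps G s"]
  have "s * K 2 - s * (s * (s * K 2)) + c * K 1 + (2 * c - 4 * b) * (s * K 1) +
    (c - 2 - 4 * a) * (s * (s * K 1)) + 2 * a * (c - 2 * b) * K 0 +
    2 * a * (c - 1 - 2 * a) * (s * K 0) = 0"
    by (simp add: r rd less_fps_conv_radius_arith eval_fps_add eval_fps_diff eval_fps_mult K_def
        numeral_2_eq_2 del: right_diff_distrib_numeral)
  moreover have "s * K 2 - s * (s * (s * K 2)) + c * K 1 + (2 * c - 4 * b) * (s * K 1) +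
    (c - 2 - 4 * a) * (s * (s * K 1)) + 2 * a * (c - 2 * b) * K 0 +
    2 * a * (c - 1 - 2 * a) * (s * K 0) =
    s * (1 - s\<^sup>2) * K 2 + (c + (2 * c - 4 * b) * s + (c - 2 - 4 * a) * s\<^sup>2) * K 1 +
    2 * a * (c - 2 * b + (c - 1 - 2 * a) * s) * K 0"
    by (simp add: ring_distribs mult_ac power2_eq_square)
  ultimately show ?thesis
    by simp
qed

end

section \<open>The conformal map of the slit plane onto the disc\<close>

text \<open>From w = 4s/(1 + s)^2 follows 1 - w = ((1 - s)/(1 + s))^2; the principal root selects
  the solution s inside the disc.\<close>

definition slit_to_disc :: "complex \<Rightarrow> complex" where
  "slit_to_disc w = (1 - csqrt (1 - w)) / (1 + csqrt (1 - w))"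

lemma hyp2F1_domain_iff: "w \<in> hyp2F1_domain \<longleftrightarrow> 1 - w \<notin> \<real>\<^sub>\<le>\<^sub>0"
proof -
  have "w \<in> of_real ` {1..} \<longleftrightarrow> 1 - w \<in> \<real>\<^sub>\<le>\<^sub>0"
    by (auto simp: complex_nonpos_Reals_iff image_iff complex_eq_iff)
  then show ?thesis
    by (simp add: hyp2F1_domain_def)
qed

text \<open>Off [1, \<infinity>) the root r of 1 - w has positive real part, and the Cayley
  transform (1 - r)/(1 + r) carries the right half plane into the disc. The derivative is the
  reciprocal of dw/ds = 4 (1 - s)/(1 + s)^3.\<close>

lemma slit_to_disc:
  assumes "w \<in> hyp2F1_domain"
  defines "s \<equiv> slit_to_disc w"
  shows norm_slit_to_disc: "norm s < 1"
    and slit_to_disc_inverse: "w = 4 * s / (1 + s)\<^sup>2"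
    and has_field_derivative_slit_to_disc:
      "(slit_to_disc has_field_derivative (1 + s) ^ 3 / (4 * (1 - s))) (at w)"
proof -
  define r where "r = csqrt (1 - w)"
  have slit: "1 - w \<notin> \<real>\<^sub>\<le>\<^sub>0"
    using assms by (simp add: hyp2F1_domain_iff)
  have r2: "w = 1 - r\<^sup>2"
    by (simp add: r_def)
  have "Re r \<noteq> 0"
  proof
    assume "Re r = 0"
    then have "r\<^sup>2 = - of_real ((Im r)\<^sup>2)"
      by (simp add: complex_eq_iff power2_eq_square)
    moreover have "r\<^sup>2 = 1 - w"
      by (simp add: r_def)
    ultimately have "1 - w \<in> \<real>\<^sub>\<le>\<^sub>0"
      by (simp add: complex_nonpos_Reals_iff)
    with slit show False by blast
  qed
  moreover have "Re r \<ge> 0"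
    unfolding r_def by (rule Re_csqrt)
  ultimately have r: "Re r > 0"
    by simp
  then have r0: "r \<noteq> 0" and r1: "1 + r \<noteq> 0"
    by (auto simp: complex_eq_iff)
  have s: "s = (1 - r) / (1 + r)"
    by (simp add: s_def slit_to_disc_def r_def)
  have "(norm (1 - r))\<^sup>2 < (norm (1 + r))\<^sup>2"
    using r unfolding cmod_power2 by (simp add: power2_eq_square algebra_simps)
  then have "norm (1 - r) < norm (1 + r)"
    by (rule power_less_imp_less_base) simp
  then show "norm s < 1"
    unfolding s norm_divide by (subst divide_less_eq_1) auto
  have s1: "1 + s = 2 / (1 + r)" "1 - s = 2 * r / (1 + r)"
    using r1 by (simp_all add: s field_simps)
  show "w = 4 * s / (1 + s)\<^sup>2"
    unfolding s1 unfolding s r2 using r1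
    by (simp add: divide_simps power2_eq_square) (simp add: algebra_simps)
  have "((\<lambda>w. (1 - csqrt (1 - w)) / (1 + csqrt (1 - w))) has_field_derivative
      ((1 / (2 * r)) * (1 + r) - (1 - r) * (- 1 / (2 * r))) / ((1 + r) * (1 + r))) (at w)"
    using slit r0 r1 unfolding r_def
    by (auto intro!: derivative_eq_intros simp: mult_ac)
  also have "((1 / (2 * r)) * (1 + r) - (1 - r) * (- 1 / (2 * r))) / ((1 + r) * (1 + r)) =
      (1 + s) ^ 3 / (4 * (1 - s))"
    unfolding s1 using r0 r1
    by (simp add: divide_simps power3_eq_cube)
  finally show "(slit_to_disc has_field_derivative (1 + s) ^ 3 / (4 * (1 - s))) (at w)"
    unfolding slit_to_disc_def[abs_def] .
qed

lemma open_hyp2F1_domain: "open hyp2F1_domain"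
proof -
  have "hyp2F1_domain = (\<lambda>w. 1 - w) -` (- \<real>\<^sub>\<le>\<^sub>0)"
    by (auto simp: hyp2F1_domain_iff)
  also have "open \<dots>"
    by (intro open_vimage continuous_intros) (auto simp: open_Compl)
  finally show ?thesis .
qed

lemma ball_subset_hyp2F1_domain: "ball 0 1 \<subseteq> hyp2F1_domain"
proof
  fix w :: complex
  assume "w \<in> ball 0 1"
  then have "Re w < 1"
    using complex_Re_le_cmod[of w] by simp
  then show "w \<in> hyp2F1_domain"
    by (auto simp: hyp2F1_domain_iff complex_nonpos_Reals_iff)
qed

text \<open>The result is again (1 + s)^(2a) times an expression in s, so the rule can be iterated
  for the second derivative.\<close>

lemma has_field_derivative_quadratic:
  assumes w: "w \<in> hyp2F1_domain"
  defines "s \<equiv> slit_to_disc w"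
  assumes G: "(G has_field_derivative G') (at s)"
  shows "((\<lambda>w. (1 + slit_to_disc w) powr (2 * a) * G (slit_to_disc w)) has_field_derivative
     (1 + s) powr (2 * a) * ((1 + s)\<^sup>2 / (4 * (1 - s)) * (2 * a * G s + (1 + s) * G'))) (at w)"
proof -
  have n: "norm s < 1"
    using norm_slit_to_disc[OF w] by (simp add: s_def)
  then have re: "Re (1 + s) > 0"
    using abs_Re_le_cmod[of s] by simp
  then have nz: "1 + s \<noteq> 0" "1 + s \<notin> \<real>\<^sub>\<le>\<^sub>0"
    by (metis less_irrefl zero_complex.sel(1)) (use re in \<open>auto simp: complex_nonpos_Reals_iff\<close>)
  have nz': "1 - s \<noteq> 0"
    using n by auto
  note der = has_field_derivative_slit_to_disc[OF w, folded s_def]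
  have "((\<lambda>w. (1 + slit_to_disc w) powr (2 * a) * G (slit_to_disc w)) has_field_derivative
     (2 * a * (1 + s) powr (2 * a - 1) * ((1 + s) ^ 3 / (4 * (1 - s)))) * G s +
      (G' * ((1 + s) ^ 3 / (4 * (1 - s)))) * (1 + s) powr (2 * a)) (at w)"
    unfolding s_def
    by (rule DERIV_mult DERIV_chain2[OF has_field_derivative_powr] DERIV_chain2[where f = G and g = slit_to_disc, OF G[unfolded s_def]]
         der[unfolded s_def] nz[unfolded s_def] DERIV_cong[OF DERIV_add[OF DERIV_const]] | simp)+
  also have "(2 * a * (1 + s) powr (2 * a - 1) * ((1 + s) ^ 3 / (4 * (1 - s)))) * G s +
      (G' * ((1 + s) ^ 3 / (4 * (1 - s)))) * (1 + s) powr (2 * a) =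
     (1 + s) powr (2 * a) * ((1 + s)\<^sup>2 / (4 * (1 - s)) * (2 * a * G s + (1 + s) * G'))"
    using nz nz' by (simp add: powr_diff power3_eq_cube power2_eq_square divide_simps)
      (simp add: algebra_simps)
  finally show ?thesis .
qed

text \<open>
  \<open>A1\<close> and the second factor of the leading term are the first and second \<open>w\<close>-derivative of
  \<open>(1 + s)\<^bsup>2a\<^esup> K(s)\<close>, divided by \<open>(1 + s)\<^bsup>2a\<^esup>\<close>.
\<close>
lemma quadratic_ode_identity:
  fixes s a b c K0 K1 K2 :: complex
  assumes nz: "1 + s \<noteq> 0" "1 - s \<noteq> 0"
  defines "w \<equiv> 4 * s / (1 + s)\<^sup>2"
  defines "A1 \<equiv> (1 + s)\<^sup>2 / (4 * (1 - s)) * (2 * a * K0 + (1 + s) * K1)"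
  defines "A2 \<equiv> (1 + s) * (3 - s) / (4 * (1 - s)\<^sup>2) * (2 * a * K0 + (1 + s) * K1) +
     (1 + s)\<^sup>2 / (4 * (1 - s)) * (2 * a * K1 + K1 + (1 + s) * K2)"
  assumes ode: "s * (1 - s\<^sup>2) * K2 + (c + (2 * c - 4 * b) * s + (c - 2 - 4 * a) * s\<^sup>2) * K1 +
    2 * a * (c - 2 * b + (c - 1 - 2 * a) * s) * K0 = 0"
  shows "w * (1 - w) * ((1 + s)\<^sup>2 / (4 * (1 - s)) * (2 * a * A1 + (1 + s) * A2)) +
    (c - (a + b + 1) * w) * A1 - a * b * K0 = 0"
proof -
  define L where "L = 2 * a * K0 + (1 + s) * K1"
  define M where "M = 2 * a * K1 + K1 + (1 + s) * K2"
  have aux: "s * q / p\<^sup>2 * (2 * a * (p\<^sup>2 / (4 * q) * L) +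
      p * (p * r / (4 * q\<^sup>2) * L + p\<^sup>2 / (4 * q) * M)) = s / 4 * (2 * a * L + r / q * L + p * M)"
    if "p \<noteq> 0" "q \<noteq> 0" for p q r :: complex
    using that by (simp add: divide_simps power2_eq_square) (simp add: algebra_simps)
  have aux2: "4 * q * (s / 4 * (2 * a * L + r / q * L + p * M) + x / (4 * q) * L - y) =
    s * q * 2 * a * L + s * r * L + s * q * p * M + x * L - 4 * q * y"
    if "p \<noteq> 0" "q \<noteq> 0" for p q r x y :: complex
    using that by (simp add: field_simps)
  have w1: "1 - w = (1 - s)\<^sup>2 / (1 + s)\<^sup>2"
    using nz by (simp add: w_def divide_simps power2_eq_square) (simp add: algebra_simps)
  have "w * (1 - w) * ((1 + s)\<^sup>2 / (4 * (1 - s)) * (2 * a * A1 + (1 + s) * A2)) =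
      s * (1 - s) / (1 + s)\<^sup>2 * (2 * a * A1 + (1 + s) * A2)"
    unfolding w1 unfolding w_def using nz
    by (simp add: divide_simps power2_eq_square)
  also have "\<dots> = s / 4 * (2 * a * L + (3 - s) / (1 - s) * L + (1 + s) * M)"
    unfolding A1_def A2_def L_def[symmetric] M_def[symmetric]
    by (rule aux[OF nz])
  finally have 1: "w * (1 - w) * ((1 + s)\<^sup>2 / (4 * (1 - s)) * (2 * a * A1 + (1 + s) * A2)) = \<dots>" .
  have 2: "(c - (a + b + 1) * w) * A1 = (c * (1 + s)\<^sup>2 - 4 * (a + b + 1) * s) / (4 * (1 - s)) * L"
    unfolding A1_def w_def L_def[symmetric]
    using nz by (simp add: divide_simps)
  have "4 * (1 - s) * (s / 4 * (2 * a * L + (3 - s) / (1 - s) * L + (1 + s) * M) +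
      (c * (1 + s)\<^sup>2 - 4 * (a + b + 1) * s) / (4 * (1 - s)) * L - a * b * K0) =
    s * (1 - s) * 2 * a * L + s * (3 - s) * L + s * (1 - s) * (1 + s) * M +
      (c * (1 + s)\<^sup>2 - 4 * (a + b + 1) * s) * L - 4 * (1 - s) * (a * b * K0)"
    by (rule aux2[OF nz])
  also have "\<dots> = (1 + s) * (s * (1 - s\<^sup>2) * K2 +
      (c + (2 * c - 4 * b) * s + (c - 2 - 4 * a) * s\<^sup>2) * K1 +
      2 * a * (c - 2 * b + (c - 1 - 2 * a) * s) * K0)"
    by (simp add: L_def M_def algebra_simps power2_eq_square)
  also have "\<dots> = 0"
    by (simp add: ode)
  finally show ?thesis
    unfolding 1 2 using nz by simp
qed

text \<open>No series is substituted into another: the candidate solves the hypergeometric equation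
  in w on the slit plane and is 1 at 0, and \<open>hyp_ode_unique\<close> identifies it on the disc
  with Gamma(c) times the regularized series.\<close>

lemma Freg_continuation_aux:
  assumes c: "c \<notin> \<int>\<^sub>\<le>\<^sub>0"
  shows "\<exists>H. H holomorphic_on hyp2F1_domain \<and> (\<forall>w\<in>ball 0 1. H w = Freg a b c w)"
proof -
  define K where "K i = eval_fps ((fps_deriv ^^ i) (quad_fps a b c))" for i
  \<comment> \<open>Up to the factor (1 + s)^(2a), \<open>A1\<close> and \<open>A3\<close> represent
    the first and second w-derivative; \<open>A2\<close> is the plain s-derivative of
    \<open>A1\<close>.\<close>
  define A1 where "A1 s = (1 + s)\<^sup>2 / (4 * (1 - s)) * (2 * a * K 0 s + (1 + s) * K 1 s)" for s
  define A2 where "A2 s = (1 + s) * (3 - s) / (4 * (1 - s)\<^sup>2) * (2 * a * K 0 s + (1 + s) * K 1 s) +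
     (1 + s)\<^sup>2 / (4 * (1 - s)) * (2 * a * K 1 s + K 1 s + (1 + s) * K 2 s)" for s
  define A3 where "A3 s = (1 + s)\<^sup>2 / (4 * (1 - s)) * (2 * a * A1 s + (1 + s) * A2 s)" for s
  define H where "H G w = (1 + slit_to_disc w) powr (2 * a) * G (slit_to_disc w)" for G w
  have rad: "1 \<le> fps_conv_radius ((fps_deriv ^^ i) (quad_fps a b c))" for i
  proof (induction i)
    case 0
    then show ?case
      by (simp add: fps_conv_radius_def quad_fps_def conv_radius_quad_coeff)
  next
    case (Suc i)
    then show ?case
      using fps_conv_radius_deriv order_trans by fastforce
  qed
  have K: "(K i has_field_derivative K (Suc i) s) (at s)" if "norm s < 1" for i s
    unfolding K_def using has_field_derivative_eval_fps[of s "(fps_deriv ^^ i) (quad_fps a b c)" UNIV]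
      that less_le_trans[OF _ rad, of "ereal (norm s)" i] by simp
  have A1: "(A1 has_field_derivative A2 s) (at s)" if s: "norm s < 1" for s
  proof -
    have nz: "1 - s \<noteq> 0"
      using s by auto
    have "((\<lambda>s. (1 + s)\<^sup>2 / (4 * (1 - s))) has_field_derivative
        (2 * (1 + s) * (4 * (1 - s)) - (1 + s)\<^sup>2 * (- 4)) / ((4 * (1 - s)) * (4 * (1 - s)))) (at s)"
      using nz by (auto intro!: derivative_eq_intros)
    also have "(2 * (1 + s) * (4 * (1 - s)) - (1 + s)\<^sup>2 * (- 4)) / ((4 * (1 - s)) * (4 * (1 - s))) =
        (1 + s) * (3 - s) / (4 * (1 - s)\<^sup>2)"
      using nz by (simp add: divide_simps power2_eq_square) (simp add: algebra_simps)
    finally have 1: "((\<lambda>s. (1 + s)\<^sup>2 / (4 * (1 - s))) has_field_derivative \<dots>) (at s)" .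
    have 2: "((\<lambda>s. 2 * a * K 0 s + (1 + s) * K 1 s) has_field_derivative
        2 * a * K 1 s + K 1 s + (1 + s) * K 2 s) (at s)"
      using K[OF s, of 0] K[OF s, of 1]
      by (auto intro!: derivative_eq_intros simp: numeral_2_eq_2 algebra_simps)
    show ?thesis
      unfolding A1_def[abs_def] A2_def using DERIV_mult[OF 1 2] by (simp add: mult.commute)
  qed
  have H0: "(H (K 0) has_field_derivative H A1 w) (at w)" if "w \<in> hyp2F1_domain" for w
    using has_field_derivative_quadratic[OF that K[OF norm_slit_to_disc[OF that]], of a 0]
    by (simp add: H_def[abs_def] A1_def)
  have H1: "(H A1 has_field_derivative H A3 w) (at w)" if "w \<in> hyp2F1_domain" for w
    using has_field_derivative_quadratic[OF that A1[OF norm_slit_to_disc[OF that]], of a]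
    by (simp add: H_def[abs_def] A3_def)
  have ode: "w * (1 - w) * H A3 w + (c - (a + b + 1) * w) * H A1 w - a * b * H (K 0) w = 0"
    if w: "w \<in> hyp2F1_domain" for w
  proof -
    define s where "s = slit_to_disc w"
    have s: "norm s < 1"
      using norm_slit_to_disc[OF w] by (simp add: s_def)
    then have nz: "1 + s \<noteq> 0" "1 - s \<noteq> 0"
      by (auto simp: add_eq_0_iff)
    have "w * (1 - w) * A3 s + (c - (a + b + 1) * w) * A1 s - a * b * K 0 s = 0"
      using quadratic_ode_identity[OF nz quad_ode[OF c s, of a b]]
      unfolding slit_to_disc_inverse[OF w, folded s_def] A3_def A1_def A2_def K_def by blast
    moreover have "w * (1 - w) * H A3 w + (c - (a + b + 1) * w) * H A1 w - a * b * H (K 0) w =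
        (1 + s) powr (2 * a) * (w * (1 - w) * A3 s + (c - (a + b + 1) * w) * A1 s - a * b * K 0 s)"
      by (simp add: H_def s_def algebra_simps)
    ultimately show ?thesis
      by simp
  qed
  have "H (K 0) 0 = 1"
    by (simp add: H_def slit_to_disc_def K_def eval_fps_at_0 quad_fps_def)
  then have eq: "H (K 0) w = Gamma c * Freg a b c w" if "norm w < 1" for w
    using hyp_ode_unique[OF c, of 1 "H (K 0)" "H A1" "H A3" a b w] H0 H1 ode that
      subsetD[OF ball_subset_hyp2F1_domain] by simp
  show ?thesis
  proof (intro exI conjI ballI)
    show "(\<lambda>w. rGamma c * H (K 0) w) holomorphic_on hyp2F1_domain"
      using H0 by (intro holomorphic_on_mult holomorphic_on_const holomorphic_onI)
        (meson field_differentiable_at_within field_differentiable_def)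
    show "rGamma c * H (K 0) w = Freg a b c w" if "w \<in> ball 0 1" for w
      using eq[of w] that c by (simp add: rGamma_inverse_Gamma Gamma_eq_zero_iff)
  qed
qed

section \<open>Nonpositive integer values of c\<close>

lemma rGamma_Suc: "rGamma (1 + of_nat n) = (1 / fact n :: complex)"
  using Gamma_fact[of n, where ?'a = complex] by (metis divide_inverse inverse_inverse_eq mult_1 rGamma_inverse_Gamma)

text \<open>For n \<le> m the factor \<open>rGamma (c + of_nat n)\<close> vanishes. With n = m + 1 +
  j the remaining denominators j! n! are those of the regularized series with c = m + 2, a value at
  which the uniqueness argument works.\<close>

lemma Freg_minus_nat:
  assumes "norm w < 1"
  shows "Freg a b (- of_nat m) w = pochhammer a (Suc m) * pochhammer b (Suc m) * w ^ Suc m *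
    Freg (a + of_nat (Suc m)) (b + of_nat (Suc m)) (of_nat (m + 2)) w"
proof -
  define C where "C = pochhammer a (Suc m) * pochhammer b (Suc m)"
  define G where "G = hyp_fps (a + of_nat (Suc m)) (b + of_nat (Suc m)) (of_nat (m + 2))"
  have "hyp_fps a b (- of_nat m) = fps_const C * (fps_X ^ Suc m * G)"
  proof (rule fps_ext)
    fix n
    show "fps_nth (hyp_fps a b (- of_nat m)) n = fps_nth (fps_const C * (fps_X ^ Suc m * G)) n"
    proof (cases "n \<le> m")
      case True
      then have "- of_nat m + of_nat n = - (of_nat (m - n) :: complex)"
        by (simp add: of_nat_diff)
      then have "rGamma (- of_nat m + of_nat n :: complex) = 0"
        by (simp add: rGamma_eq_zero_iff)
      then show ?thesis
        using True by (simp add: hyp_fps_def fps_X_power_mult_nth del: power_Suc)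
    next
      case False
      define j where "j = n - Suc m"
      have n: "n = Suc m + j"
        using False by (simp add: j_def)
      have r1: "rGamma (- of_nat m + of_nat n :: complex) = 1 / fact j"
        using rGamma_Suc[of j] by (simp add: n)
      have r2: "rGamma (of_nat (m + 2) + of_nat j :: complex) = 1 / fact n"
        using rGamma_Suc[of n] by (simp add: n add_ac)
      have p: "pochhammer x n = pochhammer x (Suc m) * pochhammer (x + of_nat (Suc m)) j" for x :: complex
        unfolding n by (rule pochhammer_product')
      have "fps_nth (fps_const C * (fps_X ^ Suc m * G)) n = C * fps_nth G j"
        using False by (simp add: fps_X_power_mult_nth j_def del: power_Suc)
      then show ?thesis
        unfolding hyp_fps_def fps_nth_Abs_fps G_def C_def r1 r2 p by (simp only:) (simp add: field_simps)
    qed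
  qed
  moreover have "norm w < fps_conv_radius G"
    unfolding G_def by (rule norm_less_hyp_fps_radius[OF assms])
  ultimately show ?thesis
    unfolding Freg_def
    by (simp add: eval_fps_mult eval_fps_power less_fps_conv_radius_arith C_def G_def del: power_Suc of_nat_Suc of_nat_add)
qed

lemma Freg_continuation:
  "\<exists>H. H holomorphic_on hyp2F1_domain \<and> (\<forall>w\<in>ball 0 1. H w = Freg a b c w)"
proof (cases "c \<in> \<int>\<^sub>\<le>\<^sub>0")
  case True
  then obtain m where c: "c = - of_nat m"
    by (elim nonpos_Ints_cases')
  have "of_nat (m + 2) \<notin> (\<int>\<^sub>\<le>\<^sub>0 :: complex set)"
    using of_nat_in_nonpos_Ints_iff[of "m + 2", where ?'a = complex] by simp
  from Freg_continuation_aux[OF this, of "a + of_nat (Suc m)" "b + of_nat (Suc m)"]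
  obtain H where H: "H holomorphic_on hyp2F1_domain"
      "\<And>w. w \<in> ball 0 1 \<Longrightarrow> H w = Freg (a + of_nat (Suc m)) (b + of_nat (Suc m)) (of_nat (m + 2)) w"
    by blast
  have "(\<lambda>w. pochhammer a (Suc m) * pochhammer b (Suc m) * w ^ Suc m * H w) holomorphic_on hyp2F1_domain"
    by (intro holomorphic_intros H)
  moreover have "pochhammer a (Suc m) * pochhammer b (Suc m) * w ^ Suc m * H w = Freg a b c w"
    if "w \<in> ball 0 1" for w
    using that H(2)[OF that] unfolding c by (subst Freg_minus_nat) simp_all
  ultimately show ?thesis
    by blast
qed (rule Freg_continuation_aux)

section \<open>The principal branch on the slit plane\<close>

text \<open>The hypothesis says that the removed real set is a union of rays pointing away from 0,
  so the complement is star-shaped about 0. It covers both the hypergeometric domain and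
  \<open>D1\<close>.\<close>

lemma connected_slit_plane:
  assumes R: "\<And>r u. r \<in> R \<Longrightarrow> 0 < u \<Longrightarrow> u \<le> 1 \<Longrightarrow> r / u \<in> R" and "0 \<notin> R"
  shows "connected (- (complex_of_real ` R))"
proof (rule starlike_imp_connected)
  have "closed_segment 0 w \<subseteq> - (complex_of_real ` R)" if w: "w \<in> - (of_real ` R)" for w
  proof
    fix z
    assume "z \<in> closed_segment 0 w"
    then obtain u where u: "0 \<le> u" "u \<le> 1" "z = of_real u * w"
      by (auto simp: in_segment scaleR_conv_of_real)
    show "z \<in> - (of_real ` R)"
    proof (rule ccontr)
      assume "z \<notin> - (of_real ` R)"
      then obtain r where r: "r \<in> R" "of_real u * w = of_real r"
        using u by auto
      with \<open>0 \<notin> R\<close> have "u \<noteq> 0"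
        by auto
      then have "w = of_real (r / u)" "r / u \<in> R"
        using r u R[of r u] by (auto simp: field_simps)
      then have "w \<in> of_real ` R"
        by (rule image_eqI)
      with w show False
        by simp
    qed
  qed
  moreover have "0 \<in> - (complex_of_real ` R)"
    using \<open>0 \<notin> R\<close> by auto
  ultimately show "starlike (- (complex_of_real ` R))"
    unfolding starlike_def by blast
qed

lemma connected_hyp2F1_domain: "connected hyp2F1_domain"
  unfolding hyp2F1_domain_def by (rule connected_slit_plane) (auto simp: field_simps)

lemma Freg_altdef:
  "Freg a b c w = (\<Sum>n. pochhammer a n * pochhammer b n * rGamma (c + of_nat n) * (w ^ n / fact n))"
  by (simp add: Freg_def eval_fps_def hyp_fps_def)

text \<open>Once a continuation exists, these two properties are all that is used of the chosen
  function \<open>hyp2F1_reg\<close>.\<close>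

lemma
  shows holomorphic_hyp2F1_reg': "hyp2F1_reg a b c holomorphic_on hyp2F1_domain"
    and hyp2F1_reg_eq_Freg: "norm w < 1 \<Longrightarrow> hyp2F1_reg a b c w = Freg a b c w"
proof -
  obtain H where H: "H holomorphic_on hyp2F1_domain" "\<And>w. w \<in> ball 0 1 \<Longrightarrow> H w = Freg a b c w"
    using Freg_continuation by blast
  have eq: "hyp2F1_reg a b c w = H w" if "w \<in> hyp2F1_domain" for w
    unfolding hyp2F1_reg_def Freg_altdef[symmetric]
    by (rule analytic_extension_eqI[where a = 0])
       (use H that open_hyp2F1_domain connected_hyp2F1_domain ball_subset_hyp2F1_domain in
        \<open>auto intro!: interior_limit_point simp: subset_iff\<close>)
  then show "hyp2F1_reg a b c holomorphic_on hyp2F1_domain"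
    using H(1) holomorphic_transform by metis
  show "hyp2F1_reg a b c w = Freg a b c w" if "norm w < 1"
    using eq[of w] H(2)[of w] that ball_subset_hyp2F1_domain by (auto simp: subset_iff)
qed

lemma holomorphic_hyp2F1_reg [holomorphic_intros]:
  assumes "g holomorphic_on S" "\<And>z. z \<in> S \<Longrightarrow> g z \<in> hyp2F1_domain"
  shows "(\<lambda>z. hyp2F1_reg a b c (g z)) holomorphic_on S"
  using holomorphic_on_compose_gen[OF assms(1) holomorphic_hyp2F1_reg'] assms(2)
  by (auto simp: o_def)

lemma hyp2F1_eq_reg:
  assumes c: "c \<notin> \<int>\<^sub>\<le>\<^sub>0" and w: "w \<in> hyp2F1_domain"
  shows "hyp2F1 a b c w = Gamma c * hyp2F1_reg a b c w"
  unfolding hyp2F1_def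
proof (rule analytic_extension_eqI[where a = 0])
  show "(\<lambda>w. Gamma c * hyp2F1_reg a b c w) holomorphic_on hyp2F1_domain"
    by (intro holomorphic_intros) auto
  show "Gamma c * hyp2F1_reg a b c z =
      (\<Sum>n. pochhammer a n * pochhammer b n / pochhammer c n * (z ^ n / fact n))"
    if z: "z \<in> ball 0 1" for z
  proof -
    have "(\<lambda>n. fps_nth (hyp_fps a b c) n * z ^ n) sums Freg a b c z"
      unfolding Freg_def using z by (intro sums_eval_fps norm_less_hyp_fps_radius) auto
    from sums_mult[OF this, of "Gamma c"]
    have "(\<lambda>n. Gamma c * (fps_nth (hyp_fps a b c) n * z ^ n)) sums (Gamma c * hyp2F1_reg a b c z)"
      using z by (simp add: hyp2F1_reg_eq_Freg)
    moreover have "Gamma c * (fps_nth (hyp_fps a b c) n * z ^ n) =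
        pochhammer a n * pochhammer b n / pochhammer c n * (z ^ n / fact n)" for n
      using c by (simp add: hyp_fps_def hyp2F1_reg_coeff Gamma_eq_zero_iff)
    ultimately show ?thesis
      by (simp add: sums_iff)
  qed
qed (use w open_hyp2F1_domain connected_hyp2F1_domain ball_subset_hyp2F1_domain in
        \<open>auto intro!: interior_limit_point simp: subset_iff\<close>)

subsection \<open>Euler and Pfaff transformations\<close>

lemma Freg_unique:
  assumes c: "c \<notin> \<int>\<^sub>\<le>\<^sub>0" and r: "0 < r" "r \<le> 1"
    and f: "\<And>w. norm w < r \<Longrightarrow> (f has_field_derivative f' w) (at w)"
    and f': "\<And>w. norm w < r \<Longrightarrow> (f' has_field_derivative f'' w) (at w)"
    and ode: "\<And>w. norm w < r \<Longrightarrow>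
      w * (1 - w) * f'' w + (c - (a + b + 1) * w) * f' w - a * b * f w = 0"
    and f0: "f 0 = rGamma c"
    and w: "norm w < r"
  shows "f w = Freg a b c w"
  using hyp_ode_unique[OF c r f f' ode w] c
  by (simp add: f0 rGamma_inverse_Gamma Gamma_eq_zero_iff)

lemma one_minus_notin_nonpos_Reals: "norm w < 1 \<Longrightarrow> 1 - w \<notin> \<real>\<^sub>\<le>\<^sub>0" for w :: complex
  using ball_subset_hyp2F1_domain hyp2F1_domain_iff[of w] by (auto simp: subset_iff)

text \<open>The right-hand side is differentiated and shown to solve the equation with parameters a,
  b, c; its value at 0 is 1/Gamma(c), and uniqueness does the rest.\<close>

lemma Freg_euler_aux:
  assumes c: "c \<notin> \<int>\<^sub>\<le>\<^sub>0" and w: "norm w < 1"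
  shows "Freg a b c w = (1 - w) powr (c - a - b) * Freg (c - a) (c - b) c w"
proof -
  define \<sigma> where "\<sigma> = c - a - b"
  define G0 where "G0 = Freg (c - a) (c - b) c"
  define G1 where "G1 w = (c - a) * (c - b) * Freg (c - a + 1) (c - b + 1) (c + 1) w" for w
  define G2 where "G2 w = (c - a) * (c - b) * (c - a + 1) * (c - b + 1) * Freg (c - a + 2) (c - b + 2) (c + 2) w" for w
  define A1 where "A1 w = G1 w - \<sigma> / (1 - w) * G0 w" for w
  define A2 where "A2 w = G2 w - \<sigma> / (1 - w) * G1 w - \<sigma> / (1 - w)\<^sup>2 * G0 w" for w
  have G0: "(G0 has_field_derivative G1 w) (at w)" if "norm w < 1" for w
    unfolding G0_def G1_def using has_field_derivative_Freg[OF that] .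
  have G1: "(G1 has_field_derivative G2 w) (at w)" if "norm w < 1" for w
    unfolding G1_def G2_def using DERIV_cmult[where c = "(c - a) * (c - b)", OF has_field_derivative_Freg[OF that, of "c - a + 1" "c - b + 1" "c + 1"]]
    by (simp add: mult_ac add_ac)
  \<comment> \<open>The power is carried along as a common factor, so two applications give the
    second derivative.\<close>
  have step: "((\<lambda>w. (1 - w) powr \<sigma> * G w) has_field_derivative
      (1 - w) powr \<sigma> * (G' - \<sigma> / (1 - w) * G w)) (at w)"
    if "norm w < 1" "(G has_field_derivative G') (at w)" for w G G'
  proof -
    have "1 - w \<notin> \<real>\<^sub>\<le>\<^sub>0" "1 - w \<noteq> 0"
      using that(1) one_minus_notin_nonpos_Reals by auto
    then show ?thesis
      using that by (auto intro!: derivative_eq_intros simp: powr_diff) (simp add: divide_simps; simp add: algebra_simps)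
  qed
  have "(1 - w) powr \<sigma> * G0 w = Freg a b c w"
  proof (rule Freg_unique[OF c _ _ _ _ _ _ w])
    show "((\<lambda>w. (1 - w) powr \<sigma> * G0 w) has_field_derivative (1 - w) powr \<sigma> * A1 w) (at w)"
      if "norm w < 1" for w
      using step[OF that G0[OF that]] by (simp add: A1_def)
    show "((\<lambda>w. (1 - w) powr \<sigma> * A1 w) has_field_derivative
        (1 - w) powr \<sigma> * (A2 w - \<sigma> / (1 - w) * A1 w)) (at w)"
      if "norm w < 1" for w
    proof (rule step[OF that])
      have "1 - w \<noteq> 0"
        using that by auto
      then show "(A1 has_field_derivative A2 w) (at w)"
        unfolding A1_def[abs_def] A2_def using G0[OF that] G1[OF that]
        by (auto intro!: derivative_eq_intros simp: power2_eq_square)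
          (simp add: divide_simps; simp add: algebra_simps)
    qed
    show "w * (1 - w) * ((1 - w) powr \<sigma> * (A2 w - \<sigma> / (1 - w) * A1 w)) +
        (c - (a + b + 1) * w) * ((1 - w) powr \<sigma> * A1 w) - a * b * ((1 - w) powr \<sigma> * G0 w) = 0"
      if "norm w < 1" for w
    proof -
      have nz: "1 - w \<noteq> 0"
        using that by auto
      have ode: "w * (1 - w) * G2 w + (c - (c - a + (c - b) + 1) * w) * G1 w - (c - a) * (c - b) * G0 w = 0"
        using Freg_ode[OF that, of "c - a" "c - b" c] by (simp add: G0_def G1_def G2_def)
      define q where "q = 1 - w"
      have w: "w = 1 - q" and q: "q \<noteq> 0"
        using nz by (simp_all add: q_def)
      \<comment> \<open>Multiplication by q clears the denominators; what remains is q times the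
        equation satisfied by \<open>G0\<close>.\<close>
      have "q * (w * q * (A2 w - \<sigma> / q * A1 w) + (c - (a + b + 1) * w) * A1 w - a * b * G0 w) =
         w * (q * (q * G2 w) - 2 * \<sigma> * q * G1 w + (\<sigma> * \<sigma> - \<sigma>) * G0 w) +
         (c - (a + b + 1) * w) * (q * G1 w - \<sigma> * G0 w) - q * (a * b * G0 w)"
        unfolding A1_def A2_def q_def[symmetric] using q
        by (simp add: divide_simps power2_eq_square) (simp add: algebra_simps)
      also have "\<dots> = q * (w * (1 - w) * G2 w + (c - (c - a + (c - b) + 1) * w) * G1 w - (c - a) * (c - b) * G0 w)"
        unfolding q_def \<sigma>_def by (simp add: algebra_simps)
      also have "\<dots> = 0"
        unfolding ode by simp
      finally have "w * q * (A2 w - \<sigma> / q * A1 w) + (c - (a + b + 1) * w) * A1 w - a * b * G0 w = 0"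
        using q by simp
      then have "(1 - w) powr \<sigma> * (w * (1 - w) * (A2 w - \<sigma> / (1 - w) * A1 w) +
          (c - (a + b + 1) * w) * A1 w - a * b * G0 w) = 0"
        by (simp add: q_def)
      then show ?thesis
        by (simp add: ring_distribs mult_ac)
    qed
  qed (auto simp: G0_def Freg_0)
  then show ?thesis
    by (simp add: G0_def \<sigma>_def)
qed

text \<open>Nonpositive integers c must be included, since \<open>sol_infinity_even\<close> uses the
  formula with c = \<nu> + 3/2.\<close>

lemma Freg_euler:
  assumes w: "norm w < 1"
  shows "Freg a b c w = (1 - w) powr (c - a - b) * Freg (c - a) (c - b) c w"
proof (cases "c \<in> \<int>\<^sub>\<le>\<^sub>0")
  case True
  then obtain m where c: "c = - of_nat m"
    by (elim nonpos_Ints_cases')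
  have m: "of_nat (m + 2) \<notin> (\<int>\<^sub>\<le>\<^sub>0 :: complex set)"
    using of_nat_in_nonpos_Ints_iff[of "m + 2", where ?'a = complex] by simp
  \<comment> \<open>Reflection of the Pochhammer symbol costs a sign (-1)^(m+1); it occurs once for
    each upper parameter and cancels.\<close>
  have p: "pochhammer (- of_nat m - x) (Suc m) = (- 1) ^ Suc m * pochhammer x (Suc m)" for x :: complex
  proof -
    have "- of_nat m - x = - (x + of_nat m)"
      by simp
    then show ?thesis
      using pochhammer_minus[of "x + of_nat m" "Suc m"] by (simp only:) (simp add: algebra_simps)
  qed
  have e: "of_nat (m + 2) - (x + of_nat (Suc m)) = 1 - x" "- of_nat m - x + of_nat (Suc m) = 1 - x"
    "1 - x - (y + of_nat (Suc m)) = - of_nat m - x - y" for x y :: complex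
    by simp_all
  show ?thesis
    unfolding c Freg_minus_nat[OF w] p e
      Freg_euler_aux[OF m w, of "a + of_nat (Suc m)" "b + of_nat (Suc m)", unfolded e]
    by (simp add: mult_ac flip: power_mult_distrib)
qed (use Freg_euler_aux w in blast)

lemma norm_pfaff_less_1: "norm (w / (w - 1)) < 1" if "norm w < 1 / 2" for w :: complex
proof -
  have "norm w < norm (1 - w)"
    using that norm_triangle_ineq2[of 1 w] by simp
  then show ?thesis
    using that by (subst norm_divide, subst divide_less_eq_1) (auto simp: norm_minus_commute)
qed

text \<open>Again by uniqueness. For |w| < 1/2 the point t = w/(w - 1) stays in the unit disc, where
  the series on the right converges.\<close>

lemma Freg_pfaff:
  assumes c: "c \<notin> \<int>\<^sub>\<le>\<^sub>0" and w: "norm w < 1 / 2"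
  shows "Freg a b c w = (1 - w) powr (- a) * Freg a (c - b) c (w / (w - 1))"
proof -
  define G0 where "G0 = Freg a (c - b) c"
  define G1 where "G1 w = a * (c - b) * Freg (a + 1) (c - b + 1) (c + 1) w" for w
  define G2 where "G2 w = a * (c - b) * (a + 1) * (c - b + 1) * Freg (a + 2) (c - b + 2) (c + 2) w" for w
  \<comment> \<open>Since dt/dw = -(1 - t)^2 and 1/(1 - w) = 1 - t, this is the derivative of the
    product after removal of (1 - w)^(-a); \<open>A2\<close> is its t-derivative.\<close>
  define A1 where "A1 t = (1 - t) * (a * G0 t - (1 - t) * G1 t)" for t
  define A2 where "A2 t = - a * G0 t + (a + 2) * (1 - t) * G1 t - (1 - t)\<^sup>2 * G2 t" for t
  have G0: "(G0 has_field_derivative G1 w) (at w)" if "norm w < 1" for w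
    unfolding G0_def G1_def using has_field_derivative_Freg[OF that] .
  have G1: "(G1 has_field_derivative G2 w) (at w)" if "norm w < 1" for w
    unfolding G1_def G2_def using DERIV_cmult[where c = "a * (c - b)", OF has_field_derivative_Freg[OF that, of "a + 1" "c - b + 1" "c + 1"]]
    by (simp add: mult_ac add_ac)
  have step: "((\<lambda>w. (1 - w) powr (- a) * G (w / (w - 1))) has_field_derivative
      (1 - w) powr (- a) * ((1 - t) * (a * G t - (1 - t) * G'))) (at w)"
    if w: "norm w < 1 / 2" and t: "t = w / (w - 1)" and G: "(G has_field_derivative G') (at t)" for w t G G'
  proof -
    have nz: "1 - w \<notin> \<real>\<^sub>\<le>\<^sub>0" "1 - w \<noteq> 0" "w - 1 \<noteq> 0"
      using w one_minus_notin_nonpos_Reals[of w] by auto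
    have t1: "1 - t = 1 / (1 - w)"
      unfolding t using nz by (simp add: divide_simps)
    have "((\<lambda>w. w / (w - 1)) has_field_derivative - 1 / ((1 - w) * (1 - w))) (at w)"
      using nz by (auto intro!: derivative_eq_intros simp: divide_simps) (simp add: algebra_simps)
    from DERIV_chain2[where f = G and g = "\<lambda>w. w / (w - 1)", OF G[unfolded t] this]
    have "((\<lambda>w. G (w / (w - 1))) has_field_derivative G' * (- 1 / ((1 - w) * (1 - w)))) (at w)" .
    moreover have "((\<lambda>w. (1 - w) powr (- a)) has_field_derivative a * (1 - w) powr (- a - 1)) (at w)"
      using nz by (auto intro!: derivative_eq_intros)
    ultimately have "((\<lambda>w. (1 - w) powr (- a) * G (w / (w - 1))) has_field_derivative
       a * (1 - w) powr (- a - 1) * G (w / (w - 1)) + G' * (- 1 / ((1 - w) * (1 - w))) * (1 - w) powr (- a)) (at w)"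
      by (rule DERIV_mult[rotated])
    also have "a * (1 - w) powr (- a - 1) * G (w / (w - 1)) + G' * (- 1 / ((1 - w) * (1 - w))) * (1 - w) powr (- a) =
       (1 - w) powr (- a) * ((1 - t) * (a * G t - (1 - t) * G'))"
      unfolding t1 t[symmetric] using nz by (simp add: powr_diff divide_simps) (simp add: algebra_simps)
    finally show ?thesis .
  qed
  have "(1 - w) powr (- a) * G0 (w / (w - 1)) = Freg a b c w"
  proof (rule Freg_unique[OF c _ _ _ _ _ _ w])
    show "((\<lambda>w. (1 - w) powr (- a) * G0 (w / (w - 1))) has_field_derivative
        (1 - w) powr (- a) * A1 (w / (w - 1))) (at w)" if "norm w < 1 / 2" for w
      using step[OF that refl G0[OF norm_pfaff_less_1[OF that]]] by (simp only: A1_def)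
    show "((\<lambda>w. (1 - w) powr (- a) * A1 (w / (w - 1))) has_field_derivative
        (1 - w) powr (- a) * ((1 - w / (w - 1)) * (a * A1 (w / (w - 1)) -
          (1 - w / (w - 1)) * A2 (w / (w - 1))))) (at w)"
      if w: "norm w < 1 / 2" for w
    proof (rule step[OF w refl])
      define t where "t = w / (w - 1)"
      have "norm t < 1"
        using norm_pfaff_less_1[OF w] t_def by simp
      from G0[OF this] G1[OF this] show "(A1 has_field_derivative A2 (w / (w - 1))) (at (w / (w - 1)))"
        unfolding t_def[symmetric] A1_def[abs_def] A2_def
        by (auto intro!: derivative_eq_intros simp: power2_eq_square algebra_simps)
    qed
    show "w * (1 - w) * ((1 - w) powr (- a) * ((1 - w / (w - 1)) * (a * A1 (w / (w - 1)) -
          (1 - w / (w - 1)) * A2 (w / (w - 1))))) +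
        (c - (a + b + 1) * w) * ((1 - w) powr (- a) * A1 (w / (w - 1))) -
        a * b * ((1 - w) powr (- a) * G0 (w / (w - 1))) = 0"
      if w: "norm w < 1 / 2" for w
    proof -
      define t where "t = w / (w - 1)"
      define q where "q = 1 - t"
      have nz: "1 - w \<noteq> 0" "w - 1 \<noteq> 0"
        using w by auto
      have "norm t < 1"
        using norm_pfaff_less_1[OF w] t_def by simp
      from Freg_ode[OF this, of a "c - b" c]
      have ode: "t * (1 - t) * G2 t + (c - (a + (c - b) + 1) * t) * G1 t - a * (c - b) * G0 t = 0"
        by (simp add: G0_def G1_def G2_def)
      have q: "q = 1 / (1 - w)"
        unfolding q_def t_def using nz by (simp add: divide_simps)
      then have q0: "q \<noteq> 0" and wq: "w = 1 - 1 / q"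
        using nz by auto
      have tq: "t = 1 - q"
        by (simp add: q_def)
      have "w * (1 - w) * (q * (a * A1 t - q * A2 t)) + (c - (a + b + 1) * w) * A1 t - a * b * G0 t =
        (1 - 1 / q) * (a * A1 t - q * A2 t) + (c - (a + b + 1) * (1 - 1 / q)) * A1 t - a * b * G0 t"
        unfolding wq using q0 by simp
      \<comment> \<open>In the variable t the expression is -q times the equation of
        \<open>G0\<close>.\<close>
      also have "\<dots> = - q * (t * (1 - t) * G2 t + (c - (a + (c - b) + 1) * t) * G1 t - a * (c - b) * G0 t)"
        unfolding A1_def A2_def q_def[symmetric] unfolding tq
        using q0 by (simp add: field_simps power2_eq_square)
      also have "\<dots> = 0"
        unfolding ode by simp
      finally have "(1 - w) powr (- a) * (w * (1 - w) * (q * (a * A1 t - q * A2 t)) +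
          (c - (a + b + 1) * w) * A1 t - a * b * G0 t) = 0"
        by simp
      then show ?thesis
        unfolding t_def[symmetric] q_def[symmetric] by (simp only: ring_distribs mult_ac)
    qed
  qed (auto simp: G0_def Freg_0)
  then show ?thesis
    by (simp add: G0_def)
qed

lemma pfaff_in_hyp2F1_domain:
  assumes "w \<in> hyp2F1_domain"
  shows "w / (w - 1) \<in> hyp2F1_domain"
proof -
  have w: "1 - w \<notin> \<real>\<^sub>\<le>\<^sub>0"
    using assms by (simp add: hyp2F1_domain_iff)
  then have "1 - w \<noteq> 0" "w - 1 \<noteq> 0"
    by auto
  then have "1 - w / (w - 1) = inverse (1 - w)"
    by (simp add: divide_simps)
  then show ?thesis
    using w by (simp add: hyp2F1_domain_iff)
qed

text \<open>Both sides are holomorphic on the slit plane, because 1 - w/(w - 1) = 1/(1 - w); the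
  disc of radius 1/2 decides.\<close>

lemma hyp2F1_pfaff:
  assumes c: "c \<notin> \<int>\<^sub>\<le>\<^sub>0" and w: "w \<in> hyp2F1_domain"
  shows "hyp2F1 a b c w = (1 - w) powr (- a) * hyp2F1 a (c - b) c (w / (w - 1))"
proof -
  have one_notin: "1 \<notin> hyp2F1_domain"
    by (simp add: hyp2F1_domain_iff)
  have "hyp2F1_reg a b c w = (1 - w) powr (- a) * hyp2F1_reg a (c - b) c (w / (w - 1))"
  proof (rule analytic_continuation_open[where f = "hyp2F1_reg a b c" and
        g = "\<lambda>w. (1 - w) powr (- a) * hyp2F1_reg a (c - b) c (w / (w - 1))", OF _ open_hyp2F1_domain])
    show "ball 0 (1 / 2) \<subseteq> hyp2F1_domain"
      using ball_subset_hyp2F1_domain by (auto simp: subset_iff)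
    show "(\<lambda>w. (1 - w) powr (- a) * hyp2F1_reg a (c - b) c (w / (w - 1))) holomorphic_on hyp2F1_domain"
      using one_notin by (intro holomorphic_intros)
        (auto simp: pfaff_in_hyp2F1_domain hyp2F1_domain_iff[symmetric])
    show "hyp2F1_reg a b c z = (1 - z) powr (- a) * hyp2F1_reg a (c - b) c (z / (z - 1))"
      if "z \<in> ball 0 (1 / 2)" for z
      using that norm_pfaff_less_1[of z] Freg_pfaff[OF c, of z a b] by (simp add: hyp2F1_reg_eq_Freg)
  qed (use w connected_hyp2F1_domain holomorphic_hyp2F1_reg' in auto)
  then show ?thesis
    using c w by (simp add: hyp2F1_eq_reg pfaff_in_hyp2F1_domain)
qed

subsection \<open>Behaviour at 1\<close>

text \<open>Gauss's limit for 1/Gamma contains the Pochhammer symbol of index n + 1; the factor n/(a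
  + n), of limit 1, lowers the index to n.\<close>

lemma pochhammer_asymp:
  fixes a :: complex
  shows "(\<lambda>n. pochhammer a n / (fact n * of_nat n powr (a - 1))) \<longlonglongrightarrow> rGamma a"
proof -
  have "(\<lambda>n. rGamma_series a n * ((0 + of_nat n) / (a + of_nat n))) \<longlonglongrightarrow> rGamma a * 1"
    by (intro tendsto_mult rGamma_series_LIMSEQ tendsto_linear_ratio)
  moreover have "eventually (\<lambda>n. rGamma_series a n * ((0 + of_nat n) / (a + of_nat n)) =
      pochhammer a n / (fact n * of_nat n powr (a - 1))) sequentially"
    using eventually_gt_at_top[of 0] eventually_add_nat_neq_0[of a]
  proof eventually_elim
    case (elim n)
    have "of_nat n powr a = exp (a * of_real (ln (of_nat n)))"
      using elim by (simp add: powr_def flip: Ln_of_nat)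
    then show ?case
      using elim by (simp add: rGamma_series_def pochhammer_Suc powr_diff divide_simps)
  qed
  ultimately show ?thesis
    by (simp add: filterlim_cong)
qed

text \<open>For c outside the poles this is the reciprocal of the preceding limit. At c = -m the
  Pochhammer symbol is eventually 0 and cannot be inverted, so the claim is carried down from c + 1
  to c, starting at c = 1.\<close>

lemma rGamma_asymp:
  fixes c :: complex
  shows "(\<lambda>n. rGamma (c + of_nat n) * (fact n * of_nat n powr (c - 1))) \<longlonglongrightarrow> 1"
proof -
  define T where "T c \<longleftrightarrow> (\<lambda>n. rGamma (c + of_nat n) * (fact n * of_nat n powr (c - 1))) \<longlonglongrightarrow> 1"
    for c :: complex
  have base: "T c" if c: "c \<notin> \<int>\<^sub>\<le>\<^sub>0" for c
  proof -
    have nz: "rGamma c \<noteq> 0"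
      using c by (simp add: rGamma_eq_zero_iff)
    then have "(\<lambda>n. rGamma c * inverse (pochhammer c n / (fact n * of_nat n powr (c - 1)))) \<longlonglongrightarrow>
        rGamma c * inverse (rGamma c)"
      by (intro tendsto_intros pochhammer_asymp)
    moreover have "rGamma c * inverse (pochhammer c n / (fact n * of_nat n powr (c - 1))) =
       rGamma (c + of_nat n) * (fact n * of_nat n powr (c - 1))" for n
    proof -
      have "pochhammer c n \<noteq> 0"
        using c by (auto simp: pochhammer_eq_0_iff)
      then show ?thesis
        using pochhammer_rGamma[of c n] by simp
    qed
    ultimately show ?thesis
      using nz by (simp add: T_def)
  qed
  have step: "T c" if "T (c + 1)" for c
  proof -
    have "(\<lambda>n. (c + of_nat n) / (0 + of_nat n) *
        (rGamma (c + 1 + of_nat n) * (fact n * of_nat n powr (c + 1 - 1)))) \<longlonglongrightarrow> 1 * 1"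
      using that unfolding T_def by (intro tendsto_mult tendsto_linear_ratio)
    moreover have "eventually (\<lambda>n. (c + of_nat n) / (0 + of_nat n) *
        (rGamma (c + 1 + of_nat n) * (fact n * of_nat n powr (c + 1 - 1))) =
        rGamma (c + of_nat n) * (fact n * of_nat n powr (c - 1))) sequentially"
      using eventually_gt_at_top[of 0]
      by eventually_elim (simp add: rGamma_shift[of c] powr_diff)
    ultimately show ?thesis
      unfolding T_def by (simp add: filterlim_cong)
  qed
  have "T (- of_nat m)" for m
  proof (induction m)
    case 0
    have "(1 :: complex) \<notin> \<int>\<^sub>\<le>\<^sub>0"
      by simp
    then show ?case
      using step[of 0] base[of 1] by simp
  next
    case (Suc m)
    then show ?case
      using step[of "- of_nat (Suc m)"] by simp
  qed
  then have "T c"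
    using base by (metis nonpos_Ints_cases')
  then show ?thesis
    by (simp add: T_def)
qed

lemma hyp_fps_asymp:
  "(\<lambda>n. fps_nth (hyp_fps a b c) n * of_nat n powr (1 - (a + b - c))) \<longlonglongrightarrow> rGamma a * rGamma b"
proof -
  have "(\<lambda>n. pochhammer a n / (fact n * of_nat n powr (a - 1)) *
      (pochhammer b n / (fact n * of_nat n powr (b - 1))) *
      (rGamma (c + of_nat n) * (fact n * of_nat n powr (c - 1)))) \<longlonglongrightarrow> rGamma a * rGamma b * 1"
    by (intro tendsto_mult pochhammer_asymp rGamma_asymp)
  moreover have "eventually (\<lambda>n. pochhammer a n / (fact n * of_nat n powr (a - 1)) *
      (pochhammer b n / (fact n * of_nat n powr (b - 1))) *
      (rGamma (c + of_nat n) * (fact n * of_nat n powr (c - 1))) =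
      fps_nth (hyp_fps a b c) n * of_nat n powr (1 - (a + b - c))) sequentially"
    using eventually_gt_at_top[of 0]
  proof eventually_elim
    case (elim n)
    have "of_nat n powr (1 - (a + b - c)) = of_nat n powr (c - 1) / (of_nat n powr (a - 1) * (of_nat n powr (b - 1) :: complex))"
      using elim by (simp add: powr_diff powr_add)
    then show ?case
      by (simp add: hyp_fps_def mult_ac)
  qed
  ultimately show ?thesis
    by (simp add: filterlim_cong)
qed

section \<open>An Abelian theorem\<close>

lemma sums_pochhammer_real:
  fixes r w :: real
  assumes "\<bar>w\<bar> < 1"
  shows "(\<lambda>n. pochhammer r n / fact n * w ^ n) sums (1 - w) powr (- r)"
proof -
  have "(\<lambda>n. ((- r) gchoose n) * (- w) ^ n) sums (1 + (- w)) powr (- r)"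
    using assms by (intro gen_binomial_real) simp
  moreover have "((- r) gchoose n) * (- w) ^ n = pochhammer r n / fact n * w ^ n" for n
  proof -
    have "(- 1) ^ n * (- w) ^ n = w ^ n"
      by (simp flip: power_mult_distrib)
    then show ?thesis
      by (simp add: gbinomial_pochhammer)
  qed
  ultimately show ?thesis
    by simp
qed

lemma sums_pochhammer_complex:
  fixes p w :: complex
  assumes "norm w < 1"
  shows "(\<lambda>n. pochhammer p n / fact n * w ^ n) sums (1 - w) powr (- p)"
proof -
  have "(\<lambda>n. ((- p) gchoose n) * (- w) ^ n) sums (1 + (- w)) powr (- p)"
    using assms by (intro gen_binomial_complex) simp
  moreover have "((- p) gchoose n) * (- w) ^ n = pochhammer p n / fact n * w ^ n" for n
  proof -
    have "(- 1) ^ n * (- w) ^ n = w ^ n"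
      by (simp flip: power_mult_distrib)
    then show ?thesis
      by (simp add: gbinomial_pochhammer)
  qed
  ultimately show ?thesis
    by simp
qed

text \<open>Coefficients that are o(n^(r-1)) give a sum that is o((1 - w)^(-r)). The comparison
  series is the binomial series of (1 - w)^(-r), whose coefficients \<open>\<beta>\<close> are
  positive and asymptotic to n^(r-1)/Gamma(r).\<close>

lemma abelian_power_bound:
  fixes v :: "nat \<Rightarrow> complex"
  assumes r: "r > 0" and v: "(\<lambda>n. norm (v n) * real n powr (1 - r)) \<longlonglongrightarrow> 0"
  shows "((\<lambda>w::real. (1 - w) powr r * norm (\<Sum>n. v n * of_real w ^ n)) \<longlongrightarrow> 0) (at_left 1)"
proof -
  define \<beta> where "\<beta> n = pochhammer r n / fact n" for n
  have \<beta>pos: "\<beta> n > 0" for n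
    using r by (simp add: \<beta>_def pochhammer_pos)
  have "norm (pochhammer (of_real r) n / (fact n * of_nat n powr (of_real r - 1)) :: complex) =
      \<beta> n / real n powr (r - 1)" if "n > 0" for n
  proof -
    have "norm (of_nat n powr (of_real r - 1) :: complex) = real n powr (r - 1)"
      using that by (subst norm_powr_real_powr) auto
    moreover have "norm (pochhammer (complex_of_real r) n) = pochhammer r n"
      using r pochhammer_pos[of r n] by (simp add: pochhammer_of_real)
    ultimately show ?thesis
      by (simp add: \<beta>_def norm_divide norm_mult)
  qed
  then have ev: "eventually (\<lambda>n. norm (pochhammer (of_real r) n / (fact n * of_nat n powr (of_real r - 1)) :: complex) =
      \<beta> n / real n powr (r - 1)) sequentially"
    using eventually_gt_at_top[of 0] by (rule eventually_mono[rotated])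
  have "(\<lambda>n. \<beta> n / real n powr (r - 1)) \<longlonglongrightarrow> norm (rGamma (complex_of_real r))"
    by (rule Lim_transform_eventually[OF tendsto_norm[OF pochhammer_asymp] ev])
  moreover have rg: "norm (rGamma (complex_of_real r)) \<noteq> 0"
    using r by (auto simp: rGamma_eq_zero_iff elim!: nonpos_Ints_cases dest!: arg_cong[of _ _ Re])
  ultimately have "(\<lambda>n. norm (v n) * real n powr (1 - r) / (\<beta> n / real n powr (r - 1))) \<longlonglongrightarrow>
      0 / norm (rGamma (complex_of_real r))"
    by (intro tendsto_divide v)
  moreover have "eventually (\<lambda>n. norm (v n) * real n powr (1 - r) / (\<beta> n / real n powr (r - 1)) = norm (v n) / \<beta> n)
      sequentially"
    using eventually_gt_at_top[of 0] by eventually_elim (simp add: powr_diff)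
  ultimately have lim: "(\<lambda>n. norm (v n) / \<beta> n) \<longlonglongrightarrow> 0"
    using Lim_transform_eventually by fastforce
  show ?thesis
  proof (rule tendstoI)
    fix e :: real
    assume e: "e > 0"
    have "eventually (\<lambda>n. norm (v n) / \<beta> n < e / 2) sequentially"
      using order_tendstoD(2)[OF lim, of "e / 2"] e by simp
    then obtain N where N': "\<And>n. n \<ge> N \<Longrightarrow> norm (v n) / \<beta> n < e / 2"
      unfolding eventually_sequentially by blast
    have N: "norm (v n) \<le> e / 2 * \<beta> n" if "n \<ge> N" for n
      using N'[OF that] \<beta>pos[of n] by (metis less_imp_le pos_divide_less_eq)
    \<comment> \<open>The finite head is bounded uniformly in w and is killed by (1 - w)^r; the tail
      is at most e/2 times the comparison series.\<close>
    define M where "M = (\<Sum>n<N. norm (v n))"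
    have bound: "(1 - w) powr r * norm (\<Sum>n. v n * of_real w ^ n) \<le> M * (1 - w) powr r + e / 2"
      if w: "0 < w" "w < 1" for w :: real
    proof -
      have s\<beta>: "(\<lambda>n. \<beta> n * w ^ n) sums (1 - w) powr (- r)"
        unfolding \<beta>_def using w by (intro sums_pochhammer_real) auto
      have fin: "(\<lambda>n. if n < N then norm (v n) else 0) sums M"
        using sums_If_finite[of "\<lambda>n. n < N" "\<lambda>n. norm (v n)"] by (simp add: M_def lessThan_def)
      have s: "(\<lambda>n. (if n < N then norm (v n) else 0) + e / 2 * (\<beta> n * w ^ n)) sums
          (M + e / 2 * (1 - w) powr (- r))"
        by (intro sums_add fin sums_mult s\<beta>)
      have le: "norm (v n * of_real w ^ n) \<le> (if n < N then norm (v n) else 0) + e / 2 * (\<beta> n * w ^ n)" for n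
      proof (cases "n < N")
        case True
        have "norm (v n) * w ^ n \<le> norm (v n) * 1"
          using w by (intro mult_left_mono power_le_one) auto
        moreover have "0 \<le> e / 2 * (\<beta> n * w ^ n)"
          using e w less_imp_le[OF \<beta>pos[of n]] by simp
        ultimately show ?thesis
          using True w by (simp add: norm_mult norm_power)
      next
        case False
        then have "norm (v n) * w ^ n \<le> e / 2 * \<beta> n * w ^ n"
          using w by (intro mult_right_mono N) auto
        then show ?thesis
          using False w by (simp add: norm_mult norm_power)
      qed
      have "norm (\<Sum>n. v n * of_real w ^ n) \<le> (\<Sum>n. (if n < N then norm (v n) else 0) + e / 2 * (\<beta> n * w ^ n))"
        by (rule norm_suminf_le) (use s le in \<open>auto simp: sums_iff\<close>)
      also have "\<dots> = M + e / 2 * (1 - w) powr (- r)"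
        using s by (simp add: sums_iff)
      finally have "(1 - w) powr r * norm (\<Sum>n. v n * of_real w ^ n) \<le>
          (1 - w) powr r * (M + e / 2 * (1 - w) powr (- r))"
        by (intro mult_left_mono) auto
      also have "\<dots> = M * (1 - w) powr r + e / 2"
        using w by (simp add: powr_minus field_simps)
      finally show ?thesis .
    qed
    have "((\<lambda>w. M * (1 - w) powr r) \<longlongrightarrow> M * (1 - 1) powr r) (at_left 1)"
      using r by (intro tendsto_mult tendsto_powr' tendsto_intros)
         (auto simp: eventually_at_filter)
    then have "eventually (\<lambda>w. M * (1 - w) powr r < e / 2) (at_left 1)"
      using r e by (intro order_tendstoD) auto
    moreover have "eventually (\<lambda>w::real. 0 < w \<and> w < 1) (at_left 1)"
      using eventually_at_left_real[of 0 "1::real"] by (auto elim: eventually_mono)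
    ultimately show "eventually (\<lambda>w. dist ((1 - w) powr r * norm (\<Sum>n. v n * of_real w ^ n)) 0 < e) (at_left 1)"
    proof eventually_elim
      case (elim w)
      then show ?case
        using bound[of w] by simp
    qed
  qed
qed

text \<open>The constant is chosen so that subtracting L (1 - w)^(-p) cancels the leading growth
  n^(p-1) of the coefficients; the difference then falls under the Abelian bound with r = Re
  p.\<close>

lemma Freg_asymp_at_1:
  assumes p: "p = a + b - c" "Re p > 0"
  shows "((\<lambda>w::real. of_real (1 - w) powr p * Freg a b c (of_real w)) \<longlongrightarrow>
    Gamma p * rGamma a * rGamma b) (at_left 1)"
proof -
  define L where "L = Gamma p * rGamma a * rGamma b"
  define u where "u n = fps_nth (hyp_fps a b c) n" for n
  define v where "v n = u n - L * (pochhammer p n / fact n)" for n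
  have p0: "p \<notin> \<int>\<^sub>\<le>\<^sub>0"
    using p(2) by (auto elim!: nonpos_Ints_cases)
  have "(\<lambda>n. u n * of_nat n powr (1 - p) - L * (pochhammer p n / (fact n * of_nat n powr (p - 1)))) \<longlonglongrightarrow>
      rGamma a * rGamma b - L * rGamma p"
    unfolding u_def p(1) by (intro tendsto_intros hyp_fps_asymp pochhammer_asymp)
  moreover have "rGamma a * rGamma b - L * rGamma p = 0"
    using p0 by (simp add: L_def rGamma_inverse_Gamma Gamma_eq_zero_iff)
  moreover have "eventually (\<lambda>n. u n * of_nat n powr (1 - p) - L * (pochhammer p n / (fact n * of_nat n powr (p - 1)))
      = v n * of_nat n powr (1 - p)) sequentially"
    using eventually_gt_at_top[of 0] by eventually_elim (simp add: v_def powr_diff algebra_simps)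
  ultimately have "(\<lambda>n. v n * of_nat n powr (1 - p)) \<longlonglongrightarrow> 0"
    using Lim_transform_eventually by fastforce
  then have "(\<lambda>n. norm (v n * of_nat n powr (1 - p))) \<longlonglongrightarrow> 0"
    by (rule tendsto_norm_zero)
  moreover have "eventually (\<lambda>n. norm (v n * of_nat n powr (1 - p)) = norm (v n) * real n powr (1 - Re p)) sequentially"
    using eventually_gt_at_top[of 0]
    by eventually_elim (simp add: norm_mult norm_powr_real_powr)
  ultimately have "(\<lambda>n. norm (v n) * real n powr (1 - Re p)) \<longlonglongrightarrow> 0"
    using Lim_transform_eventually by fastforce
  from abelian_power_bound[OF p(2) this]
  have lim: "((\<lambda>w::real. (1 - w) powr Re p * norm (\<Sum>n. v n * of_real w ^ n)) \<longlongrightarrow> 0) (at_left 1)" .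
  have ev: "eventually (\<lambda>w::real. 0 < w \<and> w < 1) (at_left 1)"
    using eventually_at_left_real[of 0 "1::real"] by (auto elim: eventually_mono)
  have "eventually (\<lambda>w. (1 - w) powr Re p * norm (\<Sum>n. v n * of_real w ^ n) =
      norm (of_real (1 - w) powr p * Freg a b c (of_real w) - L)) (at_left 1)"
    using ev
  proof eventually_elim
    case (elim w)
    have "(\<lambda>n. v n * of_real w ^ n) sums (Freg a b c (of_real w) - L * (1 - of_real w) powr (- p))"
    proof -
      have "(\<lambda>n. u n * of_real w ^ n - L * (pochhammer p n / fact n * of_real w ^ n)) sums
          (Freg a b c (of_real w) - L * (1 - of_real w) powr (- p))"
        unfolding u_def Freg_def using elim
        by (intro sums_diff sums_mult sums_eval_fps norm_less_hyp_fps_radius sums_pochhammer_complex) auto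
      then show ?thesis
        by (simp add: v_def algebra_simps)
    qed
    then have 1: "(\<Sum>n. v n * of_real w ^ n) = Freg a b c (of_real w) - L * of_real (1 - w) powr (- p)"
      by (simp add: sums_iff)
    have 2: "(1 - w) powr Re p = norm (of_real (1 - w) powr p :: complex)"
      using elim by (subst norm_powr_real_powr) auto
    have "of_real (1 - w) powr p \<noteq> (0::complex)"
      using elim by simp
    then have "of_real (1 - w) powr p * (L * of_real (1 - w) powr (- p)) = L"
      by (simp add: powr_minus)
    then show ?case
      unfolding 1 2 by (simp only: right_diff_distrib flip: norm_mult)
  qed
  from Lim_transform_eventually[OF lim this]
  have "((\<lambda>w::real. of_real (1 - w) powr p * Freg a b c (of_real w) - L) \<longlongrightarrow> 0) (at_left 1)"
    by (rule tendsto_norm_zero_cancel)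
  then show ?thesis
    unfolding L_def by (rule LIM_zero_cancel)
qed

subsection \<open>Solutions of the Gegenbauer equation\<close>

text \<open>The operator b + w d/dw multiplies the n-th coefficient by b + n, which is the effect of
  raising b. The factor b is kept so that b = 0 is no exception.\<close>

lemma Freg_contiguous_b:
  assumes "norm w < 1"
  shows "b * Freg a (b + 1) c w = b * Freg a b c w + w * (a * b * Freg (a + 1) (b + 1) (c + 1) w)"
proof -
  have "fps_const b * hyp_fps a (b + 1) c = fps_const b * hyp_fps a b c + fps_X * fps_deriv (hyp_fps a b c)"
  proof (rule fps_ext)
    fix n
    have "b * pochhammer (b + 1) n = (b + of_nat n) * pochhammer b n"
      using pochhammer_rec[of b n] by (simp add: pochhammer_rec')
    then have "b * fps_nth (hyp_fps a (b + 1) c) n = (b + of_nat n) * fps_nth (hyp_fps a b c) n"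
      by (simp add: hyp_fps_def)
    moreover have "fps_nth (fps_X * fps_deriv (hyp_fps a b c)) n = of_nat n * fps_nth (hyp_fps a b c) n"
      by (cases n) simp_all
    ultimately show "fps_nth (fps_const b * hyp_fps a (b + 1) c) n =
        fps_nth (fps_const b * hyp_fps a b c + fps_X * fps_deriv (hyp_fps a b c)) n"
      by (simp add: ring_distribs)
  qed
  from arg_cong[OF this[unfolded fps_deriv_hyp_fps], of "\<lambda>F. eval_fps F w"] show ?thesis
    using norm_less_hyp_fps_radius[OF assms]
    by (simp add: eval_fps_add eval_fps_mult less_fps_conv_radius_arith Freg_def)
qed

lemma Freg_contiguous_a:
  assumes "norm w < 1"
  shows "a * Freg (a + 1) b c w = a * Freg a b c w + w * (a * b * Freg (a + 1) (b + 1) (c + 1) w)"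
  using Freg_contiguous_b[OF assms, of a b c] by (simp add: Freg_commute[of b] Freg_commute[of "b + 1"] mult_ac)

text \<open>Here c + w d/dw turns \<open>rGamma (c + 1 + of_nat n)\<close> into
  \<open>rGamma (c + of_nat n)\<close> in each coefficient.\<close>

lemma Freg_contiguous_c:
  assumes "norm w < 1"
  shows "Freg a b c w = c * Freg a b (c + 1) w + w * (a * b * Freg (a + 1) (b + 1) (c + 2) w)"
proof -
  have "hyp_fps a b c = fps_const c * hyp_fps a b (c + 1) + fps_X * fps_deriv (hyp_fps a b (c + 1))"
  proof (rule fps_ext)
    fix n
    show "fps_nth (hyp_fps a b c) n =
        fps_nth (fps_const c * hyp_fps a b (c + 1) + fps_X * fps_deriv (hyp_fps a b (c + 1))) n"
      using rGamma_shift[of c n]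
      by (cases n) (simp_all add: hyp_fps_def field_simps del: pochhammer_Suc of_nat_Suc)
  qed
  from arg_cong[OF this[unfolded fps_deriv_hyp_fps], of "\<lambda>F. eval_fps F w"] show ?thesis
    using norm_less_hyp_fps_radius[OF assms]
    by (simp add: eval_fps_add eval_fps_mult less_fps_conv_radius_arith Freg_def add.assoc)
qed

section \<open>Three solutions and their derivatives\<close>

text \<open>What remains of \<open>legendre_Q\<close> after removing the constants and (z^2 -
  1)^(\<mu>/2).\<close>

definition sol_infinity :: "complex \<Rightarrow> complex \<Rightarrow> complex \<Rightarrow> complex" where
  "sol_infinity \<nu> \<mu> z = z powr (- \<nu> - \<mu> - 1) *
     Freg ((\<nu> + \<mu> + 2) / 2) ((\<nu> + \<mu> + 1) / 2) (\<nu> + 3 / 2) (1 / z\<^sup>2)"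

text \<open>At z = 1 the equation has the exponents -\<mu> and 0; this solution belongs to -\<mu>,
  the next one to 0.\<close>

definition sol_singular :: "complex \<Rightarrow> complex \<Rightarrow> complex \<Rightarrow> complex" where
  "sol_singular \<nu> \<mu> z = (z - 1) powr (- \<mu>) * Freg (- \<nu>) (\<nu> + 1) (1 - \<mu>) ((1 - z) / 2)"

text \<open>The factor 2^(-\<mu>) absorbs the 1/2 from differentiating (1 - z)/2 and becomes (z +
  1)^(-\<mu>) in \<open>sol_regular_altdef\<close>.\<close>

definition sol_regular :: "complex \<Rightarrow> complex \<Rightarrow> complex \<Rightarrow> complex" where
  "sol_regular \<nu> \<mu> z = 2 powr (- \<mu>) * Freg (\<mu> + \<nu> + 1) (\<mu> - \<nu>) (1 + \<mu>) ((1 - z) / 2)"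

lemma in_ball_2_1:
  fixes z :: complex
  assumes "z \<in> ball 2 1"
  shows "Re z > 1" "norm (1 / z\<^sup>2) < 1" "norm ((1 - z) / 2) < 1"
    "z \<notin> \<real>\<^sub>\<le>\<^sub>0" "z - 1 \<notin> \<real>\<^sub>\<le>\<^sub>0" "z + 1 \<notin> \<real>\<^sub>\<le>\<^sub>0" "z \<noteq> 0" "z \<noteq> 1" "z + 1 \<noteq> 0"
proof -
  have n: "norm (z - 2) < 1"
    using assms by (simp add: dist_norm norm_minus_commute)
  show re: "Re z > 1"
    using abs_Re_le_cmod[of "z - 2"] n by simp
  then have "norm z > 1"
    using complex_Re_le_cmod[of z] by simp
  then show "norm (1 / z\<^sup>2) < 1"
    using one_less_power[of "norm z" 2] by (simp add: norm_divide norm_power divide_less_eq)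
  have "norm (1 - z) \<le> norm (- 1 :: complex) + norm (2 - z)"
    using norm_triangle_ineq[of "- 1" "2 - z"] by simp
  then show "norm ((1 - z) / 2) < 1"
    using n by (simp add: norm_divide norm_minus_commute)
  show "z \<notin> \<real>\<^sub>\<le>\<^sub>0" "z - 1 \<notin> \<real>\<^sub>\<le>\<^sub>0" "z + 1 \<notin> \<real>\<^sub>\<le>\<^sub>0"
    using re by (auto simp: complex_nonpos_Reals_iff)
  then show "z \<noteq> 0" "z \<noteq> 1" "z + 1 \<noteq> 0"
    by auto
qed

text \<open>
  The disc around \<open>2\<close> lies in the half plane \<open>Re z > 1\<close>, so that \<open>z\<close>, \<open>z - 1\<close> and \<open>z + 1\<close> are off the cut of the
  logarithm, and the series in \<open>1 / z\<^sup>2\<close> and in \<open>(1 - z) / 2\<close> both converge there.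
\<close>
definition gegenbauer_sol :: "complex \<Rightarrow> complex \<Rightarrow> (complex \<Rightarrow> complex) \<Rightarrow> (complex \<Rightarrow> complex) \<Rightarrow> bool" where
  "gegenbauer_sol \<nu> \<mu> u u' \<longleftrightarrow> (\<forall>z\<in>ball 2 1. (u has_field_derivative u' z) (at z) \<and>
     (\<exists>d. (u' has_field_derivative d) (at z) \<and>
        (z\<^sup>2 - 1) * d + 2 * (\<mu> + 1) * z * u' z - (\<nu> - \<mu>) * (\<nu> + \<mu> + 1) * u z = 0))"

text \<open>With w = 1/z^2 and \<nu> + \<mu> + 1 = 2b, the operator z d/dz acts on the series as -2
  (b + w d/dw), hence raises b. The parameters belonging to \<mu> + 1 are (b + 1, a), the same pair
  in the other order.\<close>

lemma has_field_derivative_sol_infinity: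
  assumes z: "z \<in> ball 2 1"
  shows "(sol_infinity \<nu> \<mu> has_field_derivative - (\<nu> + \<mu> + 1) * sol_infinity \<nu> (\<mu> + 1) z) (at z)"
proof -
  note zz = in_ball_2_1[OF z]
  define p a b c w where "p = \<nu> + \<mu> + 1" and "a = (\<nu> + \<mu> + 2) / 2" and "b = (\<nu> + \<mu> + 1) / 2"
    and "c = \<nu> + 3 / 2" and "w = 1 / z\<^sup>2"
  have pb: "p = 2 * b"
    by (simp add: p_def b_def)
  have "((\<lambda>z. 1 / z\<^sup>2) has_field_derivative - 2 / z ^ 3) (at z)"
    using zz by (auto intro!: derivative_eq_intros simp: power2_eq_square power3_eq_cube divide_simps)
  from has_field_derivative_Freg_compose[OF this zz(2), of a b c]
  have 1: "((\<lambda>z. Freg a b c (1 / z\<^sup>2)) has_field_derivative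
      a * b * Freg (a + 1) (b + 1) (c + 1) w * (- 2 / z ^ 3)) (at z)"
    by (simp add: w_def)
  have 2: "((\<lambda>z. z powr (- p)) has_field_derivative - p * z powr (- p - 1)) (at z)"
    using zz by (intro has_field_derivative_powr) auto
  have "(sol_infinity \<nu> \<mu> has_field_derivative
      - p * z powr (- p - 1) * Freg a b c w +
      a * b * Freg (a + 1) (b + 1) (c + 1) w * (- 2 / z ^ 3) * z powr (- p)) (at z)"
  proof -
    have "- \<nu> - \<mu> - 1 = - p"
      by (simp add: p_def)
    then have "sol_infinity \<nu> \<mu> = (\<lambda>z. z powr (- p) * Freg a b c (1 / z\<^sup>2))"
      by (simp only: sol_infinity_def[abs_def] a_def b_def c_def)
    then show ?thesis
      using DERIV_mult[OF 2 1] by (simp add: w_def)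
  qed
  also have "- p * z powr (- p - 1) * Freg a b c w +
      a * b * Freg (a + 1) (b + 1) (c + 1) w * (- 2 / z ^ 3) * z powr (- p) =
      - 2 * z powr (- p - 1) * (b * Freg a b c w + w * (a * b * Freg (a + 1) (b + 1) (c + 1) w))"
    using zz by (simp add: powr_diff pb w_def power2_eq_square power3_eq_cube field_simps)
  also have "b * Freg a b c w + w * (a * b * Freg (a + 1) (b + 1) (c + 1) w) = b * Freg a (b + 1) c w"
    using Freg_contiguous_b[of w b a c] zz by (simp add: w_def)
  also have "- 2 * z powr (- p - 1) * (b * Freg a (b + 1) c w) = - (\<nu> + \<mu> + 1) * sol_infinity \<nu> (\<mu> + 1) z"
  proof -
    have "(\<nu> + (\<mu> + 1) + 2) / 2 = b + 1" "(\<nu> + (\<mu> + 1) + 1) / 2 = a" "- \<nu> - (\<mu> + 1) - 1 = - p - 1"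
      by (simp_all add: a_def b_def p_def field_simps)
    then show ?thesis
      unfolding sol_infinity_def Freg_commute[of a] by (simp only: flip: c_def w_def p_def) (simp add: pb)
  qed
  finally show ?thesis .
qed

text \<open>The derivative relation makes the equation a relation between the functions at \<mu>,
  \<mu> + 1 and \<mu> + 2. Contiguity reduces it to a multiple of the hypergeometric equation in w =
  1/z^2.\<close>

lemma gegenbauer_sol_infinity:
  "gegenbauer_sol \<nu> \<mu> (sol_infinity \<nu> \<mu>) (\<lambda>z. - (\<nu> + \<mu> + 1) * sol_infinity \<nu> (\<mu> + 1) z)"
  unfolding gegenbauer_sol_def
proof (intro ballI conjI exI)
  fix z :: complex
  assume z: "z \<in> ball 2 1"
  note zz = in_ball_2_1[OF z]
  show "(sol_infinity \<nu> \<mu> has_field_derivative - (\<nu> + \<mu> + 1) * sol_infinity \<nu> (\<mu> + 1) z) (at z)"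
    by (rule has_field_derivative_sol_infinity[OF z])
  show "((\<lambda>z. - (\<nu> + \<mu> + 1) * sol_infinity \<nu> (\<mu> + 1) z) has_field_derivative
      (\<nu> + \<mu> + 1) * (\<nu> + \<mu> + 2) * sol_infinity \<nu> (\<mu> + 2) z) (at z)"
    using DERIV_cmult[where c = "- (\<nu> + \<mu> + 1)", OF has_field_derivative_sol_infinity[OF z, of \<nu> "\<mu> + 1"]]
    by (simp add: algebra_simps)
  define p a b c w where "p = \<nu> + \<mu> + 1" and "a = (\<nu> + \<mu> + 2) / 2" and "b = (\<nu> + \<mu> + 1) / 2"
    and "c = \<nu> + 3 / 2" and "w = 1 / z\<^sup>2"
  have w: "norm w < 1"
    using zz by (simp add: w_def)
  define F0 F1 F2 where "F0 = Freg a b c w" and "F1 = Freg (a + 1) (b + 1) (c + 1) w"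
    and "F2 = Freg (a + 2) (b + 2) (c + 2) w"
  define X where "X = Freg a (b + 1) c w"
  define Y where "Y = Freg (a + 1) (b + 1) c w"
  define Z where "Z = Freg (a + 1) (b + 2) (c + 1) w"
  have X: "b * X = b * F0 + w * (a * b * F1)"
    using Freg_contiguous_b[OF w, of b a c] by (simp add: X_def F0_def F1_def)
  have Z: "(b + 1) * Z = (b + 1) * F1 + w * ((a + 1) * (b + 1) * F2)"
    using Freg_contiguous_b[OF w, of "b + 1" "a + 1" "c + 1"] by (simp add: Z_def F2_def F1_def add.assoc)
  have Y: "a * Y = a * X + w * (a * (b + 1) * Z)"
    using Freg_contiguous_a[OF w, of a "b + 1" c] by (simp add: X_def Y_def Z_def add.assoc)
  have ode: "w * (1 - w) * (a * b * (a + 1) * (b + 1) * F2) + (c - (a + b + 1) * w) * (a * b * F1) - a * b * F0 = 0"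
    unfolding F0_def F1_def F2_def by (rule Freg_ode[OF w])
  have e: "(\<nu> + (\<mu> + 1) + 2) / 2 = b + 1" "(\<nu> + (\<mu> + 1) + 1) / 2 = a" "- \<nu> - (\<mu> + 1) - 1 = - p - 1"
    "(\<nu> + (\<mu> + 2) + 2) / 2 = a + 1" "(\<nu> + (\<mu> + 2) + 1) / 2 = b + 1" "- \<nu> - (\<mu> + 2) - 1 = - p - 2"
    "- \<nu> - \<mu> - 1 = - p"
    by (simp_all add: a_def b_def p_def field_simps)
  have s: "sol_infinity \<nu> \<mu> z = z powr (- p) * F0" "sol_infinity \<nu> (\<mu> + 1) z = z powr (- p) / z * X"
    "sol_infinity \<nu> (\<mu> + 2) z = z powr (- p) / z\<^sup>2 * Y"
    unfolding sol_infinity_def e F0_def X_def Y_def Freg_commute[of "b + 1" a] a_def[symmetric] b_def[symmetric]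
      c_def[symmetric] w_def[symmetric]
    using zz by (simp_all add: powr_diff)
  \<comment> \<open>The relation a = b + 1/2, special to this series, enters the last
    reduction.\<close>
  have par: "p = 2 * b" "\<nu> + \<mu> + 2 = 2 * a" "a = b + 1 / 2" "\<mu> = a + b - c" "\<nu> = c - 3 / 2"
    by (simp_all add: a_def b_def c_def p_def field_simps)
  have "(z\<^sup>2 - 1) * ((\<nu> + \<mu> + 1) * (\<nu> + \<mu> + 2) * sol_infinity \<nu> (\<mu> + 2) z) +
      2 * (\<mu> + 1) * z * (- (\<nu> + \<mu> + 1) * sol_infinity \<nu> (\<mu> + 1) z) -
      (\<nu> - \<mu>) * (\<nu> + \<mu> + 1) * sol_infinity \<nu> \<mu> z =
    z powr (- p) * ((1 - w) * (p * (\<nu> + \<mu> + 2)) * Y - 2 * (\<mu> + 1) * p * X - (\<nu> - \<mu>) * p * F0)"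
    unfolding s p_def[symmetric] w_def using zz by (simp add: field_simps power2_eq_square)
  also have "(1 - w) * (p * (\<nu> + \<mu> + 2)) * Y - 2 * (\<mu> + 1) * p * X - (\<nu> - \<mu>) * p * F0 =
      4 * b * (1 - w) * (a * Y) - 4 * (\<mu> + 1) * (b * X) - 2 * (\<nu> - \<mu>) * b * F0"
    unfolding par(1,2) by (simp add: algebra_simps)
  also have "\<dots> = 4 * (1 - w) * (a * (b * X) + w * (a * b * ((b + 1) * Z))) - 4 * (\<mu> + 1) * (b * X) - 2 * (\<nu> - \<mu>) * b * F0"
    unfolding Y by (simp add: algebra_simps)
  also have "\<dots> = 4 * w * (w * (1 - w) * (a * b * (a + 1) * (b + 1) * F2) + (c - (a + b + 1) * w) * (a * b * F1) - a * b * F0)"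
    unfolding X Z par(4) par(5) unfolding par(3) by (simp add: field_simps)
  also have "\<dots> = 0"
    unfolding ode by simp
  finally show "(z\<^sup>2 - 1) * ((\<nu> + \<mu> + 1) * (\<nu> + \<mu> + 2) * sol_infinity \<nu> (\<mu> + 2) z) +
      2 * (\<mu> + 1) * z * (- (\<nu> + \<mu> + 1) * sol_infinity \<nu> (\<mu> + 1) z) -
      (\<nu> - \<mu>) * (\<nu> + \<mu> + 1) * sol_infinity \<nu> \<mu> z = 0"
    by simp
qed

lemma has_field_derivative_sol_regular:
  assumes z: "z \<in> ball 2 1"
  shows "(sol_regular \<nu> \<mu> has_field_derivative - ((\<mu> + \<nu> + 1) * (\<mu> - \<nu>)) * sol_regular \<nu> (\<mu> + 1) z) (at z)"
proof -
  have "((\<lambda>z. (1 - z) / 2) has_field_derivative - 1 / 2) (at z)"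
    by (auto intro!: derivative_eq_intros)
  from DERIV_cmult[where c = "2 powr (- \<mu>)", OF has_field_derivative_Freg_compose[OF this in_ball_2_1(3)[OF z],
    of "\<mu> + \<nu> + 1" "\<mu> - \<nu>" "1 + \<mu>"]]
  have "(sol_regular \<nu> \<mu> has_field_derivative 2 powr (- \<mu>) * ((\<mu> + \<nu> + 1) * (\<mu> - \<nu>) *
      Freg (\<mu> + \<nu> + 1 + 1) (\<mu> - \<nu> + 1) (1 + \<mu> + 1) ((1 - z) / 2) * (- 1 / 2))) (at z)"
    unfolding sol_regular_def[abs_def] .
  moreover have "\<mu> + 1 + \<nu> + 1 = \<mu> + \<nu> + 1 + 1" "\<mu> + 1 - \<nu> = \<mu> - \<nu> + 1" "1 + (\<mu> + 1) = 1 + \<mu> + 1"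
      "2 powr (- (\<mu> + 1)) = 2 powr (- \<mu>) / (2 :: complex)"
    by (simp_all add: powr_diff powr_minus powr_add)
  ultimately show ?thesis
    unfolding sol_regular_def by (simp only:) (simp add: mult_ac)
qed

lemma gegenbauer_sol_regular:
  "gegenbauer_sol \<nu> \<mu> (sol_regular \<nu> \<mu>) (\<lambda>z. - ((\<mu> + \<nu> + 1) * (\<mu> - \<nu>)) * sol_regular \<nu> (\<mu> + 1) z)"
  unfolding gegenbauer_sol_def
proof (intro ballI conjI exI)
  fix z :: complex
  assume z: "z \<in> ball 2 1"
  define a b c t where "a = \<mu> + \<nu> + 1" and "b = \<mu> - \<nu>" and "c = 1 + \<mu>" and "t = (1 - z) / 2"
  show "(sol_regular \<nu> \<mu> has_field_derivative - ((\<mu> + \<nu> + 1) * (\<mu> - \<nu>)) * sol_regular \<nu> (\<mu> + 1) z) (at z)"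
    by (rule has_field_derivative_sol_regular[OF z])
  show "((\<lambda>z. - ((\<mu> + \<nu> + 1) * (\<mu> - \<nu>)) * sol_regular \<nu> (\<mu> + 1) z) has_field_derivative
      a * b * ((a + 1) * (b + 1)) * sol_regular \<nu> (\<mu> + 2) z) (at z)"
    using DERIV_cmult[where c = "- ((\<mu> + \<nu> + 1) * (\<mu> - \<nu>))", OF has_field_derivative_sol_regular[OF z, of \<nu> "\<mu> + 1"]]
    by (simp add: a_def b_def algebra_simps)
  have t: "norm t < 1"
    using in_ball_2_1[OF z] by (simp add: t_def)
  define F0 F1 F2 where "F0 = Freg a b c t" and "F1 = Freg (a + 1) (b + 1) (c + 1) t"
    and "F2 = Freg (a + 2) (b + 2) (c + 2) t"
  have e: "\<mu> + 1 + \<nu> + 1 = a + 1" "\<mu> + 1 - \<nu> = b + 1" "1 + (\<mu> + 1) = c + 1"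
    "\<mu> + 2 + \<nu> + 1 = a + 2" "\<mu> + 2 - \<nu> = b + 2" "1 + (\<mu> + 2) = c + 2"
    by (simp_all add: a_def b_def c_def)
  have s: "sol_regular \<nu> \<mu> z = 2 powr (- \<mu>) * F0" "sol_regular \<nu> (\<mu> + 1) z = 2 powr (- \<mu>) / 2 * F1"
    "sol_regular \<nu> (\<mu> + 2) z = 2 powr (- \<mu>) / 4 * F2"
    unfolding sol_regular_def e F0_def F1_def F2_def a_def[symmetric] b_def[symmetric]
      c_def[symmetric] t_def[symmetric]
    by (simp_all add: powr_diff powr_minus powr_add)
  have ode: "t * (1 - t) * (a * b * (a + 1) * (b + 1) * F2) + (c - (a + b + 1) * t) * (a * b * F1) - a * b * F0 = 0"
    unfolding F0_def F1_def F2_def by (rule Freg_ode[OF t])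
  have zt: "z = 1 - 2 * t"
    by (simp add: t_def field_simps)
  have par: "\<mu> = (a + b - 1) / 2" "\<nu> = (a - b - 1) / 2" "c = (a + b + 1) / 2"
    by (simp_all add: a_def b_def c_def field_simps)
  have "(z\<^sup>2 - 1) * (a * b * ((a + 1) * (b + 1)) * sol_regular \<nu> (\<mu> + 2) z) +
      2 * (\<mu> + 1) * z * (- ((\<mu> + \<nu> + 1) * (\<mu> - \<nu>)) * sol_regular \<nu> (\<mu> + 1) z) -
      (\<nu> - \<mu>) * (\<nu> + \<mu> + 1) * sol_regular \<nu> \<mu> z =
    - (2 powr (- \<mu>)) * (t * (1 - t) * (a * b * (a + 1) * (b + 1) * F2) + (c - (a + b + 1) * t) * (a * b * F1) - a * b * F0)"
    unfolding s unfolding zt c_def a_def b_def by (simp add: field_simps power2_eq_square)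
  also have "\<dots> = 0"
    unfolding ode by simp
  finally show "(z\<^sup>2 - 1) * (a * b * ((a + 1) * (b + 1)) * sol_regular \<nu> (\<mu> + 2) z) +
      2 * (\<mu> + 1) * z * (- ((\<mu> + \<nu> + 1) * (\<mu> - \<nu>)) * sol_regular \<nu> (\<mu> + 1) z) -
      (\<nu> - \<mu>) * (\<nu> + \<mu> + 1) * sol_regular \<nu> \<mu> z = 0" .
qed

text \<open>Differentiation lowers c from 1 - \<mu> to -\<mu> by \<open>Freg_contiguous_c\<close>,
  with no constant left over.\<close>

lemma has_field_derivative_sol_singular:
  assumes z: "z \<in> ball 2 1"
  shows "(sol_singular \<nu> \<mu> has_field_derivative sol_singular \<nu> (\<mu> + 1) z) (at z)"
proof -
  note zz = in_ball_2_1[OF z]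
  define a b c t where "a = - \<nu>" and "b = \<nu> + 1" and "c = - \<mu>" and "t = (1 - z) / 2"
  have "((\<lambda>z. (1 - z) / 2) has_field_derivative - 1 / 2) (at z)"
    by (auto intro!: derivative_eq_intros)
  from has_field_derivative_Freg_compose[OF this zz(3), of a b "c + 1"]
  have 1: "((\<lambda>z. Freg a b (c + 1) ((1 - z) / 2)) has_field_derivative
      a * b * Freg (a + 1) (b + 1) (c + 2) t * (- 1 / 2)) (at z)"
    by (simp add: t_def add.assoc)
  have 2: "((\<lambda>z. (z - 1) powr c) has_field_derivative c * (z - 1) powr (c - 1)) (at z)"
    using zz by (auto intro!: derivative_eq_intros)
  have "(sol_singular \<nu> \<mu> has_field_derivative c * (z - 1) powr (c - 1) * Freg a b (c + 1) t +
      a * b * Freg (a + 1) (b + 1) (c + 2) t * (- 1 / 2) * (z - 1) powr c) (at z)"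
  proof -
    have "1 - \<mu> = c + 1"
      by (simp add: c_def)
    then have "sol_singular \<nu> \<mu> = (\<lambda>z. (z - 1) powr c * Freg a b (c + 1) ((1 - z) / 2))"
      by (simp only: sol_singular_def[abs_def] a_def b_def c_def)
    then show ?thesis
      using DERIV_mult[OF 2 1] by (simp add: t_def)
  qed
  also have "c * (z - 1) powr (c - 1) * Freg a b (c + 1) t +
      a * b * Freg (a + 1) (b + 1) (c + 2) t * (- 1 / 2) * (z - 1) powr c =
    (z - 1) powr (c - 1) * (c * Freg a b (c + 1) t + t * (a * b * Freg (a + 1) (b + 1) (c + 2) t))"
    using zz by (simp add: powr_diff t_def field_simps)
  also have "c * Freg a b (c + 1) t + t * (a * b * Freg (a + 1) (b + 1) (c + 2) t) = Freg a b c t"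
    using Freg_contiguous_c[of t a b c] zz by (simp add: t_def)
  also have "(z - 1) powr (c - 1) * Freg a b c t = sol_singular \<nu> (\<mu> + 1) z"
    by (simp add: sol_singular_def a_def b_def c_def t_def)
  finally show ?thesis .
qed

lemma gegenbauer_sol_singular: "gegenbauer_sol \<nu> \<mu> (sol_singular \<nu> \<mu>) (sol_singular \<nu> (\<mu> + 1))"
  unfolding gegenbauer_sol_def
proof (intro ballI conjI exI)
  fix z :: complex
  assume z: "z \<in> ball 2 1"
  note zz = in_ball_2_1[OF z]
  show "(sol_singular \<nu> \<mu> has_field_derivative sol_singular \<nu> (\<mu> + 1) z) (at z)"
    by (rule has_field_derivative_sol_singular[OF z])
  show "(sol_singular \<nu> (\<mu> + 1) has_field_derivative sol_singular \<nu> (\<mu> + 2) z) (at z)"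
    using has_field_derivative_sol_singular[OF z, of \<nu> "\<mu> + 1"] by (simp add: add.assoc)
  define a b c t where "a = - \<nu>" and "b = \<nu> + 1" and "c = 1 - \<mu>" and "t = (1 - z) / 2"
  have t: "norm t < 1"
    using zz by (simp add: t_def)
  define F0 F1 F2 where "F0 = Freg a b c t" and "F1 = Freg (a + 1) (b + 1) (c + 1) t"
    and "F2 = Freg (a + 2) (b + 2) (c + 2) t"
  define X where "X = Freg a b (c - 1) t"
  define Y where "Y = Freg a b (c - 2) t"
  define Z where "Z = Freg (a + 1) (b + 1) c t"
  have X: "X = (c - 1) * F0 + t * (a * b * F1)"
    using Freg_contiguous_c[OF t, of a b "c - 1"] by (simp add: X_def F0_def F1_def add.commute[of 1])
  have Z: "Z = c * F1 + t * ((a + 1) * (b + 1) * F2)"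
    using Freg_contiguous_c[OF t, of "a + 1" "b + 1" c] by (simp add: Z_def F2_def F1_def add.assoc)
  have Y: "Y = (c - 2) * X + t * (a * b * Z)"
    using Freg_contiguous_c[OF t, of a b "c - 2"] by (simp add: X_def Y_def Z_def)
  have ode: "t * (1 - t) * (a * b * (a + 1) * (b + 1) * F2) + (c - (a + b + 1) * t) * (a * b * F1) - a * b * F0 = 0"
    unfolding F0_def F1_def F2_def by (rule Freg_ode[OF t])
  have e: "1 - (\<mu> + 1) = c - 1" "1 - (\<mu> + 2) = c - 2"
    by (simp_all add: c_def)
  have s: "sol_singular \<nu> \<mu> z = (z - 1) powr (- \<mu>) * F0"
    "sol_singular \<nu> (\<mu> + 1) z = (z - 1) powr (- \<mu>) / (z - 1) * X"
    "sol_singular \<nu> (\<mu> + 2) z = (z - 1) powr (- \<mu>) / (z - 1)\<^sup>2 * Y"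
    unfolding sol_singular_def e F0_def X_def Y_def a_def[symmetric] b_def[symmetric]
      c_def[symmetric] t_def[symmetric]
    using zz by (simp_all add: powr_diff powr_minus powr_add divide_simps)
  have zt: "z = 1 - 2 * t"
    by (simp add: t_def field_simps)
  have t0: "t \<noteq> 0"
    using zz by (simp add: t_def)
  have "(z\<^sup>2 - 1) * (P / (z - 1)\<^sup>2 * Y) + 2 * (\<mu> + 1) * z * (P / (z - 1) * X) -
      (\<nu> - \<mu>) * (\<nu> + \<mu> + 1) * (P * F0) =
    - (P / t) * ((1 - t) * Y + (\<mu> + 1) * (1 - 2 * t) * X + (\<nu> - \<mu>) * (\<nu> + \<mu> + 1) * t * F0)" for P
    unfolding zt using t0 by (simp add: field_simps power2_eq_square)
  then have "(z\<^sup>2 - 1) * sol_singular \<nu> (\<mu> + 2) z + 2 * (\<mu> + 1) * z * sol_singular \<nu> (\<mu> + 1) z -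
      (\<nu> - \<mu>) * (\<nu> + \<mu> + 1) * sol_singular \<nu> \<mu> z =
    - ((z - 1) powr (- \<mu>) / t) * ((1 - t) * Y + (\<mu> + 1) * (1 - 2 * t) * X + (\<nu> - \<mu>) * (\<nu> + \<mu> + 1) * t * F0)"
    unfolding s .
  also have "(1 - t) * Y + (\<mu> + 1) * (1 - 2 * t) * X + (\<nu> - \<mu>) * (\<nu> + \<mu> + 1) * t * F0 =
    t * (t * (1 - t) * (a * b * (a + 1) * (b + 1) * F2) + (c - (a + b + 1) * t) * (a * b * F1) - a * b * F0)"
    unfolding Y X Z c_def a_def b_def by (simp add: algebra_simps)
  also have "\<dots> = 0"
    unfolding ode by simp
  finally show "(z\<^sup>2 - 1) * sol_singular \<nu> (\<mu> + 2) z + 2 * (\<mu> + 1) * z * sol_singular \<nu> (\<mu> + 1) z -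
      (\<nu> - \<mu>) * (\<nu> + \<mu> + 1) * sol_singular \<nu> \<mu> z = 0"
    by simp
qed

text \<open>Abel's identity: the Wronskian W satisfies (z^2 - 1) W' = -2 (\<mu> + 1) z W, and the
  power of z^2 - 1 is the integrating factor. It is split into two principal powers, as in
  \<open>legendre_Q\<close>.\<close>

lemma wronskian_constant:
  assumes u: "gegenbauer_sol \<nu> \<mu> u u'" and v: "gegenbauer_sol \<nu> \<mu> v v'"
  shows "\<exists>C. \<forall>z\<in>ball 2 1. (z - 1) powr (\<mu> + 1) * (z + 1) powr (\<mu> + 1) * (u z * v' z - u' z * v z) = C"
proof (rule has_field_derivative_zero_constant)
  fix z :: complex
  assume z: "z \<in> ball 2 1"
  note zz = in_ball_2_1[OF z]
  define m where "m = \<mu> + 1"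
  obtain du where du: "(u has_field_derivative u' z) (at z)" "(u' has_field_derivative du) (at z)"
      "(z\<^sup>2 - 1) * du + 2 * m * z * u' z - (\<nu> - \<mu>) * (\<nu> + \<mu> + 1) * u z = 0"
    using u z unfolding gegenbauer_sol_def m_def by blast
  obtain dv where dv: "(v has_field_derivative v' z) (at z)" "(v' has_field_derivative dv) (at z)"
      "(z\<^sup>2 - 1) * dv + 2 * m * z * v' z - (\<nu> - \<mu>) * (\<nu> + \<mu> + 1) * v z = 0"
    using v z unfolding gegenbauer_sol_def m_def by blast
  define P where "P = (z - 1) powr m * (z + 1) powr m"
  have "((\<lambda>z. (z - 1) powr m * (z + 1) powr m) has_field_derivative
      m * (z - 1) powr (m - 1) * (z + 1) powr m + m * (z + 1) powr (m - 1) * (z - 1) powr m) (at z)"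
    using zz by (auto intro!: derivative_eq_intros)
  also have "m * (z - 1) powr (m - 1) * (z + 1) powr m + m * (z + 1) powr (m - 1) * (z - 1) powr m =
      P * (2 * m * z) / (z\<^sup>2 - 1)"
  proof -
    have "z\<^sup>2 - 1 = (z - 1) * (z + 1)"
      by (simp add: power2_eq_square algebra_simps)
    then show ?thesis
      using zz by (simp add: powr_diff P_def divide_simps) (simp add: algebra_simps)
  qed
  finally have P: "((\<lambda>z. (z - 1) powr m * (z + 1) powr m) has_field_derivative P * (2 * m * z) / (z\<^sup>2 - 1)) (at z)" .
  have W: "((\<lambda>z. u z * v' z - u' z * v z) has_field_derivative u z * dv - du * v z) (at z)"
    using du dv by (auto intro!: derivative_eq_intros)
  have nz: "z\<^sup>2 - 1 \<noteq> 0"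
    using zz by (metis add.commute add_neg_numeral_special(8) eq_iff_diff_eq_0 power2_eq_1_iff)
  have Weq: "(z\<^sup>2 - 1) * (u z * dv - du * v z) = - 2 * m * z * (u z * v' z - u' z * v z)"
  proof -
    have "(z\<^sup>2 - 1) * (u z * dv - du * v z) + 2 * m * z * (u z * v' z - u' z * v z) =
       u z * ((z\<^sup>2 - 1) * dv + 2 * m * z * v' z - (\<nu> - \<mu>) * (\<nu> + \<mu> + 1) * v z) -
       v z * ((z\<^sup>2 - 1) * du + 2 * m * z * u' z - (\<nu> - \<mu>) * (\<nu> + \<mu> + 1) * u z)"
      by (simp add: algebra_simps)
    also have "\<dots> = 0"
      unfolding du(3) dv(3) by simp
    finally show ?thesis
      by (simp add: add_eq_0_iff)
  qed
  have Wd: "u z * dv - du * v z = - 2 * m * z * (u z * v' z - u' z * v z) / (z\<^sup>2 - 1)"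
    by (rule eq_divide_imp[OF nz], subst mult.commute, rule Weq)
  have "P * (2 * m * z) / (z\<^sup>2 - 1) * (u z * v' z - u' z * v z) + (u z * dv - du * v z) * P = 0"
    unfolding Wd using nz by (simp add: field_simps)
  then have "((\<lambda>z. (z - 1) powr m * (z + 1) powr m * (u z * v' z - u' z * v z)) has_field_derivative 0) (at z)"
    using DERIV_mult[OF P W] by (simp add: P_def)
  then show "((\<lambda>z. (z - 1) powr (\<mu> + 1) * (z + 1) powr (\<mu> + 1) * (u z * v' z - u' z * v z))
      has_field_derivative 0) (at z within ball 2 1)"
    unfolding m_def by (rule has_field_derivative_at_within)
qed simp

subsection \<open>The connection formula\<close>

lemma tendsto_Freg_0:
  assumes "(g \<longlongrightarrow> 0) F"
  shows "((\<lambda>x. Freg a b c (g x)) \<longlongrightarrow> rGamma c) F"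
proof -
  have "isCont (Freg a b c) 0"
    by (rule DERIV_isCont[OF has_field_derivative_Freg]) simp
  then show ?thesis
    using isCont_tendsto_compose[OF _ assms, of "Freg a b c"] by (simp add: Freg_0)
qed

lemma Re_add_nat_pos: "\<exists>n. Re (\<mu> + of_nat n) > 0"
proof -
  obtain n where "- Re \<mu> < real n"
    using reals_Archimedean2 by blast
  then show ?thesis
    by (intro exI[of _ n]) simp
qed

text \<open>Stated with 1/Gamma so that poles are included: if z or z + 1/2 is a nonpositive integer
  then so is 2z, and both sides vanish.\<close>

lemma rGamma_duplication:
  fixes z :: complex
  shows "rGamma z * rGamma (z + 1 / 2) * of_real (sqrt pi) = 2 powr (2 * z - 1) * rGamma (2 * z)"
proof (cases "z \<in> \<int>\<^sub>\<le>\<^sub>0 \<or> z + 1 / 2 \<in> \<int>\<^sub>\<le>\<^sub>0")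
  case True
  then have "2 * z \<in> \<int>\<^sub>\<le>\<^sub>0"
  proof
    assume "z \<in> \<int>\<^sub>\<le>\<^sub>0"
    then obtain n where "z = - of_nat n"
      by (elim nonpos_Ints_cases')
    then have "2 * z = - of_nat (2 * n)"
      by simp
    then show ?thesis
      by (metis minus_of_nat_in_nonpos_Ints)
  next
    assume "z + 1 / 2 \<in> \<int>\<^sub>\<le>\<^sub>0"
    then obtain n where "z + 1 / 2 = - of_nat n"
      by (elim nonpos_Ints_cases')
    moreover have "2 * z = 2 * (z + 1 / 2) - 1"
      by simp
    ultimately have "2 * z = - of_nat (2 * n + 1)"
      by simp
    then show ?thesis
      by (metis minus_of_nat_in_nonpos_Ints)
  qed
  then have "rGamma (2 * z) = 0"
    by (simp only: rGamma_eq_zero_iff)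
  moreover have "rGamma z = 0 \<or> rGamma (z + 1 / 2) = 0"
    using True by (simp only: rGamma_eq_zero_iff)
  ultimately show ?thesis
    by auto
next
  case False
  then have nz: "Gamma z \<noteq> 0" "Gamma (z + 1 / 2) \<noteq> 0"
    by (auto simp: Gamma_eq_zero_iff)
  have G: "Gamma z * Gamma (z + 1 / 2) = exp ((1 - 2 * z) * of_real (ln 2)) * of_real (sqrt pi) * Gamma (2 * z)"
    using False by (intro Gamma_legendre_duplication) auto
  with nz have nz': "Gamma (2 * z) \<noteq> 0"
    by auto
  have "Ln 2 = of_real (ln 2)"
    using Ln_of_real[of 2] by simp
  then have "exp ((1 - 2 * z) * of_real (ln 2)) = 2 powr (- (2 * z - 1))"
    by (simp add: powr_def)
  then have "Gamma z * Gamma (z + 1 / 2) * 2 powr (2 * z - 1) = of_real (sqrt pi) * Gamma (2 * z)"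
    unfolding G powr_minus by simp
  then show ?thesis
    unfolding rGamma_inverse_Gamma using nz nz' by (simp add: field_simps)
qed

lemma at_right_1_real: "eventually (\<lambda>x::real. x \<in> {1<..<3}) (at_right 1)"
  by (rule eventually_at_right_real) simp

lemma of_real_in_ball_2_1: "x \<in> {1<..<3} \<Longrightarrow> complex_of_real x \<in> ball 2 1"
  using norm_of_real[of "2 - x", where ?'a = complex] by (auto simp: dist_norm abs_less_iff)

text \<open>From x - 1 = x^2/(x + 1) (1 - 1/x^2) the behaviour of the series at argument 1 applies
  with p = \<mu>; duplication merges the two reciprocal Gamma factors. Real x suffice, since the
  limit only evaluates a constant Wronskian.\<close>

lemma sol_infinity_asymp:
  assumes "Re \<mu> > 0"
  shows "((\<lambda>x::real. (of_real x - 1) powr \<mu> * sol_infinity \<nu> \<mu> (of_real x)) \<longlongrightarrow>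
    2 powr \<nu> / of_real (sqrt pi) * Gamma \<mu> * rGamma (\<nu> + \<mu> + 1)) (at_right 1)"
proof -
  define a b c where "a = (\<nu> + \<mu> + 2) / 2" and "b = (\<nu> + \<mu> + 1) / 2" and "c = \<nu> + 3 / 2"
  have \<mu>: "\<mu> = a + b - c"
    by (simp add: a_def b_def c_def field_simps)
  have "((\<lambda>x::real. 1 / x\<^sup>2) \<longlongrightarrow> 1 / 1\<^sup>2) (at_right 1)"
    by (intro tendsto_intros) auto
  then have "filterlim (\<lambda>x::real. 1 / x\<^sup>2) (at_left 1) (at_right 1)"
    using at_right_1_real
    by (intro filterlim_at_withinI) (auto elim!: eventually_mono simp: one_less_power)
  from filterlim_compose[OF Freg_asymp_at_1[OF \<mu> assms] this]
  have 1: "((\<lambda>x::real. of_real (1 - 1 / x\<^sup>2) powr \<mu> * Freg a b c (of_real (1 / x\<^sup>2))) \<longlongrightarrow>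
      Gamma \<mu> * rGamma a * rGamma b) (at_right 1)" .
  have 2: "((\<lambda>x::real. of_real x powr (- \<nu> - \<mu> - 1) * of_real (x\<^sup>2 / (x + 1)) powr \<mu>) \<longlongrightarrow>
      of_real 1 powr (- \<nu> - \<mu> - 1) * of_real (1\<^sup>2 / (1 + 1)) powr \<mu>) (at_right 1)"
    by (intro tendsto_intros) (auto simp: complex_nonpos_Reals_iff)
  have "eventually (\<lambda>x::real. of_real x powr (- \<nu> - \<mu> - 1) * of_real (x\<^sup>2 / (x + 1)) powr \<mu> *
      (of_real (1 - 1 / x\<^sup>2) powr \<mu> * Freg a b c (of_real (1 / x\<^sup>2))) =
      (of_real x - 1) powr \<mu> * sol_infinity \<nu> \<mu> (of_real x)) (at_right 1)"
    using at_right_1_real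
  proof eventually_elim
    case (elim x)
    have "x\<^sup>2 / (x + 1) * (1 - 1 / x\<^sup>2) = x - 1"
      using elim by (simp add: divide_simps power2_eq_square) (simp add: algebra_simps)
    then have "complex_of_real (x\<^sup>2 / (x + 1)) * of_real (1 - 1 / x\<^sup>2) = of_real (x - 1)"
      by (simp only: flip: of_real_mult)
    moreover have "1 / x\<^sup>2 \<le> 1"
      using elim by (simp add: one_le_power)
    then have "(complex_of_real (x\<^sup>2 / (x + 1)) * of_real (1 - 1 / x\<^sup>2)) powr \<mu> =
        of_real (x\<^sup>2 / (x + 1)) powr \<mu> * of_real (1 - 1 / x\<^sup>2) powr \<mu>"
      using elim by (intro powr_times_real Reals_of_real; simp only: Re_complex_of_real) auto
    ultimately have "of_real (x\<^sup>2 / (x + 1)) powr \<mu> * of_real (1 - 1 / x\<^sup>2) powr \<mu> = (of_real (x - 1) :: complex) powr \<mu>"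
      by simp
    then show ?case
      by (simp add: sol_infinity_def a_def b_def c_def mult_ac)
  qed
  with tendsto_mult[OF 2 1] have "((\<lambda>x::real. (of_real x - 1) powr \<mu> * sol_infinity \<nu> \<mu> (of_real x)) \<longlongrightarrow>
      of_real 1 powr (- \<nu> - \<mu> - 1) * of_real (1\<^sup>2 / (1 + 1)) powr \<mu> *
      (Gamma \<mu> * rGamma a * rGamma b)) (at_right 1)"
    by (rule Lim_transform_eventually)
  moreover have "of_real 1 powr (- \<nu> - \<mu> - 1) * of_real (1\<^sup>2 / (1 + 1)) powr \<mu> *
      (Gamma \<mu> * rGamma a * rGamma b) =
      2 powr \<nu> / of_real (sqrt pi) * Gamma \<mu> * rGamma (\<nu> + \<mu> + 1)"
  proof -
    have "b + 1 / 2 = a" "2 * b - 1 = \<nu> + \<mu>" "2 * b = \<nu> + \<mu> + 1"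
      by (simp_all add: a_def b_def field_simps)
    with rGamma_duplication[of b]
    have d: "rGamma b * rGamma a * of_real (sqrt pi) = 2 powr (\<nu> + \<mu>) * rGamma (\<nu> + \<mu> + 1)"
      by simp
    have "(of_real (1 / 2) :: complex) powr \<mu> * 2 powr \<mu> = 1"
      by (subst powr_times_real[symmetric]) auto
    then have h: "(1 / 2 :: complex) powr \<mu> = 1 / 2 powr \<mu>"
      by (simp add: field_simps)
    have "rGamma a * rGamma b = 2 powr (\<nu> + \<mu>) * rGamma (\<nu> + \<mu> + 1) / of_real (sqrt pi)"
      using d by (simp add: field_simps)
    then show ?thesis
      by (simp add: h powr_add mult.assoc)
  qed
  ultimately show ?thesis
    by simp
qed

lemma plus1_powr_tendsto:
  "((\<lambda>x::real. (of_real x + 1 :: complex) powr m) \<longlongrightarrow> (of_real 1 + 1) powr m) (at_right 1)"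
  by (intro tendsto_intros) (auto simp: complex_nonpos_Reals_iff)

lemma minus1_tendsto: "((\<lambda>x::real. of_real x - 1 :: complex) \<longlongrightarrow> of_real 1 - 1) (at_right 1)"
  by (intro tendsto_intros)

section \<open>Values of the Wronskians\<close>

text \<open>The constant is read off as z decreases to 1. The powers of z - 1 cancel exactly, one
  product keeps a factor z - 1 and disappears, and the other gives -2/(Gamma(-\<mu>) Gamma(1 +
  \<mu>)), which the reflection formula evaluates.\<close>

lemma wronskian_singular_regular:
  assumes z: "z \<in> ball 2 1"
  shows "(z - 1) powr (\<mu> + 1) * (z + 1) powr (\<mu> + 1) *
    (sol_singular \<nu> \<mu> z * (- ((\<mu> + \<nu> + 1) * (\<mu> - \<nu>)) * sol_regular \<nu> (\<mu> + 1) z) -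
     sol_singular \<nu> (\<mu> + 1) z * sol_regular \<nu> \<mu> z) = 2 * sin (of_real pi * \<mu>) / of_real pi"
proof -
  define k where "k = - ((\<mu> + \<nu> + 1) * (\<mu> - \<nu>))"
  define W where "W z = (z - 1) powr (\<mu> + 1) * (z + 1) powr (\<mu> + 1) *
    (sol_singular \<nu> \<mu> z * (k * sol_regular \<nu> (\<mu> + 1) z) - sol_singular \<nu> (\<mu> + 1) z * sol_regular \<nu> \<mu> z)" for z
  have "\<exists>C. \<forall>z\<in>ball 2 1. W z = C"
    unfolding W_def k_def
    by (rule wronskian_constant[OF gegenbauer_sol_singular gegenbauer_sol_regular])
  then obtain C where C: "\<And>z. z \<in> ball 2 1 \<Longrightarrow> W z = C"
    by blast
  have "((\<lambda>x::real. (1 - complex_of_real x) / 2) \<longlongrightarrow> (1 - of_real 1) / 2) (at_right 1)"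
    by (intro tendsto_intros) auto
  then have F: "((\<lambda>x::real. Freg a b c ((1 - of_real x) / 2)) \<longlongrightarrow> rGamma c) (at_right 1)" for a b c
    by (intro tendsto_Freg_0) simp
  have lim: "((\<lambda>x::real. (of_real x + 1) powr (\<mu> + 1) *
     ((of_real x - 1) * Freg (- \<nu>) (\<nu> + 1) (1 - \<mu>) ((1 - of_real x) / 2) *
       (k * (2 powr (- (\<mu> + 1)) * Freg (\<mu> + 1 + \<nu> + 1) (\<mu> + 1 - \<nu>) (1 + (\<mu> + 1)) ((1 - of_real x) / 2))) -
      Freg (- \<nu>) (\<nu> + 1) (1 - (\<mu> + 1)) ((1 - of_real x) / 2) *
       (2 powr (- \<mu>) * Freg (\<mu> + \<nu> + 1) (\<mu> - \<nu>) (1 + \<mu>) ((1 - of_real x) / 2)))) \<longlongrightarrow>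
     (of_real 1 + 1) powr (\<mu> + 1) *
     ((of_real 1 - 1) * rGamma (1 - \<mu>) * (k * (2 powr (- (\<mu> + 1)) * rGamma (1 + (\<mu> + 1)))) -
      rGamma (1 - (\<mu> + 1)) * (2 powr (- \<mu>) * rGamma (1 + \<mu>)))) (at_right 1)"
    by (rule tendsto_mult[OF plus1_powr_tendsto tendsto_diff[OF
          tendsto_mult[OF tendsto_mult[OF minus1_tendsto F] tendsto_mult[OF tendsto_const tendsto_mult[OF tendsto_const F]]]
          tendsto_mult[OF F tendsto_mult[OF tendsto_const F]]]])
  have ev: "eventually (\<lambda>x::real. (of_real x + 1) powr (\<mu> + 1) *
     ((of_real x - 1) * Freg (- \<nu>) (\<nu> + 1) (1 - \<mu>) ((1 - of_real x) / 2) *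
       (k * (2 powr (- (\<mu> + 1)) * Freg (\<mu> + 1 + \<nu> + 1) (\<mu> + 1 - \<nu>) (1 + (\<mu> + 1)) ((1 - of_real x) / 2))) -
      Freg (- \<nu>) (\<nu> + 1) (1 - (\<mu> + 1)) ((1 - of_real x) / 2) *
       (2 powr (- \<mu>) * Freg (\<mu> + \<nu> + 1) (\<mu> - \<nu>) (1 + \<mu>) ((1 - of_real x) / 2))) = C) (at_right 1)"
    using at_right_1_real
  proof eventually_elim
    case (elim x)
    have x: "complex_of_real x - 1 \<noteq> 0"
      using elim by auto
    define A where "A = (complex_of_real x - 1) powr \<mu>"
    have A: "A \<noteq> 0" "(complex_of_real x - 1) powr (\<mu> + 1) = A * (of_real x - 1)"
      "(complex_of_real x - 1) powr (- \<mu>) = 1 / A" "(complex_of_real x - 1) powr (- (\<mu> + 1)) = 1 / (A * (of_real x - 1))"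
      using x by (simp_all add: A_def powr_add powr_minus powr_diff field_simps)
    have aux: "p * (y * G * (k * H') - G' * H) = A * y * p * (1 / A * G * (k * H') - 1 / (A * y) * G' * H)"
      if "A \<noteq> 0" "y \<noteq> 0" for A y p G G' H H' :: complex
      using that by (simp add: field_simps)
    show ?case
      unfolding C[OF of_real_in_ball_2_1[OF elim], symmetric] W_def sol_singular_def sol_regular_def A(2,3,4)
      by (rule aux[OF A(1) x])
  qed
  have "C = (of_real 1 + 1) powr (\<mu> + 1) *
     ((of_real 1 - 1) * rGamma (1 - \<mu>) * (k * (2 powr (- (\<mu> + 1)) * rGamma (1 + (\<mu> + 1)))) -
      rGamma (1 - (\<mu> + 1)) * (2 powr (- \<mu>) * rGamma (1 + \<mu>)))"
    by (rule tendsto_unique[OF trivial_limit_at_right_real tendsto_eventually[OF ev] lim])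
  also have "\<dots> = - 2 * (rGamma (- \<mu>) * rGamma (1 - (- \<mu>)))"
    by (simp add: powr_add powr_minus)
  also have "\<dots> = 2 * sin (of_real pi * \<mu>) / of_real pi"
    unfolding rGamma_reflection_complex by simp
  finally show ?thesis
    using C[OF z] by (simp add: W_def k_def)
qed

text \<open>As z decreases to 1, the product without the derivative of \<open>sol_infinity\<close>
  keeps a factor z - 1 and vanishes; the other one is governed by the asymptotics at \<mu> + 1. Both
  limits come from \<open>sol_infinity_asymp\<close>, whence Re \<mu> > 0.\<close>

lemma wronskian_infinity_regular:
  assumes \<mu>: "Re \<mu> > 0"
  assumes z: "z \<in> ball 2 1"
  shows "(z - 1) powr (\<mu> + 1) * (z + 1) powr (\<mu> + 1) *
    (sol_infinity \<nu> \<mu> z * (- ((\<mu> + \<nu> + 1) * (\<mu> - \<nu>)) * sol_regular \<nu> (\<mu> + 1) z) -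
     - (\<nu> + \<mu> + 1) * sol_infinity \<nu> (\<mu> + 1) z * sol_regular \<nu> \<mu> z) =
    2 * 2 powr \<nu> / of_real (sqrt pi) * rGamma (\<nu> + \<mu> + 1)"
proof -
  define k where "k = - ((\<mu> + \<nu> + 1) * (\<mu> - \<nu>))"
  define p where "p = \<nu> + \<mu> + 1"
  define W where "W z = (z - 1) powr (\<mu> + 1) * (z + 1) powr (\<mu> + 1) *
    (sol_infinity \<nu> \<mu> z * (k * sol_regular \<nu> (\<mu> + 1) z) - - p * sol_infinity \<nu> (\<mu> + 1) z * sol_regular \<nu> \<mu> z)" for z
  have "\<exists>C. \<forall>z\<in>ball 2 1. W z = C"
    unfolding W_def k_def p_def
    by (rule wronskian_constant[OF gegenbauer_sol_infinity gegenbauer_sol_regular])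
  then obtain C where C: "\<And>z. z \<in> ball 2 1 \<Longrightarrow> W z = C"
    by blast
  define L0 L1 where "L0 = 2 powr \<nu> / of_real (sqrt pi) * Gamma \<mu> * rGamma (\<nu> + \<mu> + 1)"
    and "L1 = 2 powr \<nu> / of_real (sqrt pi) * Gamma (\<mu> + 1) * rGamma (\<nu> + (\<mu> + 1) + 1)"
  have reg: "((\<lambda>x. sol_regular \<nu> m (of_real x)) \<longlongrightarrow> 2 powr (- m) * rGamma (1 + m)) (at_right (1::real))" for m
    unfolding sol_regular_def
  proof -
    have "((\<lambda>x::real. (1 - complex_of_real x) / 2) \<longlongrightarrow> (1 - of_real 1) / 2) (at_right 1)"
      by (intro tendsto_intros) auto
    then show "((\<lambda>x::real. 2 powr (- m) * Freg (m + \<nu> + 1) (m - \<nu>) (1 + m) ((1 - of_real x) / 2)) \<longlongrightarrow>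
        2 powr (- m) * rGamma (1 + m)) (at_right 1)"
      by (intro tendsto_mult tendsto_const tendsto_Freg_0) simp
  qed
  have lim: "((\<lambda>x::real. (of_real x + 1) powr (\<mu> + 1) *
     ((of_real x - 1) * ((of_real x - 1) powr \<mu> * sol_infinity \<nu> \<mu> (of_real x)) *
       (k * sol_regular \<nu> (\<mu> + 1) (of_real x)) +
      p * ((of_real x - 1) powr (\<mu> + 1) * sol_infinity \<nu> (\<mu> + 1) (of_real x)) *
       sol_regular \<nu> \<mu> (of_real x))) \<longlongrightarrow>
     (of_real 1 + 1) powr (\<mu> + 1) *
     ((of_real 1 - 1) * L0 * (k * (2 powr (- (\<mu> + 1)) * rGamma (1 + (\<mu> + 1)))) +
      p * L1 * (2 powr (- \<mu>) * rGamma (1 + \<mu>)))) (at_right 1)"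
    unfolding L0_def L1_def using \<mu>
    by (intro tendsto_mult[OF plus1_powr_tendsto tendsto_add[OF
          tendsto_mult[OF tendsto_mult[OF minus1_tendsto sol_infinity_asymp] tendsto_mult[OF tendsto_const reg]]
          tendsto_mult[OF tendsto_mult[OF tendsto_const sol_infinity_asymp] reg]]]) simp_all
  have ev: "eventually (\<lambda>x::real. (of_real x + 1) powr (\<mu> + 1) *
     ((of_real x - 1) * ((of_real x - 1) powr \<mu> * sol_infinity \<nu> \<mu> (of_real x)) *
       (k * sol_regular \<nu> (\<mu> + 1) (of_real x)) +
      p * ((of_real x - 1) powr (\<mu> + 1) * sol_infinity \<nu> (\<mu> + 1) (of_real x)) *
       sol_regular \<nu> \<mu> (of_real x)) = C) (at_right 1)"
    using at_right_1_real
  proof eventually_elim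
    case (elim x)
    have "complex_of_real x - 1 \<noteq> 0"
      using elim by auto
    then have A: "(complex_of_real x - 1) powr (\<mu> + 1) = (of_real x - 1) powr \<mu> * (of_real x - 1)"
      by (simp add: powr_add)
    have aux: "q * (y * (A * f) * H' + p * (A * y * f') * H) = A * y * q * (f * H' - - p * f' * H)"
      for A y q f f' H H' :: complex
      by (simp add: algebra_simps)
    show ?case
      unfolding C[OF of_real_in_ball_2_1[OF elim], symmetric] W_def A by (rule aux)
  qed
  have "C = (of_real 1 + 1) powr (\<mu> + 1) *
     ((of_real 1 - 1) * L0 * (k * (2 powr (- (\<mu> + 1)) * rGamma (1 + (\<mu> + 1)))) +
      p * L1 * (2 powr (- \<mu>) * rGamma (1 + \<mu>)))"
    by (rule tendsto_unique[OF trivial_limit_at_right_real tendsto_eventually[OF ev] lim])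
  also have "\<dots> = 2 * p * L1 * rGamma (1 + \<mu>)"
    by (simp add: powr_add powr_minus)
  also have "\<dots> = 2 * 2 powr \<nu> / of_real (sqrt pi) * (p * rGamma (p + 1)) * (Gamma (\<mu> + 1) * rGamma (\<mu> + 1))"
    by (simp add: L1_def p_def add_ac)
  also have "p * rGamma (p + 1) = rGamma (\<nu> + \<mu> + 1)"
    by (simp only: rGamma_plus1) (simp add: p_def)
  also have "Gamma (\<mu> + 1) * rGamma (\<mu> + 1) = 1"
  proof -
    have "\<mu> + 1 \<notin> \<int>\<^sub>\<le>\<^sub>0"
      using \<mu> by (auto elim!: nonpos_Ints_cases simp: complex_eq_iff)
    then show ?thesis
      by (simp add: rGamma_inverse_Gamma Gamma_eq_zero_iff)
  qed
  finally show ?thesis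
    using C[OF z] by (simp add: W_def k_def p_def)
qed

lemma sin_pi_neq_0:
  fixes \<mu> :: complex
  assumes "\<mu> \<notin> \<int>"
  shows "sin (of_real pi * \<mu>) \<noteq> 0"
proof
  assume "sin (of_real pi * \<mu>) = 0"
  then obtain n :: int where "of_real pi * \<mu> = of_real (of_int n * pi)"
    unfolding sin_eq_0 by blast
  then have "\<mu> = of_int n"
    by (simp add: mult.commute)
  with assms show False
    by simp
qed

section \<open>Coefficients of the connection formula\<close>

text \<open>Value and derivative at z = 2 form a linear system for A and B whose determinant, the
  Wronskian, is nonzero because sin(pi \<mu>) is.\<close>

lemma sol_independent:
  assumes \<mu>: "\<mu> \<notin> \<int>"
    and eq: "\<And>z. z \<in> ball 2 1 \<Longrightarrow> A * sol_singular \<nu> \<mu> z + B * sol_regular \<nu> \<mu> z = 0"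
  shows "A = 0" "B = 0"
proof -
  define k where "k = - ((\<mu> + \<nu> + 1) * (\<mu> - \<nu>))"
  let ?z = "2 :: complex"
  have z: "?z \<in> ball 2 1"
    by simp
  define g h g' h' where "g = sol_singular \<nu> \<mu> ?z" and "h = sol_regular \<nu> \<mu> ?z"
    and "g' = sol_singular \<nu> (\<mu> + 1) ?z" and "h' = k * sol_regular \<nu> (\<mu> + 1) ?z"
  have 0: "A * g + B * h = 0"
    using eq[OF z] by (simp add: g_def h_def)
  have "((\<lambda>z. A * sol_singular \<nu> \<mu> z + B * sol_regular \<nu> \<mu> z) has_field_derivative A * g' + B * h') (at ?z)"
    unfolding g'_def h'_def k_def
    by (intro DERIV_add DERIV_cmult has_field_derivative_sol_singular has_field_derivative_sol_regular z)
  moreover have "((\<lambda>z. A * sol_singular \<nu> \<mu> z + B * sol_regular \<nu> \<mu> z) has_field_derivative 0) (at ?z)"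
    by (rule has_field_derivative_transform_within_open[where S = "ball 2 1" and f = "\<lambda>_. 0"])
      (use eq z in auto)
  ultimately have 1: "A * g' + B * h' = 0"
    by (rule DERIV_unique)
  have W: "g * h' - g' * h \<noteq> 0"
  proof
    assume "g * h' - g' * h = 0"
    with wronskian_singular_regular[OF z, of \<mu> \<nu>] have "sin (of_real pi * \<mu>) = 0"
      by (simp add: g_def h_def g'_def h'_def k_def)
    with sin_pi_neq_0[OF \<mu>] show False
      by contradiction
  qed
  have "A * (g * h' - g' * h) = h' * (A * g + B * h) - h * (A * g' + B * h')"
    by (simp add: algebra_simps)
  then show "A = 0"
    using 0 1 W by simp
  have "B * (g * h' - g' * h) = g * (A * g' + B * h') - g' * (A * g + B * h)"
    by (simp add: algebra_simps)
  then show "B = 0"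
    using 0 1 W by simp
qed

text \<open>The quotient of the two Wronskians just computed.\<close>

definition conn_coeff :: "complex \<Rightarrow> complex \<Rightarrow> complex" where
  "conn_coeff \<nu> \<mu> = 2 powr \<nu> * of_real (sqrt pi) * rGamma (\<nu> + \<mu> + 1) / sin (of_real pi * \<mu>)"

text \<open>Cramer's rule with the three constant Wronskians. Only the one giving A has been
  evaluated, and only for Re \<mu> > 0.\<close>

lemma sol_infinity_combination:
  assumes \<mu>: "\<mu> \<notin> \<int>"
  shows "\<exists>A B. (\<forall>z\<in>ball 2 1. sol_infinity \<nu> \<mu> z = A * sol_singular \<nu> \<mu> z + B * sol_regular \<nu> \<mu> z) \<and>
    (Re \<mu> > 0 \<longrightarrow> A = conn_coeff \<nu> \<mu>)"
proof -
  define P where "P z = (z - 1) powr (\<mu> + 1) * (z + 1) powr (\<mu> + 1)" for z :: complex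
  define k where "k = - ((\<mu> + \<nu> + 1) * (\<mu> - \<nu>))"
  define f g h f' g' h' where "f = sol_infinity \<nu> \<mu>" and "g = sol_singular \<nu> \<mu>" and "h = sol_regular \<nu> \<mu>"
    and "f' z = - (\<nu> + \<mu> + 1) * sol_infinity \<nu> (\<mu> + 1) z"
    and "g' = sol_singular \<nu> (\<mu> + 1)" and "h' z = k * sol_regular \<nu> (\<mu> + 1) z" for z
  define D where "D = 2 * sin (of_real pi * \<mu>) / of_real pi"
  have D0: "D \<noteq> 0"
    using sin_pi_neq_0[OF \<mu>] by (simp add: D_def)
  have gh: "P z * (g z * h' z - g' z * h z) = D" if "z \<in> ball 2 1" for z
    using wronskian_singular_regular[OF that] by (simp add: P_def g_def h_def g'_def h'_def k_def D_def)
  have "\<exists>C. \<forall>z\<in>ball 2 1. P z * (f z * h' z - f' z * h z) = C"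
    unfolding P_def f_def h_def f'_def h'_def k_def
    by (rule wronskian_constant[OF gegenbauer_sol_infinity gegenbauer_sol_regular])
  then obtain C1 where C1: "P z * (f z * h' z - f' z * h z) = C1" if "z \<in> ball 2 1" for z
    by blast
  have "\<exists>C. \<forall>z\<in>ball 2 1. P z * (f z * g' z - f' z * g z) = C"
    unfolding P_def f_def g_def f'_def g'_def
    by (rule wronskian_constant[OF gegenbauer_sol_infinity gegenbauer_sol_singular])
  then obtain C2 where C2: "P z * (f z * g' z - f' z * g z) = C2" if "z \<in> ball 2 1" for z
    by blast
  show ?thesis
  proof (intro exI conjI ballI impI)
    fix z :: complex
    assume z: "z \<in> ball 2 1"
    have "D * f z = C1 * g z - C2 * h z"
      unfolding gh[OF z, symmetric] C1[OF z, symmetric] C2[OF z, symmetric] by (simp add: algebra_simps)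
    then have "f z = C1 / D * g z + (- C2 / D) * h z"
      using D0 by (simp add: field_simps)
    then show "sol_infinity \<nu> \<mu> z = C1 / D * sol_singular \<nu> \<mu> z + (- C2 / D) * sol_regular \<nu> \<mu> z"
      by (simp add: f_def g_def h_def)
  next
    assume re: "Re \<mu> > 0"
    have "(2::complex) \<in> ball 2 1"
      by simp
    from C1[OF this] wronskian_infinity_regular[OF re this, of \<nu>]
    have "C1 = 2 * 2 powr \<nu> / of_real (sqrt pi) * rGamma (\<nu> + \<mu> + 1)"
      by (simp only: P_def f_def h_def f'_def h'_def k_def)
    moreover have "D = 2 * sin (of_real pi * \<mu>) / (of_real (sqrt pi) * of_real (sqrt pi))"
      by (simp add: D_def flip: of_real_mult)
    moreover have "2 * x / q * y / (2 * S / (q * q)) = x * q * y / S" if "q \<noteq> 0" for x y q S :: complex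
      using that by (simp add: divide_simps)
    ultimately show "C1 / D = conn_coeff \<nu> \<mu>"
      by (simp add: conn_coeff_def)
  qed
qed

lemma sin_pi_plus1: "sin (of_real pi * (\<mu> + 1)) = - sin (of_real pi * \<mu> :: complex)"
  by (simp add: ring_distribs sin_add flip: sin_of_real cos_of_real)

text \<open>Differentiating the combination at \<mu> gives one at \<mu> + 1, where the singular
  coefficient is known by induction. Comparison yields A = -(\<nu> + \<mu> + 1)
  \<open>conn_coeff \<nu> (\<mu> + 1)\<close>; the sign is absorbed by sin(pi (\<mu> + 1)) = -sin(pi
  \<mu>).\<close>

lemma sol_infinity_conn_aux:
  assumes "\<mu> \<notin> \<int>" "Re (\<mu> + of_nat n) > 0"
  shows "\<exists>B. \<forall>z\<in>ball 2 1. sol_infinity \<nu> \<mu> z = conn_coeff \<nu> \<mu> * sol_singular \<nu> \<mu> z + B * sol_regular \<nu> \<mu> z"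
  using assms
proof (induction n arbitrary: \<mu>)
  case 0
  then show ?case
    using sol_infinity_combination[of \<mu> \<nu>] by auto
next
  case (Suc n)
  obtain A B where AB: "sol_infinity \<nu> \<mu> z = A * sol_singular \<nu> \<mu> z + B * sol_regular \<nu> \<mu> z"
    if "z \<in> ball 2 1" for z
    using sol_infinity_combination[OF Suc.prems(1), of \<nu>] by blast
  have \<mu>1: "\<mu> + 1 \<notin> \<int>"
    using Suc.prems(1) Ints_diff[of "\<mu> + 1" 1] by auto
  have "Re (\<mu> + 1 + of_nat n) > 0"
    using Suc.prems(2) by simp
  from Suc.IH[OF \<mu>1 this] obtain B' where B': "sol_infinity \<nu> (\<mu> + 1) z =
      conn_coeff \<nu> (\<mu> + 1) * sol_singular \<nu> (\<mu> + 1) z + B' * sol_regular \<nu> (\<mu> + 1) z"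
    if "z \<in> ball 2 1" for z
    by blast
  define k where "k = - ((\<mu> + \<nu> + 1) * (\<mu> - \<nu>))"
  define p where "p = \<nu> + \<mu> + 1"
  have "(A + p * conn_coeff \<nu> (\<mu> + 1)) * sol_singular \<nu> (\<mu> + 1) z +
      (B * k + p * B') * sol_regular \<nu> (\<mu> + 1) z = 0" if z: "z \<in> ball 2 1" for z
  proof -
    have "((\<lambda>z. A * sol_singular \<nu> \<mu> z + B * sol_regular \<nu> \<mu> z) has_field_derivative
        A * sol_singular \<nu> (\<mu> + 1) z + B * (k * sol_regular \<nu> (\<mu> + 1) z)) (at z)"
      unfolding k_def
      by (intro DERIV_add DERIV_cmult has_field_derivative_sol_singular has_field_derivative_sol_regular z)
    moreover have "((\<lambda>z. A * sol_singular \<nu> \<mu> z + B * sol_regular \<nu> \<mu> z) has_field_derivative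
        - p * sol_infinity \<nu> (\<mu> + 1) z) (at z)"
      using has_field_derivative_sol_infinity[OF z, of \<nu> \<mu>] unfolding p_def
      by (rule has_field_derivative_transform_within_open[where S = "ball 2 1"]) (use AB z in auto)
    ultimately have "A * sol_singular \<nu> (\<mu> + 1) z + B * (k * sol_regular \<nu> (\<mu> + 1) z) =
        - p * sol_infinity \<nu> (\<mu> + 1) z"
      by (rule DERIV_unique)
    then have "A * sol_singular \<nu> (\<mu> + 1) z + B * (k * sol_regular \<nu> (\<mu> + 1) z) +
        p * sol_infinity \<nu> (\<mu> + 1) z = 0"
      by simp
    then show ?thesis
      unfolding B'[OF z] by (simp only: ring_distribs mult_ac add_ac)
  qed
  from sol_independent(1)[OF \<mu>1 this] have "A = - p * conn_coeff \<nu> (\<mu> + 1)"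
    by (simp add: add_eq_0_iff2)
  also have "\<dots> = conn_coeff \<nu> \<mu>"
  proof -
    have "p * rGamma (\<nu> + (\<mu> + 1) + 1) = rGamma (\<nu> + \<mu> + 1)"
      using rGamma_plus1[of p] by (simp add: p_def add_ac)
    moreover have "- p * conn_coeff \<nu> (\<mu> + 1) =
        2 powr \<nu> * of_real (sqrt pi) * (p * rGamma (\<nu> + (\<mu> + 1) + 1)) / sin (of_real pi * \<mu>)"
      unfolding conn_coeff_def sin_pi_plus1 by simp
    ultimately show ?thesis
      by (simp add: conn_coeff_def)
  qed
  finally show ?case
    using AB by blast
qed

section \<open>The symmetry between \<mu> and -\<mu>\<close>

lemma islimpt_of_real_greaterThanLessThan:
  assumes "a < c" "c < b"
  shows "complex_of_real c islimpt of_real ` {a<..<b}"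
  unfolding islimpt_approachable
proof (intro allI impI)
  fix e :: real
  assume e: "e > 0"
  define x where "x = min (c + e / 2) ((c + b) / 2)"
  have x: "c < x" "x < b" "x - c < e"
    using assms e by (auto simp: x_def min_def field_simps)
  then have "dist (complex_of_real x) (of_real c) < e"
    using norm_of_real[of "x - c", where ?'a = complex] by (simp add: dist_norm)
  moreover have "complex_of_real x \<in> of_real ` {a<..<b}"
    using x assms by auto
  ultimately show "\<exists>x'\<in>of_real ` {a<..<b}. x' \<noteq> complex_of_real c \<and> dist x' (of_real c) < e"
    using x by force
qed

lemma eq_on_of_real_imp_eq:
  assumes "f holomorphic_on S" "g holomorphic_on S" "open S" "connected S"
    and "a < b" "of_real ` {a<..<b} \<subseteq> S"
    and eq: "\<And>x. a < x \<Longrightarrow> x < b \<Longrightarrow> f (of_real x) = g (of_real x)"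
    and z: "z \<in> S"
  shows "f z = g z"
proof -
  define c where "c = (a + b) / 2"
  have c: "a < c" "c < b"
    using assms(5) by (auto simp: c_def)
  have lim: "complex_of_real c islimpt of_real ` {a<..<b}"
    by (rule islimpt_of_real_greaterThanLessThan[OF c])
  have "f z - g z = 0"
  proof (rule analytic_continuation[where f = "\<lambda>z. f z - g z" and S = S and U = "of_real ` {a<..<b}" and \<xi> = "of_real c"])
    show "(\<lambda>z. f z - g z) holomorphic_on S"
      by (intro holomorphic_intros assms)
  qed (use assms c lim in auto)
  then show ?thesis
    by simp
qed

text \<open>Euler's transformation of the series in 1/z^2 exchanges \<mu> and -\<mu> and produces (1
  - 1/z^2)^(-\<mu>). This power splits at once for real z > 1, so the identity is checked on (1, 3)
  and continued to the disc.\<close>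

lemma sol_infinity_even:
  assumes z: "z \<in> ball 2 1"
  shows "sol_infinity \<nu> \<mu> z = (z - 1) powr (- \<mu>) * (z + 1) powr (- \<mu>) * sol_infinity \<nu> (- \<mu>) z"
proof (rule eq_on_of_real_imp_eq[OF _ _ _ _ _ _ _ z])
  have hol: "sol_infinity \<nu> m holomorphic_on ball 2 1" for m
    using has_field_derivative_sol_infinity
    by (meson field_differentiable_at_within field_differentiable_def holomorphic_onI)
  then show "sol_infinity \<nu> \<mu> holomorphic_on ball 2 1" .
  show "(\<lambda>z. (z - 1) powr (- \<mu>) * (z + 1) powr (- \<mu>) * sol_infinity \<nu> (- \<mu>) z) holomorphic_on ball 2 1"
    using in_ball_2_1 by (intro holomorphic_intros hol) auto
  show "of_real ` {1<..<3} \<subseteq> ball (2::complex) 1"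
    using of_real_in_ball_2_1 by blast
  fix x :: real
  assume x: "1 < x" "x < 3"
  define w where "w = 1 / (complex_of_real x)\<^sup>2"
  have w: "norm w < 1"
    using in_ball_2_1(2)[OF of_real_in_ball_2_1, of x] x by (simp add: w_def)
  define X where "X = complex_of_real x"
  have e: "\<nu> + 3 / 2 - (\<nu> + \<mu> + 2) / 2 = (\<nu> + - \<mu> + 1) / 2" "\<nu> + 3 / 2 - (\<nu> + \<mu> + 1) / 2 = (\<nu> + - \<mu> + 2) / 2"
    "(\<nu> + - \<mu> + 1) / 2 - (\<nu> + \<mu> + 1) / 2 = - \<mu>"
    by (simp_all add: field_simps)
  have "(1 - w) * X\<^sup>2 = (X - 1) * (X + 1)"
    using x by (simp add: w_def X_def field_simps power2_eq_square)
  moreover have "((1 - w) * X\<^sup>2) powr (- \<mu>) = (1 - w) powr (- \<mu>) * (X\<^sup>2) powr (- \<mu>)"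
  proof -
    have "1 - w = of_real (1 - 1 / x\<^sup>2)" "X\<^sup>2 = of_real (x\<^sup>2)" "1 / x\<^sup>2 \<le> 1"
      using x by (simp_all add: w_def X_def one_le_power)
    then show ?thesis
      by (simp only:) (intro powr_times_real Reals_of_real; simp only: Re_complex_of_real; simp)
  qed
  moreover have "((X - 1) * (X + 1)) powr (- \<mu>) = (X - 1) powr (- \<mu>) * (X + 1) powr (- \<mu>)"
    using x by (subst powr_times_real) (auto simp: X_def)
  moreover have "(X\<^sup>2) powr (- \<mu>) = X powr (- \<mu>) * X powr (- \<mu>)"
    unfolding power2_eq_square using x by (subst powr_times_real) (auto simp: X_def)
  ultimately have pw: "(1 - w) powr (- \<mu>) * (X powr (- \<mu>) * X powr (- \<mu>)) = (X - 1) powr (- \<mu>) * (X + 1) powr (- \<mu>)"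
    by metis
  have "sol_infinity \<nu> \<mu> X = X powr (- \<nu> - \<mu> - 1) * ((1 - w) powr (- \<mu>) *
      Freg ((\<nu> + - \<mu> + 2) / 2) ((\<nu> + - \<mu> + 1) / 2) (\<nu> + 3 / 2) w)"
    unfolding sol_infinity_def w_def[folded X_def, symmetric]
    by (subst Freg_euler[OF w], unfold e) (simp only: Freg_commute[of "(\<nu> + - \<mu> + 1) / 2"])
  also have "\<dots> = (X powr (- \<mu>) * X powr (- \<mu>) * (1 - w) powr (- \<mu>)) * sol_infinity \<nu> (- \<mu>) X"
  proof -
    have "X powr (- \<nu> - \<mu> - 1) = X powr (- \<mu>) * X powr (- \<mu>) * X powr (- \<nu> - (- \<mu>) - 1)"
      unfolding powr_add[symmetric] by (rule arg_cong[where f = "(powr) X"]) simp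
    then show ?thesis
      unfolding sol_infinity_def w_def[folded X_def, symmetric] by (simp only: mult_ac)
  qed
  also have "X powr (- \<mu>) * X powr (- \<mu>) * (1 - w) powr (- \<mu>) = (X - 1) powr (- \<mu>) * (X + 1) powr (- \<mu>)"
    using pw by (simp only: mult_ac)
  finally show "sol_infinity \<nu> \<mu> (of_real x) = (of_real x - 1) powr (- \<mu>) * (of_real x + 1) powr (- \<mu>) *
      sol_infinity \<nu> (- \<mu>) (of_real x)"
    by (simp only: X_def)
qed auto

lemma half_powr: "((z + 1) / 2) powr m = (z + 1) powr m * 2 powr (- m)" for z m :: complex
proof -
  have "((z + 1) / 2) powr m = (of_real (1 / 2) * (z + 1)) powr m"
    by simp
  also have "\<dots> = of_real (1 / 2) powr m * (z + 1) powr m"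
    by (subst powr_times_real_left) auto
  also have "of_real (1 / 2) powr m = (2 :: complex) powr (- m)"
  proof -
    have "(of_real (1 / 2) :: complex) powr m * 2 powr m = 1"
      by (subst powr_times_real[symmetric]) auto
    then show ?thesis
      by (simp add: powr_minus field_simps)
  qed
  finally show ?thesis
    by simp
qed

text \<open>Euler's transformation reaches the upper parameters of \<open>sol_singular\<close>; up
  to powers of z - 1 and z + 1 the two solutions are interchanged by \<mu> -> -\<mu>.\<close>

lemma sol_regular_altdef:
  assumes z: "z \<in> ball 2 1"
  shows "sol_regular \<nu> \<mu> z = (z + 1) powr (- \<mu>) * Freg (- \<nu>) (\<nu> + 1) (1 + \<mu>) ((1 - z) / 2)"
proof -
  define t where "t = (1 - z) / 2"
  have t: "norm t < 1" "1 - t = (z + 1) / 2"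
    using in_ball_2_1[OF z] by (simp_all add: t_def field_simps)
  have e: "1 + \<mu> - - \<nu> = \<mu> + \<nu> + 1" "1 + \<mu> - (\<nu> + 1) = \<mu> - \<nu>" "\<mu> + \<nu> + 1 - (\<nu> + 1) = \<mu>"
    by simp_all
  have "(z + 1) powr \<mu> \<noteq> 0"
    using in_ball_2_1[OF z] by simp
  then show ?thesis
    using Freg_euler[OF t(1), of "- \<nu>" "\<nu> + 1" "1 + \<mu>", unfolded e t(2) half_powr]
    by (simp add: sol_regular_def powr_minus flip: t_def)
qed

lemma sol_infinity_connection:
  assumes \<mu>: "\<mu> \<notin> \<int>" and z: "z \<in> ball 2 1"
  shows "sol_infinity \<nu> \<mu> z = conn_coeff \<nu> \<mu> * sol_singular \<nu> \<mu> z + conn_coeff \<nu> (- \<mu>) * sol_regular \<nu> \<mu> z"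
proof -
  have \<mu>': "- \<mu> \<notin> \<int>"
    using \<mu> by simp
  obtain B where B: "sol_infinity \<nu> \<mu> z = conn_coeff \<nu> \<mu> * sol_singular \<nu> \<mu> z + B * sol_regular \<nu> \<mu> z"
    if "z \<in> ball 2 1" for z
    using sol_infinity_conn_aux[OF \<mu>] Re_add_nat_pos by metis
  obtain B' where B': "sol_infinity \<nu> (- \<mu>) z =
      conn_coeff \<nu> (- \<mu>) * sol_singular \<nu> (- \<mu>) z + B' * sol_regular \<nu> (- \<mu>) z"
    if "z \<in> ball 2 1" for z
    using sol_infinity_conn_aux[OF \<mu>'] Re_add_nat_pos by metis
  \<comment> \<open>The formula for -\<mu>, multiplied by (z^2 - 1)^(-\<mu>), is a second
    representation of \<open>sol_infinity \<nu> \<mu>\<close> in which the two Frobenius solutions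
    have changed places.\<close>
  have "(conn_coeff \<nu> \<mu> - B') * sol_singular \<nu> \<mu> z + (B - conn_coeff \<nu> (- \<mu>)) * sol_regular \<nu> \<mu> z = 0"
    if z: "z \<in> ball 2 1" for z
  proof -
    define P Q where "P = (z - 1) powr \<mu>" and "Q = (z + 1) powr \<mu>"
    have nz: "P \<noteq> 0" "Q \<noteq> 0"
      using in_ball_2_1[OF z] by (simp_all add: P_def Q_def)
    have "(z - 1) powr (- \<mu>) * (z + 1) powr (- \<mu>) * sol_singular \<nu> (- \<mu>) z = sol_regular \<nu> \<mu> z"
      unfolding sol_regular_altdef[OF z] sol_singular_def powr_minus using nz by (simp add: P_def Q_def)
    moreover have "(z - 1) powr (- \<mu>) * (z + 1) powr (- \<mu>) * sol_regular \<nu> (- \<mu>) z = sol_singular \<nu> \<mu> z"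
      unfolding sol_regular_altdef[OF z] sol_singular_def powr_minus using nz by (simp add: P_def Q_def)
    moreover have "sol_infinity \<nu> \<mu> z =
        conn_coeff \<nu> (- \<mu>) * ((z - 1) powr (- \<mu>) * (z + 1) powr (- \<mu>) * sol_singular \<nu> (- \<mu>) z) +
        B' * ((z - 1) powr (- \<mu>) * (z + 1) powr (- \<mu>) * sol_regular \<nu> (- \<mu>) z)"
      unfolding sol_infinity_even[OF z, of \<nu> \<mu>] B'[OF z] by (simp add: algebra_simps)
    ultimately show ?thesis
      using B[OF z] by (simp add: algebra_simps)
  qed
  from sol_independent(2)[OF \<mu> this] have "B = conn_coeff \<nu> (- \<mu>)"
    by simp
  then show ?thesis
    using B[OF z] by simp
qed

subsection \<open>The Ferrers function\<close>

lemma of_real_sq_cases: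
  fixes z :: complex
  assumes "z\<^sup>2 = of_real q" "0 \<le> q" "q \<le> 1"
  shows "1 - z \<in> \<real>\<^sub>\<ge>\<^sub>0"
proof -
  have "z\<^sup>2 = (of_real (sqrt q))\<^sup>2"
    using assms by (simp flip: of_real_power)
  then have "z = of_real (sqrt q) \<or> z = - of_real (sqrt q)"
    by (simp add: power2_eq_iff)
  moreover have "sqrt q \<le> 1" "- 1 \<le> sqrt q"
    using assms order_trans[of "- 1" 0 "sqrt q"] by auto
  ultimately show ?thesis
    by (auto simp: complex_nonneg_Reals_iff)
qed

text \<open>The hypothesis says that z lies off (-\<infinity>, 1]. If 1/z^2 were in [1,
  \<infinity>), then z would be real with |z| \<le> 1, hence on the cut.\<close>

lemma off_cut:
  fixes z :: complex
  assumes z: "z - 1 \<notin> \<real>\<^sub>\<le>\<^sub>0"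
  shows "z \<notin> \<real>\<^sub>\<le>\<^sub>0" "z + 1 \<notin> \<real>\<^sub>\<le>\<^sub>0" "1 / z\<^sup>2 \<in> hyp2F1_domain" "(1 - z) / 2 \<in> hyp2F1_domain"
proof -
  show z0: "z \<notin> \<real>\<^sub>\<le>\<^sub>0" and z1: "z + 1 \<notin> \<real>\<^sub>\<le>\<^sub>0"
    using z by (auto simp: complex_nonpos_Reals_iff)
  have "1 - (1 - z) / 2 = (z + 1) / 2"
    by (simp add: field_simps)
  then show "(1 - z) / 2 \<in> hyp2F1_domain"
    using z1 by (simp add: hyp2F1_domain_iff complex_nonpos_Reals_iff)
  show "1 / z\<^sup>2 \<in> hyp2F1_domain"
  proof (rule ccontr)
    assume "1 / z\<^sup>2 \<notin> hyp2F1_domain"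
    then obtain r :: real where r: "1 \<le> r" "1 / z\<^sup>2 = of_real r"
      by (auto simp: hyp2F1_domain_def)
    have "z\<^sup>2 = of_real (1 / r)"
      using arg_cong[OF r(2), of inverse] by (simp add: divide_inverse)
    then have "1 - z \<in> \<real>\<^sub>\<ge>\<^sub>0"
      using r by (intro of_real_sq_cases[of z "1 / r"]) auto
    with z show False
      by (auto simp: complex_nonpos_Reals_iff complex_nonneg_Reals_iff)
  qed
qed

lemma connection_off_cut:
  assumes \<mu>: "\<mu> \<notin> \<int>" and z: "z - 1 \<notin> \<real>\<^sub>\<le>\<^sub>0"
  shows "z powr (- \<nu> - \<mu> - 1) * hyp2F1_reg ((\<nu> + \<mu> + 2) / 2) ((\<nu> + \<mu> + 1) / 2) (\<nu> + 3 / 2) (1 / z\<^sup>2) =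
    conn_coeff \<nu> \<mu> * ((z - 1) powr (- \<mu>) * hyp2F1_reg (- \<nu>) (\<nu> + 1) (1 - \<mu>) ((1 - z) / 2)) +
    conn_coeff \<nu> (- \<mu>) * ((z + 1) powr (- \<mu>) * hyp2F1_reg (- \<nu>) (\<nu> + 1) (1 + \<mu>) ((1 - z) / 2))"
    (is "?L z = ?R z")
proof -
  \<comment> \<open>The plane cut along (-\<infinity>, 1], written as a reflection of the
    hypergeometric domain in order to inherit its connectedness.\<close>
  define S where "S = (\<lambda>w. 2 - w) ` hyp2F1_domain"
  have S: "z \<in> S \<longleftrightarrow> z - 1 \<notin> \<real>\<^sub>\<le>\<^sub>0" for z
  proof -
    have "z \<in> S \<longleftrightarrow> 2 - z \<in> hyp2F1_domain"
      by (auto simp: S_def intro!: image_eqI[of _ _ "2 - z"])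
    then show ?thesis
      by (simp add: hyp2F1_domain_iff)
  qed
  have conn: "connected S"
    unfolding S_def by (intro connected_continuous_image continuous_intros connected_hyp2F1_domain)
  have opn: "open S"
  proof -
    have "S = (\<lambda>z. z - 1) -` (- \<real>\<^sub>\<le>\<^sub>0)"
      by (auto simp: S)
    also have "open \<dots>"
      by (intro open_vimage continuous_intros) (auto simp: open_Compl)
    finally show ?thesis .
  qed
  have hL: "?L holomorphic_on S"
    using off_cut unfolding S[symmetric] by (intro holomorphic_intros) (auto simp: S)
  have hR: "?R holomorphic_on S"
    using off_cut unfolding S[symmetric] by (intro holomorphic_intros) (auto simp: S)
  have eq: "?L z = ?R z" if z: "z \<in> ball 2 1" for z
    using sol_infinity_connection[OF \<mu> z, of \<nu>] in_ball_2_1[OF z]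
    unfolding sol_regular_altdef[OF z] sol_infinity_def sol_singular_def
    by (simp only: hyp2F1_reg_eq_Freg)
  have sub: "ball 2 1 \<subseteq> S"
    using in_ball_2_1 S by blast
  show ?thesis
    by (rule analytic_continuation_open[where f = ?L and g = ?R, OF open_ball opn _ conn sub hL hR eq])
      (use z S in auto)
qed

lemma Gamma_reflections:
  fixes \<mu> :: complex
  assumes "\<mu> \<notin> \<int>"
  shows "Gamma \<mu> * Gamma (1 - \<mu>) = of_real pi / sin (of_real pi * \<mu>)"
    "Gamma (- \<mu>) * Gamma (1 + \<mu>) = - of_real pi / sin (of_real pi * \<mu>)"
  using Gamma_reflection_complex[of \<mu>] Gamma_reflection_complex[of "- \<mu>"] by simp_all

lemma one_plus_minus_not_nonpos_Ints:
  fixes \<mu> :: complex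
  assumes "\<mu> \<notin> \<int>"
  shows "1 - \<mu> \<notin> \<int>\<^sub>\<le>\<^sub>0" "1 + \<mu> \<notin> \<int>\<^sub>\<le>\<^sub>0"
proof -
  have "1 - \<mu> \<notin> \<int>" "1 + \<mu> \<notin> \<int>"
    using assms Ints_diff[of 1 "1 - \<mu>"] Ints_diff[of "1 + \<mu>" 1] by auto
  then show "1 - \<mu> \<notin> \<int>\<^sub>\<le>\<^sub>0" "1 + \<mu> \<notin> \<int>\<^sub>\<le>\<^sub>0"
    using nonpos_Ints_Int by blast+
qed

text \<open>The sign \<sigma> selects the half plane. Powers of z - 1 have a cut along (-1, 1),
  powers of 1 - z do not; the difference of the logarithms is \<sigma> i pi.\<close>

lemma powr_minus_one_side:
  assumes "\<sigma> = 1 \<or> \<sigma> = (-1 :: real)" "\<sigma> * Im z > 0"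
  shows "(z - 1) powr m = exp (of_real \<sigma> * \<i> * of_real pi * m) * (1 - z) powr m"
proof -
  have nz: "1 - z \<noteq> 0" "z - 1 \<noteq> 0"
    using assms by (auto simp: complex_eq_iff)
  have "Ln (- (1 - z)) = Ln (1 - z) + of_real \<sigma> * \<i> * of_real pi"
    using assms nz(1) by (subst Ln_minus) auto
  then have "Ln (z - 1) = Ln (1 - z) + of_real \<sigma> * \<i> * of_real pi"
    by simp
  then show ?thesis
    using nz by (simp add: powr_def algebra_simps flip: exp_add)
qed

lemma islimpt_half_plane:
  assumes "\<sigma> = 1 \<or> \<sigma> = (-1 :: real)" "Im x = 0"
  shows "x islimpt {z. \<sigma> * Im z > 0}"
  unfolding islimpt_approachable
proof (intro allI impI)
  fix e :: real
  assume "e > 0"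
  then have "x + of_real (\<sigma> * e / 2) * \<i> \<in> {z. \<sigma> * Im z > 0}" "x + of_real (\<sigma> * e / 2) * \<i> \<noteq> x"
    "dist (x + of_real (\<sigma> * e / 2) * \<i>) x < e"
    using assms by (auto simp: dist_norm norm_mult norm_divide)
  then show "\<exists>z\<in>{z. \<sigma> * Im z > 0}. z \<noteq> x \<and> dist z x < e"
    by blast
qed

lemma holomorphic_hyp2F1:
  assumes "c \<notin> \<int>\<^sub>\<le>\<^sub>0"
  shows "hyp2F1 a b c holomorphic_on hyp2F1_domain"
proof (rule holomorphic_transform)
  show "(\<lambda>w. Gamma c * hyp2F1_reg a b c w) holomorphic_on hyp2F1_domain"
    by (intro holomorphic_intros) auto
qed (simp add: hyp2F1_eq_reg assms)

lemma isCont_hyp2F1: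
  assumes "c \<notin> \<int>\<^sub>\<le>\<^sub>0" "w \<in> hyp2F1_domain"
  shows "isCont (hyp2F1 a b c) w"
  using holomorphic_on_imp_continuous_on[OF holomorphic_hyp2F1[OF assms(1)]] assms(2) open_hyp2F1_domain
    continuous_on_eq_continuous_at by blast

section \<open>Boundary values on (-1, 1)\<close>

text \<open>\<open>series_A\<close> and \<open>series_B\<close> are the hypergeometric terms of the
  claim before Pfaff's transformation, without the cosine.\<close>

definition series_A :: "complex \<Rightarrow> complex \<Rightarrow> complex \<Rightarrow> complex" where
  "series_A \<nu> \<mu> t = Gamma \<mu> * hyp2F1 (- \<nu>) (\<nu> + 1) (1 - \<mu>) t"

definition series_B :: "complex \<Rightarrow> complex \<Rightarrow> complex \<Rightarrow> complex" where
  "series_B \<nu> \<mu> t = Gamma (\<nu> + \<mu> + 1) * Gamma (- \<mu>) * rGamma (\<nu> - \<mu> + 1) * hyp2F1 (- \<nu>) (\<nu> + 1) (1 + \<mu>) t"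

text \<open>Written with 1 - z instead of z - 1, and therefore continuous across (-1, 1); likewise
  \<open>branch_B\<close>.\<close>

definition branch_A :: "complex \<Rightarrow> complex \<Rightarrow> complex \<Rightarrow> complex" where
  "branch_A \<nu> \<mu> z = (z + 1) powr (\<mu> / 2) * (1 - z) powr (- (\<mu> / 2)) * series_A \<nu> \<mu> ((1 - z) / 2)"

definition branch_B :: "complex \<Rightarrow> complex \<Rightarrow> complex \<Rightarrow> complex" where
  "branch_B \<nu> \<mu> z = (z + 1) powr (- (\<mu> / 2)) * (1 - z) powr (\<mu> / 2) * series_B \<nu> \<mu> ((1 - z) / 2)"

context
  fixes \<nu> \<mu> :: complex
  assumes \<mu>: "\<mu> \<notin> \<int>"
    and \<nu>\<mu>: "\<nu> + \<mu> + 1 \<notin> \<int>\<^sub>\<le>\<^sub>0"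
begin

text \<open>The reflection formula turns pi/sin(pi \<mu>) and the regularizing factors into the
  Gamma(\<mu>) and Gamma(-\<mu>) of the claim.\<close>

lemma legendre_Q_connection:
  assumes z: "z - 1 \<notin> \<real>\<^sub>\<le>\<^sub>0"
  shows "legendre_Q \<nu> \<mu> z = exp (\<i> * of_real pi * \<mu>) / 2 *
    ((z + 1) powr (\<mu> / 2) * (z - 1) powr (- (\<mu> / 2)) * series_A \<nu> \<mu> ((1 - z) / 2) +
     (z + 1) powr (- (\<mu> / 2)) * (z - 1) powr (\<mu> / 2) * series_B \<nu> \<mu> ((1 - z) / 2))"
proof -
  define P Q where "P = (z - 1) powr (\<mu> / 2)" and "Q = (z + 1) powr (\<mu> / 2)"
  have nz: "P \<noteq> 0" "Q \<noteq> 0"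
    using z off_cut[OF z] by (auto simp: P_def Q_def)
  have pw: "(z - 1) powr (- \<mu>) = 1 / (P * P)" "(z + 1) powr (- \<mu>) = 1 / (Q * Q)"
    "(z - 1) powr (- (\<mu> / 2)) = 1 / P" "(z + 1) powr (- (\<mu> / 2)) = 1 / Q"
  proof -
    have "(z - 1) powr \<mu> = P * P" "(z + 1) powr \<mu> = Q * Q"
      unfolding P_def Q_def powr_add[symmetric] by simp_all
    then show "(z - 1) powr (- \<mu>) = 1 / (P * P)" "(z + 1) powr (- \<mu>) = 1 / (Q * Q)"
      by (simp_all only: powr_minus divide_inverse mult_1)
    show "(z - 1) powr (- (\<mu> / 2)) = 1 / P" "(z + 1) powr (- (\<mu> / 2)) = 1 / Q"
      by (simp_all only: P_def Q_def powr_minus divide_inverse mult_1)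
  qed
  define S q G1 where "S = sin (of_real pi * \<mu>)" and "q = complex_of_real (sqrt pi)" and "G1 = Gamma (\<nu> + \<mu> + 1)"
  have S0: "S \<noteq> 0"
    using sin_pi_neq_0[OF \<mu>] by (simp add: S_def)
  have qq: "complex_of_real pi = q * q"
    by (simp add: q_def flip: of_real_mult)
  \<comment> \<open>Here the exclusion of \<nu> + \<mu> from the negative integers enters; it
    removes Gamma(\<nu> + \<mu> + 1) from the first term.\<close>
  have G1: "G1 * rGamma (\<nu> + \<mu> + 1) = 1"
    using \<nu>\<mu> by (simp add: G1_def rGamma_inverse_Gamma Gamma_eq_zero_iff)
  define H1 H2 where "H1 = hyp2F1_reg (- \<nu>) (\<nu> + 1) (1 - \<mu>) ((1 - z) / 2)"
    and "H2 = hyp2F1_reg (- \<nu>) (\<nu> + 1) (1 + \<mu>) ((1 - z) / 2)"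
  have A: "series_A \<nu> \<mu> ((1 - z) / 2) = q * q / S * H1"
    using off_cut(4)[OF z] one_plus_minus_not_nonpos_Ints[OF \<mu>] Gamma_reflections(1)[OF \<mu>]
    by (simp add: series_A_def hyp2F1_eq_reg H1_def S_def flip: qq mult.assoc)
  have B: "series_B \<nu> \<mu> ((1 - z) / 2) = G1 * rGamma (\<nu> - \<mu> + 1) * (- (q * q) / S) * H2"
  proof -
    have "series_B \<nu> \<mu> ((1 - z) / 2) = G1 * rGamma (\<nu> - \<mu> + 1) * (Gamma (- \<mu>) * Gamma (1 + \<mu>)) * H2"
      using off_cut(4)[OF z] one_plus_minus_not_nonpos_Ints[OF \<mu>]
      by (simp add: series_B_def hyp2F1_eq_reg H2_def G1_def)
    then show ?thesis
      unfolding Gamma_reflections(2)[OF \<mu>] by (simp only: qq S_def)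
  qed
  have "legendre_Q \<nu> \<mu> z = exp (\<i> * of_real pi * \<mu>) * (q * G1 * (Q * P) / 2 powr (\<nu> + 1)) *
      (z powr (- \<nu> - \<mu> - 1) * hyp2F1_reg ((\<nu> + \<mu> + 2) / 2) ((\<nu> + \<mu> + 1) / 2) (\<nu> + 3 / 2) (1 / z\<^sup>2))"
  proof -
    have "- \<nu> - \<mu> - 1 = - (\<nu> + \<mu> + 1)"
      by simp
    then have "z powr (- \<nu> - \<mu> - 1) = 1 / z powr (\<nu> + \<mu> + 1)"
      by (simp only: powr_minus divide_inverse mult_1)
    then show ?thesis
      by (simp add: legendre_Q_def q_def G1_def P_def Q_def)
  qed
  also have "\<dots> = exp (\<i> * of_real pi * \<mu>) / 2 * (Q * (1 / P) * (q * q / S * H1) +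
      1 / Q * P * (G1 * rGamma (\<nu> - \<mu> + 1) * (- (q * q) / S) * H2))"
  proof -
    have c: "conn_coeff \<nu> \<mu> = 2 powr \<nu> * q * rGamma (\<nu> + \<mu> + 1) / S"
      "conn_coeff \<nu> (- \<mu>) = - (2 powr \<nu> * q * rGamma (\<nu> - \<mu> + 1) / S)"
      by (simp_all add: conn_coeff_def q_def S_def)
    have "E * (q * G1 * (Q * P) / (T * 2)) * (T * q * r / S * (1 / (P * P) * H1) + - (T * q * r' / S) * (1 / (Q * Q) * H2)) =
        E / 2 * (Q * (1 / P) * (q * q / S * (G1 * r) * H1) + 1 / Q * P * (G1 * r' * (- (q * q) / S) * H2))"
      if "T \<noteq> 0" for E T r r' :: complex
      using that nz S0 by (simp add: field_simps)
    from this[of "2 powr \<nu>" _ "rGamma (\<nu> + \<mu> + 1)" "rGamma (\<nu> - \<mu> + 1)"] show ?thesis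
      unfolding connection_off_cut[OF \<mu> z] c pw H1_def[symmetric] H2_def[symmetric] powr_add G1 by simp
  qed
  finally show ?thesis
    unfolding A B pw P_def[symmetric] Q_def[symmetric] .
qed


text \<open>On the chosen half plane the function equals a fixed combination of
  \<open>branch_A\<close> and \<open>branch_B\<close>, which is continuous at x; the phases come
  from \<open>powr_minus_one_side\<close>.\<close>

lemma Lim_legendre_Q:
  assumes \<sigma>: "\<sigma> = 1 \<or> \<sigma> = (-1 :: real)" and x: "-1 < x" "x < 1"
  shows "Lim (at (of_real x) within {z. \<sigma> * Im z > 0}) (legendre_Q \<nu> \<mu>) =
    exp (\<i> * of_real pi * \<mu>) / 2 *
      (exp (- (of_real \<sigma> * \<i> * of_real pi * \<mu> / 2)) * branch_A \<nu> \<mu> (of_real x) +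
       exp (of_real \<sigma> * \<i> * of_real pi * \<mu> / 2) * branch_B \<nu> \<mu> (of_real x))"
proof (rule tendsto_Lim)
  show "\<not> trivial_limit (at (complex_of_real x) within {z. \<sigma> * Im z > 0})"
    using islimpt_half_plane[OF \<sigma>] by (simp add: trivial_limit_within)
  have t: "(1 - complex_of_real x) / 2 \<in> hyp2F1_domain"
  proof -
    have "1 - (1 - complex_of_real x) / 2 = of_real ((1 + x) / 2)"
      by (simp add: field_simps)
    then show ?thesis
      using x by (simp add: hyp2F1_domain_iff complex_nonpos_Reals_iff)
  qed
  have c: "isCont (\<lambda>z. hyp2F1 a b c ((1 - z) / 2)) (of_real x)" if "c \<notin> \<int>\<^sub>\<le>\<^sub>0" for a b c
    by (intro isCont_o2[where f = "\<lambda>z. (1 - z) / 2" and g = "hyp2F1 a b c", OF _ isCont_hyp2F1[OF that t]] continuous_intros) auto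
  have A: "isCont (\<lambda>z. series_A \<nu> \<mu> ((1 - z) / 2)) (of_real x)"
    unfolding series_A_def by (intro continuous_intros c one_plus_minus_not_nonpos_Ints \<mu>)
  have B: "isCont (\<lambda>z. series_B \<nu> \<mu> ((1 - z) / 2)) (of_real x)"
    unfolding series_B_def by (intro continuous_intros c one_plus_minus_not_nonpos_Ints \<mu>)
  have slit: "complex_of_real x + 1 \<notin> \<real>\<^sub>\<le>\<^sub>0" "1 - complex_of_real x \<notin> \<real>\<^sub>\<le>\<^sub>0"
    using x by (auto simp: complex_nonpos_Reals_iff)
  have pw: "isCont (\<lambda>w. w powr m) w" if "w \<notin> \<real>\<^sub>\<le>\<^sub>0" for w m :: complex
    by (rule DERIV_isCont[OF has_field_derivative_powr[OF that]])
  have p: "isCont (\<lambda>z. (z + 1) powr m) (of_real x)" "isCont (\<lambda>z. (1 - z) powr m) (of_real x)" for m :: complex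
    by (rule isCont_o2[where f = "\<lambda>z::complex. z + 1" and g = "\<lambda>w::complex. w powr m", OF _ pw[OF slit(1)]]
          isCont_o2[where f = "\<lambda>z::complex. 1 - z" and g = "\<lambda>w::complex. w powr m", OF _ pw[OF slit(2)]],
        intro continuous_intros)+
  have UV: "isCont (branch_A \<nu> \<mu>) (of_real x)" "isCont (branch_B \<nu> \<mu>) (of_real x)"
    unfolding branch_A_def[abs_def] branch_B_def[abs_def] by (intro continuous_intros A B p)+
  define F where "F z = exp (\<i> * of_real pi * \<mu>) / 2 * (exp (- (of_real \<sigma> * \<i> * of_real pi * \<mu> / 2)) * branch_A \<nu> \<mu> z +
       exp (of_real \<sigma> * \<i> * of_real pi * \<mu> / 2) * branch_B \<nu> \<mu> z)" for z
  have "isCont F (of_real x)"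
    unfolding F_def by (intro continuous_intros UV)
  then have "(F \<longlongrightarrow> F (of_real x)) (at (of_real x) within {z. \<sigma> * Im z > 0})"
    using continuous_at_imp_continuous_at_within continuous_within by blast
  moreover have "F z = legendre_Q \<nu> \<mu> z" if "\<sigma> * Im z > 0" for z
  proof -
    have "Im z \<noteq> 0"
      using that by auto
    then have z1: "z - 1 \<notin> \<real>\<^sub>\<le>\<^sub>0"
      by (auto simp: complex_nonpos_Reals_iff)
    have e: "of_real \<sigma> * \<i> * of_real pi * - (\<mu> / 2) = - (of_real \<sigma> * \<i> * of_real pi * \<mu> / 2)"
      "of_real \<sigma> * \<i> * of_real pi * (\<mu> / 2) = of_real \<sigma> * \<i> * of_real pi * \<mu> / 2"
      by simp_all
    show ?thesis
      unfolding legendre_Q_connection[OF z1] F_def branch_A_def branch_B_def powr_minus_one_side[OF \<sigma> that] e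
      by (simp only: mult_ac)
  qed
  then have "eventually (\<lambda>z. F z = legendre_Q \<nu> \<mu> z) (at (of_real x) within {z. \<sigma> * Im z > 0})"
    by (auto simp: eventually_at_filter)
  ultimately show "(legendre_Q \<nu> \<mu> \<longlongrightarrow> exp (\<i> * of_real pi * \<mu>) / 2 *
      (exp (- (of_real \<sigma> * \<i> * of_real pi * \<mu> / 2)) * branch_A \<nu> \<mu> (of_real x) +
       exp (of_real \<sigma> * \<i> * of_real pi * \<mu> / 2) * branch_B \<nu> \<mu> (of_real x)))
      (at (of_real x) within {z. \<sigma> * Im z > 0})"
    unfolding F_def[symmetric] by (rule Lim_transform_eventually)
qed

text \<open>With E = e^(i pi \<mu>/2), the two sides contribute E^(-2) and E^2 to the first branch,
  whose mean is the cosine, and 1 each to the second.\<close>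

lemma ferrers_Q_cut_eq:
  assumes x: "-1 < x" "x < 1"
  shows "ferrers_Q_cut \<nu> \<mu> (of_real x) = (cos (of_real pi * \<mu>) * branch_A \<nu> \<mu> (of_real x) + branch_B \<nu> \<mu> (of_real x)) / 2"
proof -
  define E where "E = exp (\<i> * of_real pi * \<mu> / 2)"
  have E0: "E \<noteq> 0"
    by (simp add: E_def)
  have EE: "exp (\<i> * of_real pi * \<mu>) = E * E"
    unfolding E_def exp_add[symmetric] by (simp add: mult_ac)
  have e: "exp (- (\<i> * of_real pi * \<mu> / 2)) = 1 / E" "exp (- (\<i> * of_real pi * \<mu>)) = 1 / (E * E)"
    unfolding exp_minus EE E_def by (simp_all only: divide_inverse mult_1)
  have c: "cos (of_real pi * \<mu>) = (exp (\<i> * of_real pi * \<mu>) + exp (- (\<i> * of_real pi * \<mu>))) / 2"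
    by (simp add: cos_exp_eq mult.assoc)
  have \<sigma>: "of_real 1 * \<i> * of_real pi * \<mu> / 2 = \<i> * of_real pi * \<mu> / 2"
    "of_real (- 1) * \<i> * of_real pi * \<mu> / 2 = - (\<i> * of_real pi * \<mu> / 2)"
    by simp_all
  have s1: "{z. Im z > 0} = {z. 1 * Im z > 0}" and s2: "{z. Im z < 0} = {z. - 1 * Im z > 0}"
    by auto
  have up: "Lim (at (of_real x) within {z. Im z > 0}) (legendre_Q \<nu> \<mu>) =
      E * E / 2 * (1 / E * branch_A \<nu> \<mu> (of_real x) + E * branch_B \<nu> \<mu> (of_real x))"
    unfolding s1 Lim_legendre_Q[OF disjI1[OF refl] x] \<sigma> EE e E_def[symmetric] ..
  have down: "Lim (at (of_real x) within {z. Im z < 0}) (legendre_Q \<nu> \<mu>) =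
      E * E / 2 * (E * branch_A \<nu> \<mu> (of_real x) + 1 / E * branch_B \<nu> \<mu> (of_real x))"
    unfolding s2 Lim_legendre_Q[OF disjI2[OF refl] x] \<sigma> minus_minus EE e E_def[symmetric] ..
  have "1 / 2 * (1 / E * (1 / (E * E)) * (E * E / 2 * (1 / E * A + E * B)) +
      E * (1 / (E * E)) * (E * E / 2 * (E * A + 1 / E * B))) = ((E * E + 1 / (E * E)) / 2 * A + B) / 2" for A B
    using E0 by (simp add: field_simps)
  then show ?thesis
    unfolding ferrers_Q_cut_def up down c EE e E_def[symmetric] .
qed

end

section \<open>Extension to D1\<close>

lemma D1_iff: "x \<in> D1 \<longleftrightarrow> 1 + x \<notin> \<real>\<^sub>\<le>\<^sub>0 \<and> 1 - x \<notin> \<real>\<^sub>\<le>\<^sub>0"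
proof -
  have "x \<in> of_real ` ({..-1} \<union> {1..}) \<longleftrightarrow> Im x = 0 \<and> (Re x \<le> -1 \<or> 1 \<le> Re x)"
    by (auto simp: image_iff complex_eq_iff)
  then show ?thesis
    by (auto simp: D1_def complex_nonpos_Reals_iff)
qed

lemma open_D1: "open D1"
proof -
  have "D1 = (\<lambda>x. 1 + x) -` (- \<real>\<^sub>\<le>\<^sub>0) \<inter> (\<lambda>x. 1 - x) -` (- \<real>\<^sub>\<le>\<^sub>0)"
    by (auto simp: D1_iff)
  also have "open \<dots>"
    by (intro open_Int open_vimage continuous_intros) (auto simp: open_Compl)
  finally show ?thesis .
qed

lemma connected_D1: "connected D1"
  unfolding D1_def by (rule connected_slit_plane) (auto simp: field_simps)

lemma D1_quotients:
  assumes "x \<in> D1"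
  shows "(1 + x) / (1 - x) \<notin> \<real>\<^sub>\<le>\<^sub>0" "(1 - x) / (1 + x) \<notin> \<real>\<^sub>\<le>\<^sub>0" "(x - 1) / (x + 1) \<in> hyp2F1_domain"
proof -
  have x: "1 + x \<notin> \<real>\<^sub>\<le>\<^sub>0" "1 - x \<notin> \<real>\<^sub>\<le>\<^sub>0"
    using assms by (auto simp: D1_iff)
  then have nz: "1 + x \<noteq> 0" "1 - x \<noteq> 0"
    by auto
  show 1: "(1 + x) / (1 - x) \<notin> \<real>\<^sub>\<le>\<^sub>0"
  proof
    assume "(1 + x) / (1 - x) \<in> \<real>\<^sub>\<le>\<^sub>0"
    then obtain q where q: "q \<le> 0" "(1 + x) / (1 - x) = of_real q"
      by (auto elim!: nonpos_Reals_cases)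
    then have eq: "1 + x = of_real q * (1 - x)"
      using nz by (simp add: field_simps)
    \<comment> \<open>The equation is linear in x with real coefficients, so x is real; then 1 + x
      and 1 - x are both positive, against q \<le> 0.\<close>
    then have "x * of_real (1 + q) = of_real (q - 1)"
      by (simp add: algebra_simps)
    moreover have "1 + q \<noteq> 0"
    proof
      assume "1 + q = 0"
      then have "q = - 1"
        by simp
      with eq show False
        by simp
    qed
    ultimately have "x = of_real (q - 1) / of_real (1 + q)"
      by (intro eq_divide_imp) (simp_all only: of_real_eq_0_iff not_False_eq_True)
    then have "x = of_real ((q - 1) / (1 + q))"
      by simp
    then obtain r where r: "x = of_real r"
      by blast
    then have "-1 < r" "r < 1"
      using x by (auto simp: complex_nonpos_Reals_iff)
    moreover have "1 + r = q * (1 - r)"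
      using eq unfolding r by (metis of_real_1 of_real_add of_real_diff of_real_eq_iff of_real_mult)
    ultimately show False
      using q(1) mult_nonpos_nonneg[of q "1 - r"] by simp
  qed
  have "(1 - x) / (1 + x) = inverse ((1 + x) / (1 - x))"
    by simp
  with 1 show "(1 - x) / (1 + x) \<notin> \<real>\<^sub>\<le>\<^sub>0"
    by (metis nonpos_Reals_inverse_iff)
  have "1 - (x - 1) / (x + 1) = inverse ((1 + x) / 2)"
    using nz by (simp add: divide_simps add.commute)
  moreover have "(1 + x) / 2 \<notin> \<real>\<^sub>\<le>\<^sub>0"
    using x by (simp add: complex_nonpos_Reals_iff)
  ultimately show "(x - 1) / (x + 1) \<in> hyp2F1_domain"
    by (metis hyp2F1_domain_iff nonpos_Reals_inverse_iff)
qed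

lemma of_real_powr_quotient:
  assumes "-1 < x" "x < 1"
  shows "((1 + complex_of_real x) / (1 - of_real x)) powr m = (of_real x + 1) powr m * (1 - of_real x) powr (- m)"
    "((1 - complex_of_real x) / (1 + of_real x)) powr m = (of_real x + 1) powr (- m) * (1 - of_real x) powr m"
proof -
  have q: "(complex_of_real a / of_real b) powr m = of_real a powr m * of_real b powr (- m)"
    if "a > 0" "b > 0" for a b
  proof -
    have "(of_real (a / b) * of_real b) powr m = (of_real (a / b) powr m * of_real b powr m :: complex)"
      using that by (intro powr_times_real Reals_of_real; simp only: Re_complex_of_real; simp)
    then have "complex_of_real a powr m = of_real (a / b) powr m * of_real b powr m"
      using that by simp
    then show ?thesis
      using that by (simp add: powr_minus)
  qed
  show "((1 + complex_of_real x) / (1 - of_real x)) powr m = (of_real x + 1) powr m * (1 - of_real x) powr (- m)"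
    using q[of "1 + x" "1 - x"] assms by (simp add: add.commute)
  show "((1 - complex_of_real x) / (1 + of_real x)) powr m = (of_real x + 1) powr (- m) * (1 - of_real x) powr m"
    using q[of "1 - x" "1 + x"] assms by (simp add: add.commute mult.commute)
qed

text \<open>Pfaff's transformation at w = (1 - x)/2, where 1 - w = (1 + x)/2 and w/(w - 1) = (x -
  1)/(x + 1).\<close>

lemma hyp2F1_half_pfaff:
  assumes c: "c \<notin> \<int>\<^sub>\<le>\<^sub>0" and x: "x \<in> D1"
  shows "hyp2F1 (- \<nu>) (\<nu> + 1) c ((1 - x) / 2) =
    (1 + x) powr \<nu> * 2 powr (- \<nu>) * hyp2F1 (- \<nu>) (c - \<nu> - 1) c ((x - 1) / (x + 1))"
proof -
  have x': "1 + x \<notin> \<real>\<^sub>\<le>\<^sub>0"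
    using x by (simp add: D1_iff)
  then have nz: "x + 1 \<noteq> 0"
    by (auto simp: add.commute)
  have e: "1 - (1 - x) / 2 = (x + 1) / 2"
    by (simp add: field_simps)
  have dom: "(1 - x) / 2 \<in> hyp2F1_domain"
    unfolding hyp2F1_domain_iff e using x' by (simp add: complex_nonpos_Reals_iff add.commute)
  have quot: "(1 - x) / 2 / ((1 - x) / 2 - 1) = (x - 1) / (x + 1)"
  proof -
    have 1: "(1 - x) / 2 - 1 = - ((x + 1) / 2)"
      by (simp add: field_simps)
    have 2: "(1 - x) / 2 / - (y / 2) = (x - 1) / y" if "y \<noteq> 0" for y
      using that by (simp add: divide_simps)
    show ?thesis
      unfolding 1 by (rule 2[OF nz])
  qed
  show ?thesis
    unfolding hyp2F1_pfaff[OF c dom] quot e half_powr by (simp add: add.commute diff_diff_eq)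
qed

text \<open>The right-hand side is holomorphic on \<open>D1\<close>, since neither quotient meets
  the cut of the logarithm there. On (-1, 1) all bases are positive, the powers split, and it agrees
  with \<open>ferrers_Q_cut\<close>; so it is the analytic extension.\<close>

theorem theorem3p3:
  fixes x \<nu> \<mu> :: complex
  assumes "x \<in> D1"
    and "\<mu> \<notin> \<int>"
    and "\<And>n::nat. n \<ge> 1 \<Longrightarrow> \<nu> + \<mu> \<noteq> - of_nat n"
  shows "ferrers_Q \<nu> \<mu> x =
    (1 + x) powr \<nu> / 2 powr (\<nu> + 1) *
    (cos (of_real pi * \<mu>) * Gamma \<mu> * ((1 + x) / (1 - x)) powr (\<mu> / 2) *
       hyp2F1 (- \<nu>) (- \<nu> - \<mu>) (1 - \<mu>) ((x - 1) / (x + 1)) +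
     Gamma (\<nu> + \<mu> + 1) * Gamma (- \<mu>) * rGamma (\<nu> - \<mu> + 1) *
       ((1 - x) / (1 + x)) powr (\<mu> / 2) *
       hyp2F1 (- \<nu>) (\<mu> - \<nu>) (1 + \<mu>) ((x - 1) / (x + 1)))"
  unfolding ferrers_Q_def
proof (rule analytic_extension_eqI[where a = "of_real 0"])
  have \<nu>\<mu>: "\<nu> + \<mu> + 1 \<notin> \<int>\<^sub>\<le>\<^sub>0"
  proof
    assume "\<nu> + \<mu> + 1 \<in> \<int>\<^sub>\<le>\<^sub>0"
    then obtain n where "\<nu> + \<mu> + 1 = - of_nat n"
      by (elim nonpos_Ints_cases')
    then have "\<nu> + \<mu> = - of_nat (Suc n)"
      by (simp add: algebra_simps eq_neg_iff_add_eq_0)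
    with assms(3)[of "Suc n"] show False
      by simp
  qed
  note c = one_plus_minus_not_nonpos_Ints[OF assms(2)]
  have hol: "(\<lambda>x. hyp2F1 a b c ((x - 1) / (x + 1))) holomorphic_on D1" if "c \<notin> \<int>\<^sub>\<le>\<^sub>0" for a b c
  proof -
    have "(\<lambda>x. (x - 1) / (x + 1)) holomorphic_on D1"
      by (intro holomorphic_intros) (auto simp: D1_iff add.commute)
    from holomorphic_on_compose_gen[OF this holomorphic_hyp2F1[OF that]] show ?thesis
      using D1_quotients(3) by (auto simp: o_def)
  qed
  show "(\<lambda>x. (1 + x) powr \<nu> / 2 powr (\<nu> + 1) *
    (cos (of_real pi * \<mu>) * Gamma \<mu> * ((1 + x) / (1 - x)) powr (\<mu> / 2) *
       hyp2F1 (- \<nu>) (- \<nu> - \<mu>) (1 - \<mu>) ((x - 1) / (x + 1)) +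
     Gamma (\<nu> + \<mu> + 1) * Gamma (- \<mu>) * rGamma (\<nu> - \<mu> + 1) *
       ((1 - x) / (1 + x)) powr (\<mu> / 2) *
       hyp2F1 (- \<nu>) (\<mu> - \<nu>) (1 + \<mu>) ((x - 1) / (x + 1)))) holomorphic_on D1"
    by (intro holomorphic_intros hol c) (auto simp: D1_iff[symmetric] D1_quotients, auto simp: D1_iff)
  show "(1 + z) powr \<nu> / 2 powr (\<nu> + 1) *
    (cos (of_real pi * \<mu>) * Gamma \<mu> * ((1 + z) / (1 - z)) powr (\<mu> / 2) *
       hyp2F1 (- \<nu>) (- \<nu> - \<mu>) (1 - \<mu>) ((z - 1) / (z + 1)) +
     Gamma (\<nu> + \<mu> + 1) * Gamma (- \<mu>) * rGamma (\<nu> - \<mu> + 1) *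
       ((1 - z) / (1 + z)) powr (\<mu> / 2) *
       hyp2F1 (- \<nu>) (\<mu> - \<nu>) (1 + \<mu>) ((z - 1) / (z + 1))) = ferrers_Q_cut \<nu> \<mu> z"
    if z: "z \<in> of_real ` {-1<..<1}" for z
  proof -
    obtain r where r: "-1 < r" "r < 1" "z = of_real r"
      using z by auto
    then have D: "z \<in> D1"
      by (auto simp: D1_iff complex_nonpos_Reals_iff)
    have e: "1 - \<mu> - \<nu> - 1 = - \<nu> - \<mu>" "1 + \<mu> - \<nu> - 1 = \<mu> - \<nu>"
      by simp_all
    show ?thesis
      unfolding r(3) ferrers_Q_cut_eq[OF assms(2) \<nu>\<mu> r(1,2)] branch_A_def branch_B_def series_A_def series_B_def
        of_real_powr_quotient[OF r(1,2)] hyp2F1_half_pfaff[OF c(1) D[unfolded r(3)]]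
        hyp2F1_half_pfaff[OF c(2) D[unfolded r(3)]] e
      by (simp add: powr_minus powr_add field_simps)
  qed
  show "of_real ` {-1<..<1} \<subseteq> D1"
    by (auto simp: D1_iff complex_nonpos_Reals_iff)
  show "of_real 0 \<in> D1"
    by (auto simp: D1_iff complex_nonpos_Reals_iff)
  show "complex_of_real 0 islimpt of_real ` {-1<..<1}"
    by (rule islimpt_of_real_greaterThanLessThan) auto
qed (use open_D1 connected_D1 assms(1) in auto)

end
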